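(* The Drone-Delivery Packing Problem (DDP) is NP-hard.
   Context: An instance of DDP consists of a set of deliveries $\mathcal{N}=\{1,\dots,n\}$, for each delivery $j$ a closed delivery time interval $I_j=[t_j^L,t_j^R]$ with $t_j^L\le t_j^R$ and an energy cost $c_j$ with $0<c_j\le B$, where $B>0$ is the common battery budget of identical drones. Two intervals are compatible if they are disjoint; a set $S$ of intervals is compatible if its members are pairwise compatible, and feasible if it is compatible and $\sum_{I_j\in S}c_j\le B$. The goal of DDP is to find the minimum number $m$ of drones together with a partition of $\{I_1,\dots,I_n\}$ into $m$ feasible sets (one per drone, each delivery performed by exactly one drone). *)

theory Defs
  imports Main HOL.Rat "HOL-Library.Disjoint_Sets" "HOL-Computational_Algebra.Polynomial"
begin

section \<open>Multi-tape Turing machines\<close>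

text \<open>
  States and tape symbols are natural numbers. The symbol 0 is the blank, 1 and 2 represent the
  input bits 0 and 1, and all other symbols are work symbols. The tapes are infinite in both
  directions; a tape is a pair of its contents and its head position.
\<close>

datatype move = Left | Stay | Right

fun offset :: "move \<Rightarrow> int" where
  "offset Left = -1"
| "offset Stay = 0"
| "offset Right = 1"

type_synonym tape = "(int \<Rightarrow> nat) \<times> int"

text \<open>
  An instruction \<open>(q, rs, q', as)\<close> is applicable in state \<open>q\<close> if the heads read the symbols \<open>rs\<close>;
  it changes the state to \<open>q'\<close> and performs on each tape the corresponding write-and-move action
  in \<open>as\<close>. As the set of instructions is required to be finite, only finitely many states and
  symbols are relevant.
\<close>

type_synonym instr = "nat \<times> nat list \<times> nat \<times> (nat \<times> move) list"

record tm =
  ntapes :: nat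
  start :: nat
  accept :: nat
  instrs :: "instr set"

definition wf_tm :: "tm \<Rightarrow> bool" where
  "wf_tm M \<longleftrightarrow> ntapes M \<ge> 1 \<and> finite (instrs M) \<and>
     (\<forall>(q, rs, q', as) \<in> instrs M. length rs = ntapes M \<and> length as = ntapes M)"

definition deterministic :: "tm \<Rightarrow> bool" where
  "deterministic M \<longleftrightarrow>
     (\<forall>q rs x y. (q, rs, x) \<in> instrs M \<longrightarrow> (q, rs, y) \<in> instrs M \<longrightarrow> x = y)"

type_synonym config = "nat \<times> tape list"

fun read :: "tape \<Rightarrow> nat" where
  "read (f, h) = f h"

fun act :: "nat \<times> move \<Rightarrow> tape \<Rightarrow> tape" where
  "act (s, d) (f, h) = (f(h := s), h + offset d)"

definition step :: "tm \<Rightarrow> config \<Rightarrow> config \<Rightarrow> bool" where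
  "step M c c' \<longleftrightarrow>
     (\<exists>as. (fst c, map read (snd c), fst c', as) \<in> instrs M \<and> snd c' = map2 act as (snd c))"

definition halted :: "tm \<Rightarrow> config \<Rightarrow> bool" where
  "halted M c \<longleftrightarrow> \<not> (\<exists>c'. step M c c')"

definition contents :: "bool list \<Rightarrow> int \<Rightarrow> nat" where
  "contents w i = (if 0 \<le> i \<and> i < int (length w) then if w ! nat i then 2 else 1 else 0)"

text \<open>The input is on the first tape; a computed string is on the last tape.\<close>

definition init :: "tm \<Rightarrow> bool list \<Rightarrow> config" where
  "init M w = (start M, (contents w, 0) # replicate (ntapes M - 1) (contents [], 0))"

definition has_output :: "config \<Rightarrow> bool list \<Rightarrow> bool" where
  "has_output c w \<longleftrightarrow> fst (last (snd c)) = contents w"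


section \<open>NP-hardness\<close>

text \<open>
  A language is in NP if it is decided by a nondeterministic machine all of whose computations
  have polynomially bounded length.
\<close>

definition NP :: "bool list set set" where
  "NP = {L. \<exists>M (p :: nat poly). wf_tm M \<and>
     (\<forall>w t c. (step M ^^ t) (init M w) c \<longrightarrow> t \<le> poly p (length w)) \<and>
     (\<forall>w. w \<in> L \<longleftrightarrow> (\<exists>t c. (step M ^^ t) (init M w) c \<and> fst c = accept M))}"

definition polytime_computable :: "(bool list \<Rightarrow> bool list) \<Rightarrow> bool" where
  "polytime_computable f \<longleftrightarrow> (\<exists>M (p :: nat poly). wf_tm M \<and> deterministic M \<and>
     (\<forall>w. \<exists>t c. t \<le> poly p (length w) \<and> (step M ^^ t) (init M w) c \<and>
                halted M c \<and> has_output c (f w)))"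

definition polytime_reducible :: "bool list set \<Rightarrow> bool list set \<Rightarrow> bool" (infix "\<le>\<^sub>p" 50) where
  "L \<le>\<^sub>p K \<longleftrightarrow> (\<exists>f. polytime_computable f \<and> (\<forall>w. w \<in> L \<longleftrightarrow> f w \<in> K))"

definition NP_hard :: "bool list set \<Rightarrow> bool" where
  "NP_hard K \<longleftrightarrow> (\<forall>L \<in> NP. L \<le>\<^sub>p K)"


section \<open>The Drone-Delivery Packing Problem\<close>

text \<open>
  All data are rational, so that instances are finite objects. The deliveries are indexed by
  \<open>0, \<dots>, n - 1\<close>; feasibility and partitions are about sets of indices, because
  distinct deliveries may have the same interval and cost.
\<close>

record delivery =
  left_end :: rat
  right_end :: rat
  cost :: rat

record ddp_instance =
  budget :: rat
  deliveries :: "delivery list"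

definition valid_instance :: "ddp_instance \<Rightarrow> bool" where
  "valid_instance I \<longleftrightarrow> budget I > 0 \<and>
     (\<forall>d \<in> set (deliveries I). left_end d \<le> right_end d \<and> 0 < cost d \<and> cost d \<le> budget I)"

definition interval :: "ddp_instance \<Rightarrow> nat \<Rightarrow> rat set" where
  "interval I j = {left_end (deliveries I ! j) .. right_end (deliveries I ! j)}"

definition compatible :: "ddp_instance \<Rightarrow> nat set \<Rightarrow> bool" where
  "compatible I S \<longleftrightarrow> (\<forall>i \<in> S. \<forall>j \<in> S. i \<noteq> j \<longrightarrow> interval I i \<inter> interval I j = {})"

definition feasible :: "ddp_instance \<Rightarrow> nat set \<Rightarrow> bool" where
  "feasible I S \<longleftrightarrow> compatible I S \<and> (\<Sum>j\<in>S. cost (deliveries I ! j)) \<le> budget I"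

definition feasible_partition :: "ddp_instance \<Rightarrow> nat set set \<Rightarrow> bool" where
  "feasible_partition I P \<longleftrightarrow>
     partition_on {..<length (deliveries I)} P \<and> (\<forall>S \<in> P. feasible I S)"

definition min_drones :: "ddp_instance \<Rightarrow> nat" where
  "min_drones I = (LEAST m. \<exists>P. feasible_partition I P \<and> card P = m)"

lemma feasible_partition_exists:
  assumes "valid_instance I"
  shows "\<exists>P. feasible_partition I P"
proof
  let ?P = "(\<lambda>j. {j}) ` {..<length (deliveries I)}"
  have "partition_on {..<length (deliveries I)} ?P"
    by (auto simp: partition_on_def disjoint_def)
  moreover have "\<forall>S \<in> ?P. feasible I S"
    using assms by (auto simp: feasible_def compatible_def valid_instance_def)
  ultimately show "feasible_partition I ?P"
    by (simp add: feasible_partition_def)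
qed


subsection \<open>Encoding as binary strings\<close>

text \<open>
  Numbers are written in binary, least significant digit first. Each digit is preceded by \<open>True\<close>
  and the number is terminated by \<open>False\<close>, which makes the code prefix-free.
\<close>

fun enc_nat :: "nat \<Rightarrow> bool list" where
  "enc_nat n = (if n = 0 then [False] else True # odd n # enc_nat (n div 2))"

declare enc_nat.simps [simp del]

definition enc_int :: "int \<Rightarrow> bool list" where
  "enc_int z = (z < 0) # enc_nat (nat \<bar>z\<bar>)"

text \<open>A rational is represented by its normalised numerator and positive denominator.\<close>

definition enc_rat :: "rat \<Rightarrow> bool list" where
  "enc_rat r = enc_int (fst (quotient_of r)) @ enc_int (snd (quotient_of r))"

definition enc_delivery :: "delivery \<Rightarrow> bool list" where
  "enc_delivery d = enc_rat (left_end d) @ enc_rat (right_end d) @ enc_rat (cost d)"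

fun enc_deliveries :: "delivery list \<Rightarrow> bool list" where
  "enc_deliveries [] = [False]"
| "enc_deliveries (d # ds) = True # enc_delivery d @ enc_deliveries ds"

definition encode :: "ddp_instance \<Rightarrow> nat \<Rightarrow> bool list" where
  "encode I k = enc_nat k @ enc_rat (budget I) @ enc_deliveries (deliveries I)"

lemma enc_nat_append_eq_iff: "enc_nat m @ u = enc_nat n @ v \<longleftrightarrow> m = n \<and> u = v"
proof (induction m arbitrary: n rule: less_induct)
  case (less m)
  show ?case
  proof (cases "m = 0 \<or> n = 0")
    case True
    then show ?thesis by (auto simp: enc_nat.simps[of m] enc_nat.simps[of n])
  next
    case False
    then have "enc_nat m @ u = enc_nat n @ v \<longleftrightarrow>
        odd m = odd n \<and> enc_nat (m div 2) @ u = enc_nat (n div 2) @ v"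
      by (subst enc_nat.simps[of m], subst enc_nat.simps[of n]) auto
    also have "\<dots> \<longleftrightarrow> odd m = odd n \<and> m div 2 = n div 2 \<and> u = v"
      using less.IH[of "m div 2" "n div 2"] False by auto
    also have "\<dots> \<longleftrightarrow> m = n \<and> u = v"
      by (metis bit_eq_rec)
    finally show ?thesis .
  qed
qed

lemma enc_int_append_eq_iff: "enc_int y @ u = enc_int z @ v \<longleftrightarrow> y = z \<and> u = v"
  by (auto simp: enc_int_def enc_nat_append_eq_iff)

lemma enc_rat_append_eq_iff: "enc_rat r @ u = enc_rat s @ v \<longleftrightarrow> r = s \<and> u = v"
  by (auto simp: enc_rat_def enc_int_append_eq_iff intro: quotient_of_inject prod_eqI)

lemma enc_delivery_append_eq_iff: "enc_delivery d @ u = enc_delivery e @ v \<longleftrightarrow> d = e \<and> u = v"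
  by (cases d; cases e) (auto simp: enc_delivery_def enc_rat_append_eq_iff)

lemma enc_deliveries_eq_iff: "enc_deliveries ds = enc_deliveries es \<longleftrightarrow> ds = es"
proof (induction ds arbitrary: es)
  case Nil
  then show ?case by (cases es) auto
next
  case (Cons d ds)
  then show ?case by (cases es) (auto simp: enc_delivery_append_eq_iff)
qed

lemma encode_eq_iff: "encode I k = encode J l \<longleftrightarrow> I = J \<and> k = l"
  by (cases I; cases J)
    (auto simp: encode_def enc_nat_append_eq_iff enc_rat_append_eq_iff enc_deliveries_eq_iff)


subsection \<open>The decision problem\<close>

text \<open>
  NP-hardness of an optimisation problem is, as usual, NP-hardness of its decision version: given
  an instance and a bound \<open>k\<close>, is the minimum number of drones at most \<open>k\<close>?
\<close>

definition DDP :: "bool list set" where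
  "DDP = {encode I k | I k. valid_instance I \<and> min_drones I \<le> k}"

end

theory Submission
  imports Defs "HOL-Library.Multiset" "HOL-Library.Countable"
begin

text \<open>
  A computation of a nondeterministic machine is laid out as a sequence of tiles whose rows are the
  successive configurations, shifted so that the head stays in a fixed column; the instruction
  applied in a row travels along the row as a signal. All consistency conditions are equalities of
  colours between the tiles at positions \<open>i\<close> and \<open>i + 1\<close>, or \<open>i\<close> and \<open>i + W\<close>, where \<open>W\<close> is the
  width of a row. Counting colours at all positions at once turns these equalities into a single
  equation between numbers in a large base. It becomes an instance with two drones: for every
  position and tile there are two deliveries at the same point in time, so each drone gets exactly
  one of them, and as all costs add up to twice the budget, both drones are filled exactly.

  The digits of all numbers depend only on regions of the layout. Therefore the encoded
  instance is written by a program with for-loops over append-only tapes, and such programs compile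
  to deterministic Turing machines whose running time is polynomial in the lengths of the tapes
  that control loops.
\<close>

section \<open>For-loop programs over append-only tapes\<close>

text \<open>Comparing colours calls for subtraction, but costs are positive: the delivery for
  leaving a tile out carries its east and north colours, and as their sum over all tiles is known,
  this amounts to subtracting the colours of the placed tiles. No cost says directly that a position
  holds exactly one tile; this follows by counting, since block 0 admits one west colour and every
  later block has as many west colours as there are east colours to its left. Base \<open>Y\<close>
  exceeds the number of colours meeting in a block, and base \<open>X\<close> their weights, so
  nothing carries. As \<open>X\<close> is a power of two, a block is a fixed piece of the binary
  code, and long numbers are written by loops over unary tapes without arithmetic; the points in
  time are powers of two for the same reason. Tiles and bases depend on the machine alone: the input
  enters through the south colours of the first row, its length through the number of blocks. Since
  the rows form one long line, the last cell of a row is the left neighbour of the first cell of the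
  next; this spoils only columns too far from the head to matter.\<close>

datatype com = Skip | Put nat bool | Seq com com | For nat com com

type_synonym store = "nat \<Rightarrow> bool list"

primrec exec :: "com \<Rightarrow> store \<Rightarrow> store" where
  "exec Skip = (\<lambda>s. s)"
| "exec (Put x b) = (\<lambda>s. s(x := s x @ [b]))"
| "exec (Seq c d) = (\<lambda>s. exec d (exec c s))"
| "exec (For x c d) = (\<lambda>s. fold (\<lambda>b. if b then exec d else exec c) (s x) s)"

primrec used :: "com \<Rightarrow> nat set" where
  "used Skip = {}"
| "used (Put x b) = {x}"
| "used (Seq c d) = used c \<union> used d"
| "used (For x c d) = insert x (used c \<union> used d)"

primrec loops :: "com \<Rightarrow> nat set" where
  "loops Skip = {}"
| "loops (Put x b) = {}"
| "loops (Seq c d) = loops c \<union> loops d"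
| "loops (For x c d) = insert x (loops c \<union> loops d)"

text \<open>A controlling tape must not occur in the body, neither as a target of \<open>Put\<close>
  nor as the control of an inner loop: its head marks the progress of the loop.\<close>

primrec wf_com :: "com \<Rightarrow> bool" where
  "wf_com Skip \<longleftrightarrow> True"
| "wf_com (Put x b) \<longleftrightarrow> True"
| "wf_com (Seq c d) \<longleftrightarrow> wf_com c \<and> wf_com d"
| "wf_com (For x c d) \<longleftrightarrow> x \<notin> used c \<union> used d \<and> wf_com c \<and> wf_com d"

text \<open>The variable bounds the lengths \<open>m\<close> of all loop tapes. A loop takes one
  step to leave the end, at most \<open>m + 1\<close> steps to rewind, two steps per iteration
  besides the body, and one step to exit. Adding both branches avoids a maximum.\<close>

primrec time_bound :: "com \<Rightarrow> nat poly" where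
  "time_bound Skip = 0"
| "time_bound (Put x b) = 1"
| "time_bound (Seq c d) = time_bound c + time_bound d"
| "time_bound (For x c d) = [:3, 1:] + [:0, 1:] * (time_bound c + time_bound d + 2)"

text \<open>Tapes never shrink, so a bound on the final lengths also bounds the number of iterations
  of every loop met on the way.\<close>

lemma length_exec_mono: "length (s x) \<le> length (exec c s x)"
proof (induction c arbitrary: s)
  case (Seq c d)
  then show ?case by (metis exec.simps(3) order_trans)
next
  case (For y c d)
  have "length (s x) \<le> length (fold (\<lambda>b. if b then exec d else exec c) bs s x)" for bs
  proof (induction bs arbitrary: s)
    case (Cons b bs)
    have "length (s x) \<le> length ((if b then exec d else exec c) s x)"
      using For.IH by simp
    also have "\<dots> \<le> length (fold (\<lambda>b. if b then exec d else exec c) (b # bs) s x)"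
      using Cons by simp
    finally show ?case .
  qed simp
  then show ?case by simp
qed auto

lemma length_fold_exec_mono:
  "length (s x) \<le> length (fold (\<lambda>b. if b then exec d else exec c) bs s x)"
proof (induction bs arbitrary: s)
  case (Cons b bs)
  have "length (s x) \<le> length ((if b then exec d else exec c) s x)"
    using length_exec_mono by simp
  also have "\<dots> \<le> length (fold (\<lambda>b. if b then exec d else exec c) (b # bs) s x)"
    using Cons by simp
  finally show ?case .
qed simp

lemma exec_unused: "x \<notin> used c \<Longrightarrow> exec c s x = s x"
proof (induction c arbitrary: s)
  case (For y c d)
  have "fold (\<lambda>b. if b then exec d else exec c) bs s x = s x" for bs
    by (induction bs arbitrary: s) (use For in auto)
  then show ?case by simp
qed auto

subsection \<open>Flat programs\<close>

text \<open>
  State \<open>q\<close> of a flat program inspects only the tape named in its \<open>q\<close>-th entry; the position just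
  behind the last entry is the halting state.
\<close>

type_synonym flat = "(nat \<times> (nat \<Rightarrow> nat \<times> move \<times> nat)) list"

inductive fstep :: "flat \<Rightarrow> nat \<times> (nat \<Rightarrow> tape) \<Rightarrow> nat \<times> (nat \<Rightarrow> tape) \<Rightarrow> bool" for F where
  "q < length F \<Longrightarrow> F ! q = (x, \<delta>) \<Longrightarrow> \<delta> (read (T x)) = (s, d, q') \<Longrightarrow>
   fstep F (q, T) (q', T(x := act (s, d) (T x)))"

text \<open>For a loop, \<open>a\<close> steps off the blank behind the word, \<open>a + 1\<close>
  rewinds to the blank in front of it, and \<open>a + 2\<close> branches: the blank exits with the
  head back at the end, the symbols 1 and 2 enter the bodies at \<open>a + 3\<close> and
  \<open>a'\<close>. The instruction behind each body advances the head and returns to the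
  test.\<close>

fun compile :: "com \<Rightarrow> nat \<Rightarrow> flat" where
  "compile Skip a = []"
| "compile (Put x b) a = [(x, \<lambda>s. (if b then 2 else 1, Right, a + 1))]"
| "compile (Seq c d) a =
     (let C = compile c a in C @ compile d (a + length C))"
| "compile (For x c d) a =
     (let C = compile c (a + 3); a' = a + 4 + length C;
          D = compile d a'; a'' = a' + length D + 1
      in [(x, \<lambda>s. (s, Left, a + 1)),
          (x, \<lambda>s. if s = 0 then (s, Right, a + 2) else (s, Left, a + 1)),
          (x, \<lambda>s. (s, Stay, if s = 0 then a'' else if s = 1 then a + 3 else a'))] @
         C @ [(x, \<lambda>s. (s, Right, a + 2))] @ D @ [(x, \<lambda>s. (s, Right, a + 2))])"

definition at_end :: "bool list \<Rightarrow> tape" where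
  "at_end w = (contents w, int (length w))"

lemma act_at_end: "act (if b then 2 else 1, Right) (at_end w) = at_end (w @ [b])"
  by (auto simp: at_end_def contents_def fun_eq_iff nth_append)

lemma contents_eq_0_iff: "contents w i = 0 \<longleftrightarrow> i < 0 \<or> int (length w) \<le> i"
  by (auto simp: contents_def)

definition code_at :: "flat \<Rightarrow> nat \<Rightarrow> flat \<Rightarrow> bool" where
  "code_at F a C \<longleftrightarrow> (\<exists>A B. F = A @ C @ B \<and> length A = a)"

lemma code_at_append:
  "code_at F a (C @ D) \<Longrightarrow> code_at F a C \<and> code_at F (a + length C) D"
proof -
  assume "code_at F a (C @ D)"
  then obtain A B where F: "F = A @ (C @ D) @ B" "length A = a"
    by (auto simp: code_at_def)
  have "F = A @ C @ (D @ B)" "F = (A @ C) @ D @ B" using F by simp_all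
  moreover have "length (A @ C) = a + length C" using F(2) by simp
  ultimately show ?thesis using F(2) unfolding code_at_def by blast
qed

lemma code_at_Cons:
  "code_at F a (i # C) \<Longrightarrow> a < length F \<and> F ! a = i \<and> code_at F (a + 1) C"
proof -
  assume "code_at F a (i # C)"
  then have "code_at F a ([i] @ C)" by simp
  from code_at_append[OF this] have "code_at F a [i]" "code_at F (a + 1) C" by simp_all
  moreover from this(1) have "a < length F \<and> F ! a = i"
    unfolding code_at_def by (auto simp: nth_append)
  ultimately show ?thesis by simp
qed

lemma fstepI:
  assumes "a < length F \<and> F ! a = (x, \<delta>)" "T x = (f, i)" "\<delta> (f i) = (f i, d, q')"
  shows "fstep F (a, T) (q', T(x := (f, i + offset d)))"
  using fstep.intros[of a F x \<delta> T "f i" d q'] assms by simp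

lemma relpowp_Suc_0I:
  fixes R :: "'a \<Rightarrow> 'a \<Rightarrow> bool"
  shows "R x y \<Longrightarrow> (R ^^ Suc 0) x y"
  by auto

lemma rewind:
  assumes "q < length F \<and> F ! q = (x, \<lambda>s. if s = 0 then (s, Right, q') else (s, Left, q))"
  shows "i \<le> length w \<Longrightarrow> T x = (contents w, int i - 1) \<Longrightarrow>
    (fstep F ^^ (i + 1)) (q, T) (q', T(x := (contents w, 0)))"
proof (induction i arbitrary: T)
  case 0
  have "fstep F (q, T) (q', T(x := (contents w, int 0 - 1 + offset Right)))"
    by (rule fstepI[OF assms]) (use 0 in \<open>auto simp: contents_def\<close>)
  then show ?case by (auto simp: fun_upd_def)
next
  case (Suc i)
  let ?T = "T(x := (contents w, int (Suc i) - 1 + offset Left))"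
  have "fstep F (q, T) (q, ?T)"
    by (rule fstepI[OF assms]) (use Suc in \<open>auto simp: contents_eq_0_iff\<close>)
  moreover have "(fstep F ^^ (i + 1)) (q, ?T) (q', ?T(x := (contents w, 0)))"
    using Suc by (intro Suc.IH) auto
  ultimately have "(fstep F ^^ Suc (i + 1)) (q, T) (q', ?T(x := (contents w, 0)))"
    by (rule relpowp_Suc_I2)
  then show ?case by (simp only: fun_upd_upd add_Suc)
qed

text \<open>Only tapes in \<open>used c\<close> must have their heads at the end, and all others are
  preserved; so a body can run while the head of the controlling tape stands inside its
  word.\<close>

lemma compile_correct:
  assumes "wf_com c" "code_at F a (compile c a)"
    and "\<forall>x \<in> used c. T x = at_end (s x)"
    and "\<forall>x \<in> loops c. length (exec c s x) \<le> m"
  shows "\<exists>t \<le> poly (time_bound c) m. (fstep F ^^ t) (a, T)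
    (a + length (compile c a), \<lambda>x. if x \<in> used c then at_end (exec c s x) else T x)"
  using assms
proof (induction c arbitrary: a T s)
  case Skip
  then show ?case by (intro exI[of _ 0]) simp
next
  case (Put x b)
  have "fstep F (a, T) (a + 1, T(x := act (if b then 2 else 1, Right) (T x)))"
    using code_at_Cons[of F a] Put by (intro fstep.intros) auto
  also have "T(x := act (if b then 2 else 1, Right) (T x)) =
      (\<lambda>y. if y \<in> used (Put x b) then at_end (exec (Put x b) s y) else T y)"
    using Put act_at_end[of b "s x"] by (auto simp: fun_eq_iff)
  finally have "(fstep F ^^ 1) (a, T) (a + 1, \<lambda>y. if y \<in> used (Put x b)
      then at_end (exec (Put x b) s y) else T y)"
    unfolding One_nat_def by (rule relpowp_Suc_0I)
  then show ?case by (intro exI[of _ 1]) simp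
next
  case (Seq c d)
  let ?T = "\<lambda>x. if x \<in> used c then at_end (exec c s x) else T x"
  let ?a = "a + length (compile c a)"
  have code: "code_at F a (compile c a)" "code_at F ?a (compile d ?a)"
    using code_at_append Seq.prems(2) by (auto simp: Let_def)
  have "\<forall>x \<in> loops c. length (exec c s x) \<le> m"
    using Seq.prems(4) length_exec_mono[of "exec c s" _ d] by (fastforce intro: order_trans)
  then obtain t1 where t1: "t1 \<le> poly (time_bound c) m" "(fstep F ^^ t1) (a, T) (?a, ?T)"
    using Seq.IH(1)[of a T s] Seq.prems code by auto
  have "\<forall>x \<in> used d. ?T x = at_end (exec c s x)"
    using Seq.prems(3) by (auto simp: exec_unused)
  then obtain t2 where t2: "t2 \<le> poly (time_bound d) m" "(fstep F ^^ t2) (?a, ?T)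
      (?a + length (compile d ?a), \<lambda>x. if x \<in> used d then at_end (exec d (exec c s) x) else ?T x)"
    using Seq.IH(2)[of ?a ?T "exec c s"] Seq.prems code by auto
  have "(\<lambda>x. if x \<in> used d then at_end (exec d (exec c s) x) else ?T x) =
      (\<lambda>x. if x \<in> used (Seq c d) then at_end (exec (Seq c d) s x) else T x)"
    by (auto simp: fun_eq_iff exec_unused)
  then show ?case
    using t1 t2 relpowp_trans[OF t1(2) t2(2)]
    by (intro exI[of _ "t1 + t2"]) (auto simp: Let_def add.assoc)
next
  case (For x c d)
  define C where "C = compile c (a + 3)"
  define a' where "a' = a + 4 + length C"
  define D where "D = compile d a'"
  define a'' where "a'' = a' + length D + 1"
  let ?B = "\<lambda>b. if b then exec d else exec c"
  let ?U = "used c \<union> used d"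
  have x: "x \<notin> ?U" using For.prems(1) by auto
  have len: "a + length (compile (For x c d) a) = a''"
    by (simp add: Let_def C_def[symmetric] a'_def[symmetric] D_def[symmetric] a''_def) 
      (simp add: a'_def)
  have "code_at F a ([(x, \<lambda>s. (s, Left, a + 1)),
          (x, \<lambda>s. if s = 0 then (s, Right, a + 2) else (s, Left, a + 1)),
          (x, \<lambda>s. (s, Stay, if s = 0 then a'' else if s = 1 then a + 3 else a'))] @
         C @ [(x, \<lambda>s. (s, Right, a + 2))] @ D @ [(x, \<lambda>s. (s, Right, a + 2))])"
    using For.prems(2) unfolding compile.simps Let_def a''_def D_def a'_def C_def .
  note code_at_append[OF this]
  then have 1: "a < length F \<and> F ! a = (x, \<lambda>s. (s, Left, a + 1))"
    and 2: "a + 1 < length F \<and> F ! (a + 1) =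
      (x, \<lambda>s. if s = 0 then (s, Right, a + 2) else (s, Left, a + 1))"
    and 3: "a + 2 < length F \<and> F ! (a + 2) =
      (x, \<lambda>s. (s, Stay, if s = 0 then a'' else if s = 1 then a + 3 else a'))"
    and r1: "code_at F (a + 3) (C @ [(x, \<lambda>s. (s, Right, a + 2))] @ D @ [(x, \<lambda>s. (s, Right, a + 2))])"
    by (auto dest!: code_at_Cons simp: numeral_3_eq_3)
  note r2 = code_at_append[OF r1]
  then have C: "code_at F (a + 3) C"
    and "code_at F (a + 3 + length C) ([(x, \<lambda>s. (s, Right, a + 2))] @ D @ [(x, \<lambda>s. (s, Right, a + 2))])"
    by auto
  note r3 = code_at_append[OF this(2)]
  then have 4: "a + 3 + length C < length F \<and> F ! (a + 3 + length C) = (x, \<lambda>s. (s, Right, a + 2))"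
    by (auto dest: code_at_Cons)
  have "code_at F a' (D @ [(x, \<lambda>s. (s, Right, a + 2))])"
    using r3 by (auto simp: a'_def eval_nat_numeral)
  note r4 = code_at_append[OF this]
  then have D: "code_at F a' D"
    and 5: "a' + length D < length F \<and> F ! (a' + length D) = (x, \<lambda>s. (s, Right, a + 2))"
    by (auto dest: code_at_Cons)
  let ?w = "s x"
  define p where "p = poly (time_bound c) m + poly (time_bound d) m + 2"
  \<comment> \<open>Invariant of the test state: \<open>u\<close> has been processed and
    \<open>v\<close> remains.\<close>
  have loop: "\<exists>t \<le> length v * p + 1. (fstep F ^^ t) (a + 2, T1)
      (a'', \<lambda>y. if y \<in> ?U then at_end (fold ?B v s1 y) else if y = x then at_end ?w else T1 y)"
    if "?w = u @ v" "T1 x = (contents ?w, int (length u))"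
      "\<forall>y \<in> ?U. T1 y = at_end (s1 y)"
      "\<forall>y \<in> loops (For x c d). length (fold ?B v s1 y) \<le> m" for u v T1 s1
    using that
  proof (induction v arbitrary: u T1 s1)
    case Nil
    have "fstep F (a + 2, T1) (a'', T1(x := (contents ?w, int (length u) + offset Stay)))"
      by (rule fstepI[OF 3]) (use Nil in \<open>auto simp: contents_def\<close>)
    also have "T1(x := (contents ?w, int (length u) + offset Stay)) =
        (\<lambda>y. if y \<in> ?U then at_end (fold ?B [] s1 y) else if y = x then at_end ?w else T1 y)"
      using Nil x by (auto simp: fun_eq_iff at_end_def)
    finally show ?case by (intro exI[of _ "Suc 0"] conjI relpowp_Suc_0I) auto
  next
    case (Cons b v)
    have cb: "contents ?w (int (length u)) = (if b then 2 else 1)"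
      using Cons.prems(1) by (auto simp: contents_def)
    let ?q = "if b then a' else a + 3"
    have s1: "fstep F (a + 2, T1) (?q, T1(x := (contents ?w, int (length u) + offset Stay)))"
      by (rule fstepI[OF 3]) (use Cons.prems cb in auto)
    have T1x: "T1(x := (contents ?w, int (length u) + offset Stay)) = T1"
      using Cons.prems by (auto simp: fun_eq_iff)
    define e where "e = (if b then d else c)"
    have ee: "exec e = (if b then exec d else exec c)" by (simp add: e_def)
    have ue: "used e \<subseteq> ?U" by (auto simp: e_def)
    define E where "E = compile e ?q"
    let ?T2 = "\<lambda>y. if y \<in> used e then at_end (exec e s1 y) else T1 y"
    have "\<forall>y\<in>loops e. length (exec e s1 y) \<le> m"
    proof
      fix y assume "y \<in> loops e"
      then have "length (fold ?B (b # v) s1 y) \<le> m" using Cons.prems(4) 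
        by (auto simp: e_def split: if_splits)
      moreover have "length (exec e s1 y) \<le> length (fold ?B (b # v) s1 y)"
        using length_fold_exec_mono[of "exec e s1" y d c v] by (cases b) (simp_all add: e_def)
      ultimately show "length (exec e s1 y) \<le> m" by simp
    qed
    then have "\<exists>t \<le> poly (time_bound e) m. (fstep F ^^ t) (?q, T1) (?q + length E, ?T2)"
    proof (cases b)
      case True
      then have "e = d" by (simp add: e_def)
      then show ?thesis
        using \<open>\<forall>y\<in>loops e. _ y\<close> True For.IH(2)[of a' T1 s1] For.prems(1) D Cons.prems(3)
        by (simp add: E_def D_def cong: if_cong)
    next
      case False
      then have "e = c" by (simp add: e_def)
      then show ?thesis
        using \<open>\<forall>y\<in>loops e. _ y\<close> False For.IH(1)[of "a + 3" T1 s1] For.prems(1) C Cons.prems(3)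
        by (simp add: E_def C_def cong: if_cong)
    qed
    then obtain t1 where t1: "t1 \<le> poly (time_bound e) m"
      "(fstep F ^^ t1) (?q, T1) (?q + length E, ?T2)" by auto
    have xe: "x \<notin> used e" using x by (auto simp: e_def)
    have q: "?q + length E < length F \<and> F ! (?q + length E) = (x, \<lambda>s. (s, Right, a + 2))"
      using 4 5 by (auto simp: e_def E_def C_def D_def)
    let ?T3 = "?T2(x := (contents ?w, int (length u) + offset Right))"
    have s2: "fstep F (?q + length E, ?T2) (a + 2, ?T3)"
      by (rule fstepI[OF q]) (use Cons.prems xe in auto)
    have "\<exists>t \<le> length v * p + 1. (fstep F ^^ t) (a + 2, ?T3)
      (a'', \<lambda>y. if y \<in> ?U then at_end (fold ?B v (exec e s1) y)
                else if y = x then at_end ?w else ?T3 y)"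
    proof (rule Cons.IH[of "u @ [b]"])
      show "\<forall>y\<in>?U. ?T3 y = at_end (exec e s1 y)"
        using Cons.prems(3) x by (auto simp: exec_unused)
      show "\<forall>y\<in>loops (For x c d). length (fold ?B v (exec e s1) y) \<le> m"
        using Cons.prems(4) by (simp add: ee)
    qed (use Cons.prems in auto)
    then obtain t2 where t2: "t2 \<le> length v * p + 1" "(fstep F ^^ t2) (a + 2, ?T3)
      (a'', \<lambda>y. if y \<in> ?U then at_end (fold ?B v (exec e s1) y)
                else if y = x then at_end ?w else ?T3 y)" by auto
    have "(\<lambda>y. if y \<in> ?U then at_end (fold ?B v (exec e s1) y)
                else if y = x then at_end ?w else ?T3 y) =
      (\<lambda>y. if y \<in> ?U then at_end (fold ?B (b # v) s1 y) else if y = x then at_end ?w else T1 y)"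
      using ue by (auto simp: fun_eq_iff ee)
    then have "(fstep F ^^ (1 + t1 + 1 + t2)) (a + 2, T1) (a'',
      \<lambda>y. if y \<in> ?U then at_end (fold ?B (b # v) s1 y) else if y = x then at_end ?w else T1 y)"
      using relpowp_trans[OF relpowp_trans[OF relpowp_trans[OF
        relpowp_Suc_0I[of "fstep F", OF s1[unfolded T1x]] t1(2)] relpowp_Suc_0I[of "fstep F", OF s2]] t2(2)]
      by (simp only: One_nat_def)
    moreover have "1 + t1 + 1 + t2 \<le> length (b # v) * p + 1"
      using t1(1) t2(1) by (auto simp: p_def e_def split: if_splits)
    ultimately show ?case by blast
  qed
  have Tx: "T x = (contents ?w, int (length ?w))" using For.prems(3) by (simp add: at_end_def)
  let ?T1 = "T(x := (contents ?w, int (length ?w) + offset Left))"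
  have s1: "fstep F (a, T) (a + 1, ?T1)" by (rule fstepI[OF 1]) (use Tx in auto)
  have s2: "(fstep F ^^ (length ?w + 1)) (a + 1, ?T1) (a + 2, ?T1(x := (contents ?w, 0)))"
    by (rule rewind[OF 2]) auto
  have "\<exists>t \<le> length ?w * p + 1. (fstep F ^^ t) (a + 2, ?T1(x := (contents ?w, 0)))
      (a'', \<lambda>y. if y \<in> ?U then at_end (fold ?B ?w s y) else if y = x then at_end ?w
                else (?T1(x := (contents ?w, 0))) y)"
    by (rule loop[of "[]"]) (use For.prems x in auto)
  then obtain t where t: "t \<le> length ?w * p + 1" and
    s3: "(fstep F ^^ t) (a + 2, ?T1(x := (contents ?w, 0)))
      (a'', \<lambda>y. if y \<in> ?U then at_end (fold ?B ?w s y) else if y = x then at_end ?w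
                else (?T1(x := (contents ?w, 0))) y)"
    by blast
  have eq: "(\<lambda>y. if y \<in> ?U then at_end (fold ?B ?w s y) else if y = x then at_end ?w
                else (?T1(x := (contents ?w, 0))) y) =
      (\<lambda>y. if y \<in> used (For x c d) then at_end (exec (For x c d) s y) else T y)"
  proof -
    have "exec (For x c d) s x = s x"
    proof -
      have "fold ?B bs r x = r x" for bs r
        by (induction bs arbitrary: r) (use x in \<open>auto simp: exec_unused\<close>)
      then show ?thesis by simp
    qed
    then show ?thesis using x by (auto simp: fun_eq_iff)
  qed
  note steps = relpowp_trans[OF relpowp_trans[OF relpowp_Suc_0I[of "fstep F", OF s1] s2] s3, unfolded eq]
  have "length ?w \<le> m"
    using For.prems(4) length_exec_mono[of s x "For x c d"] by (auto intro: order_trans)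
  then have "Suc 0 + (length ?w + 1) + t \<le> 3 + m + m * p"
    using t mult_le_mono1[of "length ?w" m p] by linarith
  also have "\<dots> = poly (time_bound (For x c d)) m"
    by (simp add: p_def algebra_simps)
  finally show ?case using steps unfolding len by blast
qed

subsection \<open>From flat programs to Turing machines\<close>

text \<open>A flat state looks at tape \<open>x\<close> only, but a machine instruction fixes all
  symbols read. Hence there is one instruction for every tuple \<open>rs\<close>, and it rewrites on
  the other tapes what it has read.\<close>

definition flat_instr :: "flat \<Rightarrow> nat \<Rightarrow> nat \<times> nat list \<Rightarrow> instr" where
  "flat_instr F K = (\<lambda>(q, rs). case F ! q of (x, \<delta>) \<Rightarrow> case \<delta> (rs ! x) of (s, d, q') \<Rightarrow>
     (q, rs, q', map (\<lambda>i. if i = x then (s, d) else (rs ! i, Stay)) [0..<K]))"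

definition tm_of :: "flat \<Rightarrow> nat \<Rightarrow> tm" where
  "tm_of F K = \<lparr>ntapes = K, start = 0, accept = 0,
     instrs = flat_instr F K ` ({..<length F} \<times> {rs. set rs \<subseteq> {..2} \<and> length rs = K})\<rparr>"

lemma wf_tm_of: "0 < K \<Longrightarrow> wf_tm (tm_of F K)"
  by (auto simp: wf_tm_def tm_of_def flat_instr_def finite_lists_length_eq split: prod.splits)

lemma deterministic_tm_of: "deterministic (tm_of F K)"
  by (auto simp: deterministic_def tm_of_def flat_instr_def split: prod.splits)

lemma halted_tm_of: "length F \<le> q \<Longrightarrow> halted (tm_of F K) (q, ts)"
  by (auto simp: halted_def step_def tm_of_def flat_instr_def split: prod.splits)

definition wf_flat :: "nat \<Rightarrow> flat \<Rightarrow> bool" where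
  "wf_flat K F \<longleftrightarrow> (\<forall>(x, \<delta>) \<in> set F. x < K \<and> (\<forall>s \<le> 2. fst (\<delta> s) \<le> 2))"

lemma act_read: "act (read t, Stay) t = t"
  by (cases t) simp

text \<open>The bound 2 on tape symbols has to be carried along, because \<open>tm_of\<close> has
  instructions for tuples over these symbols only.\<close>

lemma step_tm_of:
  assumes "wf_flat K F" "fstep F (q, T) (q', T')" "\<forall>x i. fst (T x) i \<le> 2"
  shows "step (tm_of F K) (q, map T [0..<K]) (q', map T' [0..<K]) \<and> (\<forall>x i. fst (T' x) i \<le> 2)"
  using assms(2)
proof cases
  case (1 x \<delta> s d)
  have "F ! q \<in> set F" using 1(2) nth_mem by blast
  then have x: "x < K" "\<forall>s \<le> 2. fst (\<delta> s) \<le> 2"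
    using assms(1) 1 by (auto simp: wf_flat_def)
  have r: "read (T y) \<le> 2" for y
    using assms(3) by (cases "T y") (metis fst_conv read.simps)
  let ?rs = "map read (map T [0..<K])"
  let ?as = "map (\<lambda>i. if i = x then (s, d) else (?rs ! i, Stay)) [0..<K]"
  have "(q, ?rs, q', ?as) = flat_instr F K (q, ?rs)"
    using 1 x by (simp add: flat_instr_def)
  then have "(q, ?rs, q', ?as) \<in> instrs (tm_of F K)"
    using 1 r by (auto simp: tm_of_def intro!: image_eqI[of _ _ "(q, ?rs)"])
  moreover have "map T' [0..<K] = map2 act ?as (map T [0..<K])"
    by (intro nth_equalityI) (auto simp: 1 act_read)
  ultimately have "step (tm_of F K) (q, map T [0..<K]) (q', map T' [0..<K])"
    by (auto simp: step_def)
  moreover have "fst (T' y) i \<le> 2" for y i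
  proof -
    have "s \<le> 2" using x(2) r[of x] 1 by (metis fst_conv)
    then show ?thesis using assms(3) 1 by (cases "T x") (auto, metis fst_conv)
  qed
  ultimately show ?thesis by blast
qed

lemma steps_tm_of:
  assumes "wf_flat K F" "(fstep F ^^ t) (q, T) (q', T')" "\<forall>x i. fst (T x) i \<le> 2"
  shows "(step (tm_of F K) ^^ t) (q, map T [0..<K]) (q', map T' [0..<K]) \<and>
    (\<forall>x i. fst (T' x) i \<le> 2)"
  using assms(2)
proof (induction t arbitrary: q' T')
  case 0
  then show ?case using assms(3) by auto
next
  case (Suc t)
  then obtain q1 T1 where "(fstep F ^^ t) (q, T) (q1, T1)" "fstep F (q1, T1) (q', T')"
    by auto
  then show ?case using Suc.IH[of q1 T1] step_tm_of[OF assms(1)] by auto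
qed

lemma wf_flat_append: "wf_flat K (F @ G) \<longleftrightarrow> wf_flat K F \<and> wf_flat K G"
  by (auto simp: wf_flat_def)

lemma wf_flat_Cons: "wf_flat K ((x, \<delta>) # F) \<longleftrightarrow> x < K \<and> (\<forall>s \<le> 2. fst (\<delta> s) \<le> 2) \<and> wf_flat K F"
  by (auto simp: wf_flat_def)

lemma wf_flat_Nil: "wf_flat K []"
  by (auto simp: wf_flat_def)

lemma wf_flat_compile: "used c \<subseteq> {..<K} \<Longrightarrow> wf_flat K (compile c a)"
  by (induction c arbitrary: a) (auto simp: wf_flat_append wf_flat_Cons wf_flat_Nil Let_def)

text \<open>Initially the head of tape 0 is on the first input symbol, while programs expect it
  behind the word. On the empty tapes both places coincide.\<close>

definition scan :: "nat \<times> (nat \<Rightarrow> nat \<times> move \<times> nat)" where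
  "scan = (0, \<lambda>s. if s = 0 then (0, Stay, 1) else (s, Right, 0))"

lemma scan_correct:
  assumes "F = scan # C"
  shows "i \<le> length w \<Longrightarrow> T 0 = (contents w, int (length w - i)) \<Longrightarrow>
    (fstep F ^^ Suc i) (0, T) (1, T(0 := at_end w))"
proof (induction i arbitrary: T)
  case 0
  have "fstep F (0, T) (1, T(0 := (contents w, int (length w) + offset Stay)))"
    by (rule fstepI[where \<delta> = "snd scan"]) (use assms 0 in \<open>auto simp: scan_def contents_def\<close>)
  then show ?case by (auto simp: fun_upd_def at_end_def)
next
  case (Suc i)
  let ?T = "T(0 := (contents w, int (length w - Suc i) + offset Right))"
  have s: "fstep F (0, T) (0, ?T)"
    by (rule fstepI[where \<delta> = "snd scan"]) (use assms Suc.prems in \<open>auto simp: scan_def contents_eq_0_iff\<close>)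
  have "(fstep F ^^ Suc i) (0, ?T) (1, ?T(0 := at_end w))"
    by (rule Suc.IH) (use Suc.prems in auto)
  with s have "(fstep F ^^ Suc (Suc i)) (0, T) (1, ?T(0 := at_end w))"
    by (rule relpowp_Suc_I2)
  then show ?case by (simp only: fun_upd_upd)
qed

definition input :: "bool list \<Rightarrow> store" where
  "input w = (\<lambda>_. [])(0 := w)"

text \<open>The running time depends only on the tapes that control loops, so no bound is asked for
  the output tape \<open>K - 1\<close>.\<close>

theorem polytime_computable_exec:
  assumes "wf_com c" "used c \<subseteq> {..<K}" "0 < K"
    and "\<And>w x. x \<in> loops c \<Longrightarrow> length (exec c (input w) x) \<le> poly p (length w)"
  shows "polytime_computable (\<lambda>w. exec c (input w) (K - 1))"
proof -
  define F where "F = scan # compile c 1"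
  let ?M = "tm_of F K"
  \<comment> \<open>The first summand pays for the \<open>n + 1\<close> steps of
    \<open>scan\<close>.\<close>
  let ?p = "[:1, 1:] + pcompose (time_bound c) p"
  have wf: "wf_flat K F"
    using wf_flat_compile[OF assms(2)] assms(3) by (auto simp: wf_flat_def F_def scan_def)
  have "\<exists>t c'. t \<le> poly ?p (length w) \<and> (step ?M ^^ t) (init ?M w) c' \<and> halted ?M c' \<and>
    has_output c' (exec c (input w) (K - 1))" for w
  proof -
    let ?n = "length w"
    define T0 where "T0 = (\<lambda>x :: nat. if x = 0 then (contents w, 0) else (contents [], 0 :: int))"
    define T1 where "T1 = (\<lambda>x. at_end (input w x))"
    define T2 where "T2 = (\<lambda>x. if x \<in> used c then at_end (exec c (input w) x) else T1 x)"
    have "(fstep F ^^ Suc ?n) (0, T0) (1, T0(0 := at_end w))"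
      by (rule scan_correct[OF F_def]) (auto simp: T0_def)
    also have "T0(0 := at_end w) = T1"
      by (auto simp: T0_def T1_def input_def at_end_def)
    finally have s1: "(fstep F ^^ Suc ?n) (0, T0) (1, T1)" .
    have code: "code_at F 1 (compile c 1)"
      unfolding code_at_def F_def by (intro exI[of _ "[scan]"] exI[of _ "[]"]) auto
    obtain t where t: "t \<le> poly (time_bound c) (poly p ?n)"
      and s2: "(fstep F ^^ t) (1, T1) (1 + length (compile c 1), T2)"
      using compile_correct[OF assms(1) code, of T1 "input w" "poly p ?n"] assms(4)
      by (auto simp: T1_def T2_def)
    have le2: "\<forall>x i. fst (T0 x) i \<le> 2" by (auto simp: T0_def contents_def)
    have T2: "T2 = (\<lambda>x. at_end (exec c (input w) x))"
      by (auto simp: T2_def T1_def exec_unused fun_eq_iff)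
    have "map T0 [0..<K] = (contents w, 0) # replicate (K - 1) (contents [], 0)"
      by (rule nth_equalityI) (use assms(3) in \<open>auto simp: T0_def nth_Cons split: nat.splits\<close>)
    then have init: "init ?M w = (0, map T0 [0..<K])"
      by (simp add: init_def tm_of_def)
    have "Suc ?n + t \<le> poly ?p ?n"
      using t by (simp add: poly_pcompose)
    moreover have "(step ?M ^^ (Suc ?n + t)) (init ?M w) (1 + length (compile c 1), map T2 [0..<K])"
      using steps_tm_of[OF wf relpowp_trans[OF s1 s2] le2] unfolding init by blast
    moreover have "halted ?M (1 + length (compile c 1), map T2 [0..<K])"
      by (rule halted_tm_of) (simp add: F_def)
    moreover have "has_output (1 + length (compile c 1), map T2 [0..<K]) (exec c (input w) (K - 1))"
      using assms(3) by (simp add: has_output_def last_map T2 at_end_def)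
    ultimately show ?thesis by blast
  qed
  then show ?thesis
    using assms(3) wf_tm_of deterministic_tm_of unfolding polytime_computable_def by blast
qed

section \<open>Computations as two-dimensional patterns\<close>

text \<open>
  A cell consists of one symbol per tape and a flag, which is 1 in the column of the heads and 2 in
  the last column. In the first row the heads stand at position \<open>-1\<close>, left of the input, and the
  signal \<open>Start\<close> moves them to the initial position; this way the head column never coincides with
  an input cell of the first row. Rows carrying the signal \<open>End\<close> erase everything above
  them, which makes the last row independent of the computation.
\<close>

type_synonym cell = "nat list \<times> nat"

datatype signal = Start | Run instr | End

fun written :: "signal \<Rightarrow> nat \<Rightarrow> nat" where
  "written (Run (q, rs, q', as)) j = fst (as ! j)"
| "written _ j = 0"

fun moved :: "signal \<Rightarrow> nat \<Rightarrow> move" where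
  "moved (Run (q, rs, q', as)) j = snd (as ! j)"
| "moved _ j = Right"

fun target :: "tm \<Rightarrow> signal \<Rightarrow> nat" where
  "target M (Run (q, rs, q', as)) = q'"
| "target M _ = start M"

fun follows :: "tm \<Rightarrow> signal \<Rightarrow> signal \<Rightarrow> bool" where
  "follows M g (Run (q, rs, q', as)) \<longleftrightarrow> target M g = q"
| "follows M g End \<longleftrightarrow> target M g = accept M"
| "follows M g Start \<longleftrightarrow> False"

definition null :: "nat \<Rightarrow> cell" where
  "null k = (replicate k 0, 0)"

text \<open>The heads keep their column and the tapes are shifted instead, so a move to the right
  fetches the symbol of the right neighbour. If the cell it comes from has flag 1, that symbol was
  under the head and has been overwritten.\<close>

definition up :: "nat \<Rightarrow> signal \<Rightarrow> cell \<Rightarrow> cell \<Rightarrow> cell \<Rightarrow> cell" where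
  "up k g l x r = (if g = End then null k else
     (map (\<lambda>j. let y = (case moved g j of Left \<Rightarrow> l | Stay \<Rightarrow> x | Right \<Rightarrow> r)
               in if snd y = 1 then written g j else fst y ! j) [0..<k], snd x))"

text \<open>In the last column (flag 2) the next instruction is guessed among those that fit the
  state; whether it fits the symbols read is tested in the head column (flag 1) of its own
  row.\<close>

definition locally_ok :: "tm \<Rightarrow> signal \<Rightarrow> cell \<Rightarrow> cell \<Rightarrow> cell \<Rightarrow> signal \<Rightarrow> cell \<Rightarrow> bool" where
  "locally_ok M g l x r g' u \<longleftrightarrow> u = up (ntapes M) g l x r \<and>
     (if g = End then g' = End else if snd x = 2 then follows M g g' else g' = g) \<and>
     (\<forall>q rs q' as. g = Run (q, rs, q', as) \<longrightarrow> snd x = 1 \<longrightarrow> fst x = rs)"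

definition symbols :: "tm \<Rightarrow> nat set" where
  "symbols M = {..2} \<union> (\<Union>(q, rs, q', as) \<in> instrs M. fst ` set as)"

definition cells :: "tm \<Rightarrow> cell set" where
  "cells M = {a. set a \<subseteq> symbols M \<and> length a = ntapes M} \<times> {..2}"

definition signals :: "tm \<Rightarrow> signal set" where
  "signals M = insert Start (insert End (Run ` instrs M))"

definition flag :: "nat \<Rightarrow> nat \<Rightarrow> nat \<Rightarrow> nat" where
  "flag U n i = (if i = U + 1 then 1 else if i = 2 * U + n + 2 then 2 else 0)"

text \<open>The offset makes the head column \<open>U + 1\<close> show tape position
  \<open>-1\<close>; the input starts in column \<open>U + 2\<close>.\<close>

definition first_row :: "nat \<Rightarrow> nat \<Rightarrow> bool list \<Rightarrow> nat \<Rightarrow> cell" where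
  "first_row k U w i =
     (contents w (int i - int U - 2) # replicate (k - 1) 0, flag U (length w) i)"

text \<open>\<open>U + 1\<close> blank columns, the head column, the input, \<open>U\<close> blank
  columns and the closing column.\<close>

definition width :: "nat \<Rightarrow> nat \<Rightarrow> nat" where
  "width U n = 2 * U + n + 3"

text \<open>Cells from \<open>N - 1\<close> on are \<open>null\<close>, which makes the colours at
  the east end and along the upper boundary independent of the run.\<close>

definition pattern :: "tm \<Rightarrow> nat \<Rightarrow> bool list \<Rightarrow> (nat \<Rightarrow> cell) \<Rightarrow> (nat \<Rightarrow> signal) \<Rightarrow> bool" where
  "pattern M U w x g \<longleftrightarrow> (let W = width U (length w); N = (U + 1) * W in
     (\<forall>i. x i \<in> cells M) \<and> (\<forall>i \<le> N. g i \<in> signals M) \<and>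
     (\<forall>i<W. x i = first_row (ntapes M) U w i) \<and> (\<forall>i \<ge> N - 1. x i = null (ntapes M)) \<and>
     g 0 = Start \<and> g N = End \<and>
     (\<forall>i<N. locally_ok M (g i) (if i = 0 then null (ntapes M) else x (i - 1)) (x i) (x (i + 1))
        (g (i + 1)) (x (i + W))))"

lemma finite_symbols: "wf_tm M \<Longrightarrow> finite (symbols M)"
  by (auto simp: symbols_def wf_tm_def)

lemma finite_cells: "wf_tm M \<Longrightarrow> finite (cells M)"
  by (auto simp: cells_def finite_symbols intro!: finite_lists_length_eq)

lemma finite_signals: "wf_tm M \<Longrightarrow> finite (signals M)"
  by (auto simp: signals_def wf_tm_def)

section \<open>Patterns correspond to accepting runs\<close>

fun sim_tape :: "(nat \<Rightarrow> signal) \<Rightarrow> bool list \<Rightarrow> nat \<Rightarrow> nat \<Rightarrow> tape" where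
  "sim_tape G w j 0 = (contents (if j = 0 then w else []), -1)"
| "sim_tape G w j (Suc t) = act (written (G t) j, moved (G t) j) (sim_tape G w j t)"

text \<open>The outermost cells of a row have neighbours in adjacent rows, so wrong symbols creep
  inwards by one column per row. The range \<open>t \<le> h\<close>,
  \<open>h + t \<le> 2 * U + 2\<close> is what is still correct in row \<open>t\<close>; it contains
  the head column \<open>U + 1\<close> while \<open>t \<le> U + 1\<close>. Flags are copied straight
  upwards and stay correct everywhere.\<close>

lemma track:
  fixes x :: "nat \<Rightarrow> cell" and w :: "bool list" and U :: nat
  defines "W \<equiv> width U (length w)"
  assumes k: "0 < k"
    and first: "\<And>i. i < W \<Longrightarrow> x i = first_row k U w i"
    and up: "\<And>i. i < m * W \<Longrightarrow>
      x (i + W) = up k (G (i div W)) (if i = 0 then null k else x (i - 1)) (x i) (x (i + 1))"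
    and G: "\<And>t. t < m \<Longrightarrow> G t \<noteq> End"
    and m: "m \<le> U + 1"
  shows "t \<le> m \<Longrightarrow> (\<forall>h<W. snd (x (t * W + h)) = flag U (length w) h) \<and>
    (\<forall>j<k. \<forall>h. t \<le> h \<longrightarrow> h + t \<le> 2 * U + 2 \<longrightarrow> fst (x (t * W + h)) ! j =
       fst (sim_tape G w j t) (snd (sim_tape G w j t) + int h - int U - 1))"
proof (induction t)
  case 0
  have "W > 2 * U + 2" by (simp add: W_def width_def)
  then show ?case using k
    by (auto simp: first first_row_def nth_Cons contents_def split: nat.splits)
next
  case (Suc t)
  have W: "W > 2 * U + 2" by (simp add: W_def width_def)
  have eq: "x (Suc t * W + h) =
      up k (G t) (if t * W + h = 0 then null k else x (t * W + h - 1)) (x (t * W + h))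
        (x (t * W + (h + 1)))" if "h < W" for h
  proof -
    have "t * W + h < Suc t * W" using that by simp
    also have "\<dots> \<le> m * W" using Suc.prems mult_le_mono1 by blast
    finally have "t * W + h < m * W" .
    moreover have "(t * W + h) div W = t" using that by simp
    ultimately show ?thesis using up[of "t * W + h"] by (simp add: ac_simps)
  qed
  have Gt: "G t \<noteq> End" using Suc.prems G by simp
  have IH: "\<And>h. h < W \<Longrightarrow> snd (x (t * W + h)) = flag U (length w) h"
    "\<And>j h. j < k \<Longrightarrow> t \<le> h \<Longrightarrow> h + t \<le> 2 * U + 2 \<Longrightarrow> fst (x (t * W + h)) ! j =
       fst (sim_tape G w j t) (snd (sim_tape G w j t) + int h - int U - 1)"
    using Suc by auto
  have "fst (x (Suc t * W + h)) ! j =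
       fst (sim_tape G w j (Suc t)) (snd (sim_tape G w j (Suc t)) + int h - int U - 1)"
    if j: "j < k" and h: "Suc t \<le> h" "h + Suc t \<le> 2 * U + 2" for j h
  proof -
    obtain f p where fp: "sim_tape G w j t = (f, p)" by fastforce
    have l: "(if t * W + h = 0 then null k else x (t * W + h - 1)) = x (t * W + (h - 1))"
      using h by auto
    let ?y = "case moved (G t) j of Left \<Rightarrow> h - 1 | Stay \<Rightarrow> h | Right \<Rightarrow> h + 1"
    have "fst (x (Suc t * W + h)) ! j =
      (if snd (x (t * W + ?y)) = 1 then written (G t) j else fst (x (t * W + ?y)) ! j)"
      using eq[of h] l h W j Gt by (auto simp: up_def Let_def split: move.splits)
    also have "snd (x (t * W + ?y)) = flag U (length w) ?y"
      using h W by (intro IH) (auto split: move.splits)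
    also have "fst (x (t * W + ?y)) ! j = f (p + int ?y - int U - 1)"
      using IH(2)[of j ?y] j h fp by (auto split: move.splits)
    finally show ?thesis
      using h fp by (auto simp: flag_def split: move.splits)
  qed
  moreover have "snd (x (Suc t * W + h)) = flag U (length w) h" if "h < W" for h
    using eq[OF that] IH(1)[OF that] Gt by (simp add: up_def)
  ultimately show ?case by blast
qed

text \<open>\<open>Start\<close> writes a blank on position \<open>-1\<close>, which is blank
  anyway, and moves right: row 1 shows the initial configuration.\<close>

lemma sim_tape_1:
  assumes "G 0 = Start" "wf_tm M"
  shows "init M w = (start M, map (\<lambda>j. sim_tape G w j 1) [0..<ntapes M])"
proof -
  have "0 < ntapes M" using assms(2) by (auto simp: wf_tm_def)
  moreover have "(contents v)(-1 := 0) = contents v" for v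
    by (auto simp: contents_def fun_eq_iff)
  ultimately show ?thesis using assms(1)
    by (auto simp: init_def intro!: nth_equalityI simp: nth_Cons split: nat.splits)
qed

lemma step_sim_tape:
  assumes "G t = Run (q, rs, q', as)" "(q, rs, q', as) \<in> instrs M" "wf_tm M"
    and "rs = map (\<lambda>j. read (sim_tape G w j t)) [0..<ntapes M]"
  shows "step M (q, map (\<lambda>j. sim_tape G w j t) [0..<ntapes M])
    (q', map (\<lambda>j. sim_tape G w j (Suc t)) [0..<ntapes M])"
proof -
  have "length as = ntapes M" using assms(2,3) by (auto simp: wf_tm_def)
  then have "map (\<lambda>j. sim_tape G w j (Suc t)) [0..<ntapes M] =
      map2 act as (map (\<lambda>j. sim_tape G w j t) [0..<ntapes M])"
    by (auto intro!: nth_equalityI simp: assms(1))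
  then show ?thesis using assms(2,4) by (auto simp: step_def comp_def)
qed

lemma read_eq: "read t = fst t (snd t)"
  by (cases t) simp

lemma pattern_imp_accepting:
  assumes "pattern M U w x g" and wf: "wf_tm M"
  shows "\<exists>t c. (step M ^^ t) (init M w) c \<and> fst c = accept M"
proof -
  define W where "W = width U (length w)"
  define k where "k = ntapes M"
  define G where "G t = g (t * W)" for t
  have k: "0 < k" using wf by (auto simp: wf_tm_def k_def)
  have W: "W = 2 * U + length w + 3" by (simp add: W_def width_def)
  have x: "\<And>i. i \<le> (U + 1) * W \<Longrightarrow> g i \<in> signals M"
    "\<And>i. i < W \<Longrightarrow> x i = first_row k U w i" "g 0 = Start" "g ((U + 1) * W) = End"
    "\<And>i. i < (U + 1) * W \<Longrightarrow> locally_ok M (g i) (if i = 0 then null k else x (i - 1)) (x i)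
      (x (i + 1)) (g (i + 1)) (x (i + W))"
    using assms(1) unfolding pattern_def W_def k_def Let_def by blast+
  have row: "g (t * W + h) = G t"
    if "G t \<noteq> End" "\<forall>h<W. snd (x (t * W + h)) = flag U (length w) h" "h < W" "t \<le> U" for t h
    using that(3)
  proof (induction h)
    case (Suc h)
    have "t * W + h < Suc t * W" using Suc.prems by simp
    also have "\<dots> \<le> (U + 1) * W" using that(4) by (intro mult_le_mono1) simp
    finally have "t * W + h < (U + 1) * W" .
    from x(5)[OF this] show ?case using Suc that
      by (auto simp: locally_ok_def flag_def W split: if_splits)
  qed (simp add: G_def)
  \<comment> \<open>That the signal is constant along a row depends on the flags of the row, and
    these come from \<open>track\<close> applied to the rows before it. Hence both claims are proved
    together, row by row.\<close>
  have up: "m \<le> U + 1 \<Longrightarrow> \<forall>t<m. G t \<noteq> End \<Longrightarrow> i < m * W \<Longrightarrow> g i = G (i div W) \<and>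
      x (i + W) = up k (G (i div W)) (if i = 0 then null k else x (i - 1)) (x i) (x (i + 1))"
    for i m
  proof (induction m arbitrary: i)
    case (Suc m)
    have "\<forall>h<W. snd (x (m * W + h)) = flag U (length w) h"
      using track[OF k, of U w x m G m] x(2) Suc unfolding W_def[symmetric] by fastforce
    note r = row[OF _ this]
    show ?case
    proof (cases "i < m * W")
      case True
      then show ?thesis using Suc by auto
    next
      case False
      then have "i div W = m"
        using Suc.prems(3) by (intro div_nat_eqI) (auto simp: mult.commute)
      then have i: "i = m * W + i mod W" "i div W = m"
        using div_mult_mod_eq[of i W] by simp_all
      have "g i = G m" using r[of "i mod W"] Suc.prems i W by auto
      moreover have "i < (U + 1) * W"
        using Suc.prems(1,3) by (meson less_le_trans mult_le_mono1)
      ultimately show ?thesis using x(5)[of i] i by (simp add: locally_ok_def k_def)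
    qed
  qed simp
  \<comment> \<open>The first row with \<open>End\<close>; rows \<open>1\<close> to
    \<open>tend - 1\<close> carry the instructions of the run.\<close>
  define tend where "tend = (LEAST t. G t = End)"
  have "G (U + 1) = End" using x(4) by (simp add: G_def)
  then have tend: "G tend = End" "tend \<le> U + 1" "\<And>t. t < tend \<Longrightarrow> G t \<noteq> End"
    unfolding tend_def by (auto intro: LeastI Least_le dest: not_less_Least)
  have "tend \<noteq> 0" using tend(1) x(3) by (intro notI) (simp add: G_def)
  have track: "(\<forall>h<W. snd (x (t * W + h)) = flag U (length w) h) \<and>
    (\<forall>j<k. \<forall>h. t \<le> h \<longrightarrow> h + t \<le> 2 * U + 2 \<longrightarrow> fst (x (t * W + h)) ! j =
       fst (sim_tape G w j t) (snd (sim_tape G w j t) + int h - int U - 1))" if "t \<le> tend" for t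
    using track[OF k, of U w x tend G t] x(2) up[of tend] tend that unfolding W_def[symmetric] by blast
  have next_row: "follows M (G t) (G (Suc t))" if "t < tend" for t
  proof -
    have t: "t \<le> U" using that tend(2) by simp
    have "t * W + (W - 1) < Suc t * W" using W by simp
    also have "\<dots> \<le> (U + 1) * W" using t by (intro mult_le_mono1) simp
    finally have "t * W + (W - 1) < (U + 1) * W" .
    note x(5)[OF this]
    moreover have "t * W + (W - 1) + 1 = Suc t * W" using W by simp
    moreover have "g (t * W + (W - 1)) = G t"
      using track[of t] that W t tend by (intro row) auto
    moreover have "snd (x (t * W + (W - 1))) = 2"
    proof -
      have "W - 1 < W" using W by simp
      then have "snd (x (t * W + (W - 1))) = flag U (length w) (W - 1)"
        by (rule conjunct1[OF track[OF less_imp_le[OF that]], rule_format])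
      then show ?thesis using W by (simp add: flag_def)
    qed
    ultimately show ?thesis using tend(3)[OF that] by (simp add: locally_ok_def G_def add.commute[of W])
  qed
  have "Suc t \<le> tend \<Longrightarrow> (step M ^^ t) (init M w)
    (target M (G t), map (\<lambda>j. sim_tape G w j (Suc t)) [0..<k])" for t
  proof (induction t)
    case 0
    then show ?case using sim_tape_1[of G M w] wf x(3) by (simp add: G_def k_def)
  next
    case (Suc t)
    have f: "follows M (G t) (G (Suc t))" using next_row Suc.prems by simp
    have "Suc t * W \<le> (U + 1) * W" using Suc.prems tend(2) by (intro mult_le_mono1) simp
    then have "G (Suc t) \<in> signals M" unfolding G_def by (rule x(1))
    moreover have "G (Suc t) \<noteq> End" "G (Suc t) \<noteq> Start" using f tend(3) Suc.prems by auto
    ultimately obtain q rs q' as where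
      G: "G (Suc t) = Run (q, rs, q', as)" "(q, rs, q', as) \<in> instrs M"
      by (auto simp: signals_def)
    have q: "q = target M (G t)" using f G by simp
    have "Suc t * W + (U + 1) < Suc (Suc t) * W" using W by simp
    also have "\<dots> \<le> (U + 1) * W" using Suc.prems tend(2) by (intro mult_le_mono1) simp
    finally have i: "Suc t * W + (U + 1) < (U + 1) * W" .
    have "g (Suc t * W + (U + 1)) = G (Suc t)"
      using track[of "Suc t"] Suc.prems W tend by (intro row) auto
    moreover have "snd (x (Suc t * W + (U + 1))) = 1"
    proof -
      have "U + 1 < W" using W by simp
      then have "snd (x (Suc t * W + (U + 1))) = flag U (length w) (U + 1)"
        by (rule conjunct1[OF track[OF Suc_leD[OF Suc.prems]], rule_format])
      then show ?thesis by (simp add: flag_def)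
    qed
    ultimately have "fst (x (Suc t * W + (U + 1))) = rs"
      using x(5)[OF i] G by (simp add: locally_ok_def)
    moreover have "fst (x (Suc t * W + (U + 1))) ! j = read (sim_tape G w j (Suc t))" if "j < k" for j
    proof -
      have "fst (x (Suc t * W + (U + 1))) ! j = fst (sim_tape G w j (Suc t))
         (snd (sim_tape G w j (Suc t)) + int (U + 1) - int U - 1)"
        by (rule conjunct2[OF track[OF Suc_leD[OF Suc.prems]], rule_format])
          (use that Suc.prems tend(2) in simp_all)
      then show ?thesis by (simp add: read_eq)
    qed
    moreover have "length rs = k" using G(2) wf by (auto simp: wf_tm_def k_def)
    ultimately have rs: "rs = map (\<lambda>j. read (sim_tape G w j (Suc t))) [0..<k]"
      by (intro nth_equalityI) auto
    show ?case
      using Suc step_sim_tape[OF G wf rs[unfolded k_def]] q G(1)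
      by (auto simp: k_def)
  qed
  from this[of "tend - 1"] have "(step M ^^ (tend - 1)) (init M w)
    (target M (G (tend - 1)), map (\<lambda>j. sim_tape G w j tend) [0..<k])" using \<open>tend \<noteq> 0\<close> by simp
  moreover have "target M (G (tend - 1)) = accept M"
    using next_row[of "tend - 1"] \<open>tend \<noteq> 0\<close> tend(1) by simp
  ultimately show ?thesis by (intro exI conjI) auto
qed

text \<open>The guard \<open>W < 2\<close> only serves termination.\<close>

function history :: "nat \<Rightarrow> nat \<Rightarrow> (nat \<Rightarrow> cell) \<Rightarrow> (nat \<Rightarrow> signal) \<Rightarrow> nat \<Rightarrow> cell" where
  "history k W R G i = (if i < W \<or> W < 2 then R i else
     up k (G ((i - W) div W)) (if i = W then null k else history k W R G (i - W - 1))
       (history k W R G (i - W)) (history k W R G (i - W + 1)))"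
  by auto
termination
  by (relation "measure (\<lambda>(k, W, R, G, i). i)") auto

declare history.simps [simp del]

lemma up_in_cells:
  assumes "wf_tm M" "g \<in> signals M" "l \<in> cells M" "x \<in> cells M" "r \<in> cells M"
  shows "up (ntapes M) g l x r \<in> cells M"
proof (cases "g = End")
  case True
  then show ?thesis by (auto simp: up_def null_def cells_def symbols_def)
next
  case False
  have "written g j \<in> symbols M" if "j < ntapes M" for j
  proof (cases "g = Start")
    case True
    then show ?thesis by (simp add: symbols_def)
  next
    case False
    with \<open>g \<noteq> End\<close> assms(2) obtain q rs q' as where
      g: "g = Run (q, rs, q', as)" "(q, rs, q', as) \<in> instrs M"
      by (auto simp: signals_def)
    then have "as ! j \<in> set as" using assms(1) that by (auto simp: wf_tm_def)
    then show ?thesis using g by (force simp: symbols_def)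
  qed
  moreover have "fst y ! j \<in> symbols M" if "j < ntapes M" "y \<in> cells M" for y j
    using that by (auto simp: cells_def subset_iff)
  moreover define y where "y j = (case moved g j of Left \<Rightarrow> l | Stay \<Rightarrow> x | Right \<Rightarrow> r)" for j
  moreover have "y j \<in> cells M" for j
    using assms(3-5) by (auto simp: y_def split: move.splits)
  ultimately have "written g j \<in> symbols M" "fst (y j) ! j \<in> symbols M" if "j < ntapes M" for j
    using that by simp_all
  moreover have "snd x \<le> 2" using assms(4) by (auto simp: cells_def)
  ultimately show ?thesis using False
    by (simp add: up_def Let_def y_def[symmetric]) (auto simp: cells_def)
qed

lemma first_row_in_cells: "wf_tm M \<Longrightarrow> first_row (ntapes M) U w i \<in> cells M"
  by (auto simp: first_row_def cells_def symbols_def wf_tm_def flag_def contents_def)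

lemma null_in_cells: "null (ntapes M) \<in> cells M"
  by (auto simp: null_def cells_def symbols_def)

text \<open>The \<open>U + 1\<close> rows have room for \<open>Start\<close>, the \<open>T\<close>
  instructions and at least two \<open>End\<close> rows; the first of these erases the row above it,
  so the last row is all \<open>null\<close>.\<close>

lemma accepting_imp_pattern:
  assumes wf: "wf_tm M" and run: "(step M ^^ T) (init M w) c" "fst c = accept M"
    and U: "T + 2 \<le> U"
  shows "\<exists>x g. pattern M U w x g"
proof -
  define W where "W = width U (length w)"
  define k where "k = ntapes M"
  have k: "0 < k" using wf by (auto simp: wf_tm_def k_def)
  have W: "W = 2 * U + length w + 3" by (simp add: W_def width_def)
  obtain C where C: "C 0 = init M w" "C T = c" "\<And>t. t < T \<Longrightarrow> step M (C t) (C (Suc t))"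
    using run(1) unfolding relpowp_fun_conv by blast
  have "\<forall>t. \<exists>as. t < T \<longrightarrow> (fst (C t), map read (snd (C t)), fst (C (Suc t)), as) \<in> instrs M \<and>
      snd (C (Suc t)) = map2 act as (snd (C t))"
    using C(3) by (auto simp: step_def)
  then obtain as where as: "\<And>t. t < T \<Longrightarrow>
      (fst (C t), map read (snd (C t)), fst (C (Suc t)), as t) \<in> instrs M"
      "\<And>t. t < T \<Longrightarrow> snd (C (Suc t)) = map2 act (as t) (snd (C t))"
    by metis
  \<comment> \<open>Row 0 is taken by \<open>Start\<close>, so row \<open>t\<close> carries the step
    from \<open>C (t - 1)\<close> to \<open>C t\<close>.\<close>
  define G where "G t = (if t = 0 then Start else if t \<le> T then
      Run (fst (C (t - 1)), map read (snd (C (t - 1))), fst (C t), as (t - 1)) else End)" for t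
  have G0: "G 0 = Start" by (simp add: G_def)
  have G_sig: "G t \<in> signals M" for t
    using as(1)[of "t - 1"] by (auto simp: G_def signals_def)
  define x where "x = history k W (first_row k U w) G"
  define g where "g i = G (i div W)" for i
  have first: "x i = first_row k U w i" if "i < W" for i
    using that by (simp add: x_def history.simps)
  have up: "x (i + W) = up k (G (i div W)) (if i = 0 then null k else x (i - 1)) (x i) (x (i + 1))" for i
  proof -
    have "\<not> W < 2" using W by simp
    then show ?thesis by (simp add: x_def history.simps[of k W _ G "i + W"])
  qed
  have x_cells: "x i \<in> cells M" for i
  proof (induction i rule: less_induct)
    case (less i)
    show ?case
    proof (cases "i < W")
      case True
      then show ?thesis using first_row_in_cells[OF wf] by (simp add: first k_def)
    next
      case False
      then obtain j where j: "i = j + W" using le_Suc_ex by (metis add.commute not_less)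
      show ?thesis unfolding j up unfolding k_def
        using W by (intro up_in_cells[OF wf G_sig]) (auto simp: j null_in_cells intro!: less)
    qed
  qed
  have C0: "fst (C 0) = start M" by (simp add: C(1) init_def)
  have follows: "follows M (G t) (G (Suc t))" if "t \<le> T" for t
  proof (cases "t = T")
    case True
    then have "target M (G t) = accept M"
      using run(2) C(2) C0 by (cases t) (auto simp: G_def)
    then show ?thesis using True by (simp add: G_def)
  next
    case False
    then show ?thesis using that C0 by (cases t) (auto simp: G_def)
  qed
  have tapes: "t \<le> T \<Longrightarrow> snd (C t) = map (\<lambda>j. sim_tape G w j (Suc t)) [0..<k]" for t
  proof (induction t)
    case 0
    then show ?case using sim_tape_1[of G M w] G0 wf C(1) by (simp add: k_def)
  next
    case (Suc t)
    then have "length (as t) = k" using as(1)[of t] wf by (auto simp: wf_tm_def k_def)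
    then have "map (\<lambda>j. sim_tape G w j (Suc (Suc t))) [0..<k] =
      map2 act (as t) (map (\<lambda>j. sim_tape G w j (Suc t)) [0..<k])"
      using Suc.prems by (intro nth_equalityI) (auto simp: G_def)
    then show ?case using Suc as(2)[of t] by simp
  qed
  have track: "(\<forall>h<W. snd (x (t * W + h)) = flag U (length w) h) \<and>
    (\<forall>j<k. \<forall>h. t \<le> h \<longrightarrow> h + t \<le> 2 * U + 2 \<longrightarrow> fst (x (t * W + h)) ! j =
       fst (sim_tape G w j t) (snd (sim_tape G w j t) + int h - int U - 1))" if "t \<le> Suc T" for t
    unfolding W_def
    by (rule track[OF k, where m = "Suc T"])
      (use first up U that in \<open>auto simp: W_def[symmetric] G_def\<close>)
  have local: "locally_ok M (g i) (if i = 0 then null k else x (i - 1)) (x i) (x (i + 1))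
      (g (i + 1)) (x (i + W))" for i
  proof -
    define t h where "t = i div W" and "h = i mod W"
    have i: "i = t * W + h" by (simp add: t_def h_def)
    have "h < W" using W by (simp add: h_def)
    note i = i this
    have gi: "g i = G t" by (simp add: g_def t_def)
    have gi1: "g (i + 1) = (if h = W - 1 then G (Suc t) else G t)"
    proof (cases "h = W - 1")
      case True
      then have "i + 1 = Suc t * W" using i W by simp
      then show ?thesis using True W by (simp add: g_def del: mult_Suc)
    next
      case False
      then have "(i + 1) div W = t" using i W by (intro div_nat_eqI) auto
      then show ?thesis using False by (simp add: g_def)
    qed
    have sig: "if g i = End then g (i + 1) = End else
        if snd (x i) = 2 then follows M (g i) (g (i + 1)) else g (i + 1) = g i"
    proof (cases "t \<le> T")
      case True
      then have "G t \<noteq> End" by (simp add: G_def)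
      moreover have "snd (x i) = flag U (length w) h"
        unfolding i(1) by (rule conjunct1[OF track, rule_format]) (use True i(2) in simp_all)
      moreover have "flag U (length w) h = 2 \<longleftrightarrow> h = W - 1" by (auto simp: flag_def W)
      ultimately show ?thesis using gi gi1 follows[OF True] by simp
    next
      case False
      then show ?thesis using gi gi1 by (simp add: G_def)
    qed
    have "fst (x i) = rs" if g: "g i = Run (q, rs, q', as')" and c: "snd (x i) = 1" for q rs q' as'
    proof -
      have t: "0 < t" "t \<le> T" and rs: "rs = map read (snd (C (t - 1)))"
        using g unfolding gi G_def by (simp_all split: if_splits)
      have "snd (x i) = flag U (length w) h"
        unfolding i(1) by (rule conjunct1[OF track, rule_format]) (use t i(2) in simp_all)
      then have "flag U (length w) h = 1" using c by (rule trans[OF sym])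
      then have h: "h = U + 1" by (simp add: flag_def split: if_splits)
      have r: "fst (x i) ! j = read (sim_tape G w j t)" if "j < k" for j
      proof -
        have "fst (x i) ! j = fst (sim_tape G w j t)
          (snd (sim_tape G w j t) + int (U + 1) - int U - 1)"
          unfolding i(1) h
          by (rule conjunct2[OF track, rule_format]) (use that t U in simp_all)
        then show ?thesis by (simp add: read_eq)
      qed
      have "Suc (t - 1) = t" "t - 1 \<le> T" using t by simp_all
      then have rs': "rs = map (\<lambda>j. read (sim_tape G w j t)) [0..<k]"
        unfolding rs using tapes[of "t - 1"] by (simp only: map_map comp_def)
      have "length (fst (x i)) = k"
        using x_cells[of i] by (auto simp: cells_def k_def)
      then show ?thesis unfolding rs' by (intro nth_equalityI) (simp_all add: r)
    qed
    then show ?thesis using up[of i] sig gi by (auto simp: locally_ok_def k_def t_def)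
  qed
  \<comment> \<open>The cell at \<open>i - W\<close> lies in row \<open>U - 1\<close> or later,
    which carries \<open>End\<close> because \<open>T + 2 \<le> U\<close>.\<close>
  have "x i = null k" if "i \<ge> (U + 1) * W - 1" for i
  proof -
    have "1 * W \<le> U * W" using U by (intro mult_le_mono1) simp
    moreover have "(U + 1) * W = U * W + W" by simp
    ultimately have "W \<le> i" using that W by linarith
    then obtain j where j: "i = j + W" by (metis add.commute le_Suc_ex)
    have "(U + 1) * W = (U - 1) * W + 2 * W" using U by (simp add: add_mult_distrib[symmetric])
    then have "(U - 1) * W \<le> j" using that j W by linarith
    then have "(U - 1) * W div W \<le> j div W" by (rule div_le_mono)
    then have "U - 1 \<le> j div W" using W by simp
    then have "G (j div W) = End" using U by (auto simp: G_def)
    then show ?thesis unfolding j up by (simp add: up_def)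
  qed
  moreover have "g ((U + 1) * W) = End" using U W by (simp add: G_def g_def del: mult_Suc)
  moreover have "g i \<in> signals M" "g 0 = Start" for i using G_sig G0 by (simp_all add: g_def)
  ultimately have "pattern M U w x g"
    using x_cells first local
    unfolding pattern_def Let_def W_def[symmetric] k_def[symmetric] by blast
  then show ?thesis by blast
qed

section \<open>Two drones and pairs of conflicting deliveries\<close>

text \<open>Intervals are closed, so a single point is an interval: deliveries at the same point
  conflict, those at distinct points are compatible.\<close>

definition point_delivery :: "nat \<Rightarrow> nat \<Rightarrow> delivery" where
  "point_delivery p c = \<lparr>left_end = of_nat p, right_end = of_nat p, cost = of_nat c\<rparr>"

definition pair_deliveries :: "(nat \<times> nat \<times> nat) list \<Rightarrow> delivery list" where
  "pair_deliveries ps = concat (map (\<lambda>(p, a, b). [point_delivery p a, point_delivery p b]) ps)"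

definition pair_instance :: "nat \<Rightarrow> (nat \<times> nat \<times> nat) list \<Rightarrow> ddp_instance" where
  "pair_instance B ps = \<lparr>budget = of_nat B, deliveries = pair_deliveries ps\<rparr>"

lemma length_pair_deliveries: "length (pair_deliveries ps) = 2 * length ps"
  by (induction ps) (auto simp: pair_deliveries_def)

lemma pair_deliveries_nth:
  "j < length ps \<Longrightarrow> pair_deliveries ps ! (2 * j) = point_delivery (fst (ps ! j)) (fst (snd (ps ! j)))"
  "j < length ps \<Longrightarrow> pair_deliveries ps ! Suc (2 * j) = point_delivery (fst (ps ! j)) (snd (snd (ps ! j)))"
proof (induction ps arbitrary: j)
  case (Cons p ps)
  {
    case 1
    then show ?case using Cons.IH(1)[of "j - 1"]
      by (cases j) (auto simp: pair_deliveries_def split: prod.splits)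
  next
    case 2
    then show ?case using Cons.IH(2)[of "j - 1"]
      by (cases j) (auto simp: pair_deliveries_def split: prod.splits)
  }
qed auto

lemma valid_pair_instance:
  assumes "0 < B" "\<And>p a b. (p, a, b) \<in> set ps \<Longrightarrow> 0 < a \<and> a \<le> B \<and> 0 < b \<and> b \<le> B"
  shows "valid_instance (pair_instance B ps)"
  using assms
  by (force simp: valid_instance_def pair_instance_def pair_deliveries_def point_delivery_def)

text \<open>The two deliveries of pair \<open>j\<close> have the indices \<open>2 * j\<close> and
  \<open>2 * j + 1\<close>.\<close>

definition pick :: "(nat \<Rightarrow> bool) \<Rightarrow> nat \<Rightarrow> nat" where
  "pick f j = (if f j then 2 * j else Suc (2 * j))"

lemma pick_eq_iff: "pick f i = pick g j \<longleftrightarrow> i = j \<and> f i = g j"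
  by (cases "f i"; cases "g j"; simp add: pick_def; presburger)

lemma inj_pick: "inj_on (pick f) A"
  by (auto simp: inj_on_def pick_eq_iff)

lemma pick_cover: "pick f ` {..<J} \<union> pick (\<lambda>j. \<not> f j) ` {..<J} = {..<2 * J}"
proof (intro equalityI subsetI)
  fix i assume "i \<in> {..<2 * J}"
  then have "i div 2 < J" "i = pick f (i div 2) \<or> i = pick (\<lambda>j. \<not> f j) (i div 2)"
    using odd_two_times_div_two_succ[of i] by (auto simp: pick_def)
  then show "i \<in> pick f ` {..<J} \<union> pick (\<lambda>j. \<not> f j) ` {..<J}" by blast
qed (auto simp: pick_def)

lemma feasible_pick_iff:
  assumes "distinct (map fst ps)"
  shows "feasible (pair_instance B ps) (pick f ` {..<length ps}) \<longleftrightarrow>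
    (\<Sum>j<length ps. if f j then fst (snd (ps ! j)) else snd (snd (ps ! j))) \<le> B"
proof -
  let ?J = "length ps"
  have nth: "deliveries (pair_instance B ps) ! pick f j = point_delivery (fst (ps ! j))
      (if f j then fst (snd (ps ! j)) else snd (snd (ps ! j)))" if "j < ?J" for j
    using that by (simp add: pair_instance_def pick_def pair_deliveries_nth)
  have "fst (ps ! i) \<noteq> fst (ps ! j)" if "i < ?J" "j < ?J" "i \<noteq> j" for i j
    using nth_eq_iff_index_eq[OF assms] that by simp
  then have "compatible (pair_instance B ps) (pick f ` {..<?J})"
    by (auto simp: compatible_def interval_def nth point_delivery_def pick_eq_iff)
  moreover have "(\<Sum>i\<in>pick f ` {..<?J}. cost (deliveries (pair_instance B ps) ! i)) =
      (\<Sum>j<?J. of_nat (if f j then fst (snd (ps ! j)) else snd (snd (ps ! j))))"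
    by (subst sum.reindex[OF inj_pick]) (auto simp: nth point_delivery_def intro!: sum.cong)
  moreover have "\<dots> = (of_nat (\<Sum>j<?J. if f j then fst (snd (ps ! j)) else snd (snd (ps ! j))) :: rat)"
    by simp
  ultimately show ?thesis
    unfolding feasible_def by (simp only: of_nat_le_iff) (simp add: pair_instance_def del: of_nat_sum)
qed

text \<open>The deliveries of a pair conflict, so each of two drones gets exactly one of them. As
  all costs add up to \<open>2 * B\<close>, neither drone has slack, and the budget inequality
  becomes an equation.\<close>

lemma min_drones_pair_instance:
  assumes dist: "distinct (map fst ps)" and ne: "ps \<noteq> []" and valid: "valid_instance (pair_instance B ps)"
    and total: "(\<Sum>(p, a, b)\<leftarrow>ps. a + b) = 2 * B"
  shows "min_drones (pair_instance B ps) \<le> 2 \<longleftrightarrow>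
    (\<exists>f. (\<Sum>j<length ps. if f j then fst (snd (ps ! j)) else snd (snd (ps ! j))) = B)"
proof -
  let ?I = "pair_instance B ps"
  let ?J = "length ps"
  let ?c = "\<lambda>f. \<Sum>j<?J. if f j then fst (snd (ps ! j)) else snd (snd (ps ! j))"
  have len: "length (deliveries ?I) = 2 * ?J"
    by (simp add: pair_instance_def length_pair_deliveries)
  have compl: "?c f + ?c (\<lambda>j. \<not> f j) = 2 * B" for f
  proof -
    have "?c f + ?c (\<lambda>j. \<not> f j) = (\<Sum>j<?J. fst (snd (ps ! j)) + snd (snd (ps ! j)))"
      unfolding sum.distrib[symmetric] by (intro sum.cong) auto
    also have "\<dots> = (\<Sum>(p, a, b)\<leftarrow>ps. a + b)"
      by (simp add: sum_list_sum_nth atLeast0LessThan case_prod_unfold)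
    finally show ?thesis using total by simp
  qed
  show ?thesis
  proof
    assume "min_drones ?I \<le> 2"
    moreover have "\<exists>P. feasible_partition ?I P \<and> card P = min_drones ?I"
      unfolding min_drones_def
      by (rule LeastI_ex[of "\<lambda>m. \<exists>P. feasible_partition ?I P \<and> card P = m"])
        (use feasible_partition_exists[OF valid] in blast)
    ultimately obtain P where P: "feasible_partition ?I P" "card P \<le> 2" by auto
    have part: "partition_on {..<2 * ?J} P" and feas: "\<And>S. S \<in> P \<Longrightarrow> feasible ?I S"
      using P(1) len by (auto simp: feasible_partition_def)
    have not_both: False if "S \<in> P" "2 * j \<in> S" "Suc (2 * j) \<in> S" "j < ?J" for S j
    proof -
      have "interval ?I (2 * j) \<inter> interval ?I (Suc (2 * j)) = {}"
        using feas[OF that(1)] that by (auto simp: feasible_def compatible_def)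
      then show False using that(4)
        by (simp add: interval_def pair_instance_def pair_deliveries_nth point_delivery_def)
    qed
    have J: "0 < ?J" using ne by simp
    have cover: "\<exists>S \<in> P. i \<in> S" if "i < 2 * ?J" for i
      using part that by (auto simp: partition_on_def)
    obtain S1 S2 where S: "S1 \<in> P" "S2 \<in> P" "0 \<in> S1" "1 \<in> S2"
      using cover[of 0] cover[of 1] J by auto
    \<comment> \<open>A single pair already forces two different sets; together with
      \<open>card P \<le> 2\<close> there are exactly two.\<close>
    have ne12: "S1 \<noteq> S2" using not_both[of S1 0] S J by auto
    have finP: "finite P" using part by (auto intro: finite_elements)
    have P12: "P = {S1, S2}"
      using card_seteq[OF finP, of "{S1, S2}"] S ne12 P(2) by auto
    have disj: "S1 \<inter> S2 = {}" using part ne12 P12 by (auto simp: partition_on_def disjoint_def)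
    have union: "S1 \<union> S2 = {..<2 * ?J}" using part P12 by (auto simp: partition_on_def)
    define f where "f j \<longleftrightarrow> 2 * j \<in> S1" for j
    have mem: "2 * j \<in> S1 \<longleftrightarrow> Suc (2 * j) \<in> S2" "2 * j \<in> S2 \<longleftrightarrow> Suc (2 * j) \<in> S1" if "j < ?J" for j
    proof -
      have "2 * j \<in> S1 \<union> S2" "Suc (2 * j) \<in> S1 \<union> S2" using that unfolding union by auto
      then show "2 * j \<in> S1 \<longleftrightarrow> Suc (2 * j) \<in> S2" "2 * j \<in> S2 \<longleftrightarrow> Suc (2 * j) \<in> S1"
        using not_both[of S1 j] not_both[of S2 j] that S disj by blast+
    qed
    have sub: "pick f ` {..<?J} \<subseteq> S1" "pick (\<lambda>j. \<not> f j) ` {..<?J} \<subseteq> S2"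
    proof -
      have "2 * j \<in> S1 \<or> 2 * j \<in> S2" if "j < ?J" for j
        using union that by (metis Un_iff lessThan_iff nat_mult_less_cancel1 pos2)
      then show "pick f ` {..<?J} \<subseteq> S1" "pick (\<lambda>j. \<not> f j) ` {..<?J} \<subseteq> S2"
        using mem by (auto simp: pick_def f_def)
    qed
    have "C = A \<and> D = B" if "A \<subseteq> C" "B \<subseteq> D" "A \<union> B = C \<union> D" "C \<inter> D = {}" for A B C D :: "nat set"
      using that by blast
    from this[OF sub _ disj] have "S1 = pick f ` {..<?J}" "S2 = pick (\<lambda>j. \<not> f j) ` {..<?J}"
      using pick_cover[of f ?J] union by simp_all
    then have "?c f \<le> B" "?c (\<lambda>j. \<not> f j) \<le> B"
      using feas S(1,2) feasible_pick_iff[OF dist, of B f] feasible_pick_iff[OF dist, of B "\<lambda>j. \<not> f j"]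
      by auto
    then have "?c f = B" using compl[of f] by linarith
    then show "\<exists>f. ?c f = B" by blast
  next
    assume "\<exists>f. ?c f = B"
    then obtain f where f: "?c f = B" by blast
    then have f': "?c (\<lambda>j. \<not> f j) = B" using compl[of f] by linarith
    let ?P = "{pick f ` {..<?J}, pick (\<lambda>j. \<not> f j) ` {..<?J}}"
    have "partition_on {..<2 * ?J} ?P"
      using pick_cover[of f ?J] ne
      by (auto simp: partition_on_def disjoint_def pick_eq_iff)
    moreover have "\<forall>S \<in> ?P. feasible ?I S"
      using f f' feasible_pick_iff[OF dist, of B f] feasible_pick_iff[OF dist, of B "\<lambda>j. \<not> f j"]
      by auto
    ultimately have "feasible_partition ?I ?P"
      by (simp add: feasible_partition_def len)
    then have "min_drones ?I \<le> card ?P"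
      unfolding min_drones_def by (intro Least_le) blast
    also have "\<dots> \<le> 2" by (simp add: card_insert_if)
    finally show "min_drones ?I \<le> 2" .
  qed
qed

lemma sum_nth_choice:
  "(\<Sum>j<length ps. if f (fst (ps ! j)) then fst (snd (ps ! j)) else snd (snd (ps ! j))) =
    (\<Sum>(p, a, b)\<leftarrow>ps. if f p then a else b)"
  by (simp add: sum_list_sum_nth atLeast0LessThan case_prod_unfold)

text \<open>Swapping the drones complements the choice and keeps the sum at \<open>B\<close>, so the
  first drone may be assumed to get \<open>a0\<close>. Choices are indexed by points rather than
  list positions, which suits nested lists of pairs.\<close>

lemma min_drones_pair_instance_Cons:
  assumes dist: "distinct (map fst ((p0, a0, b0) # ps))"
    and valid: "valid_instance (pair_instance B ((p0, a0, b0) # ps))"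
    and total: "(\<Sum>(p, a, b)\<leftarrow>(p0, a0, b0) # ps. a + b) = 2 * B"
  shows "min_drones (pair_instance B ((p0, a0, b0) # ps)) \<le> 2 \<longleftrightarrow>
    (\<exists>f. a0 + (\<Sum>(p, a, b)\<leftarrow>ps. if f p then a else b) = B)"
proof -
  let ?ps = "(p0, a0, b0) # ps"
  let ?J = "length ?ps"
  let ?c = "\<lambda>f. \<Sum>j<?J. if f j then fst (snd (?ps ! j)) else snd (snd (?ps ! j))"
  let ?d = "\<lambda>f. \<Sum>(p, a, b)\<leftarrow>?ps. if f p then a else b :: nat"
  have cd: "?c (\<lambda>j. f (fst (?ps ! j))) = ?d f" for f
    by (rule sum_nth_choice)
  have compl: "?d f + ?d (\<lambda>p. \<not> f p) = 2 * B" for f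
  proof -
    have "?d f + ?d (\<lambda>p. \<not> f p) = (\<Sum>(p, a, b)\<leftarrow>?ps. a + b)"
      unfolding sum_list_addf[symmetric] by (intro arg_cong[of _ _ sum_list] map_cong) auto
    then show ?thesis using total by simp
  qed
  have inj: "fst (?ps ! i) = fst (?ps ! j) \<longleftrightarrow> i = j" if "i < ?J" "j < ?J" for i j
    using nth_eq_iff_index_eq[OF dist, of i j] that by (simp only: length_map nth_map)
  have "(\<exists>f. ?c f = B) \<longleftrightarrow> (\<exists>f. ?d f = B)"
  proof
    assume "\<exists>f. ?c f = B"
    then obtain f where f: "?c f = B" by blast
    define g where "g p = f (THE j. j < ?J \<and> fst (?ps ! j) = p)" for p
    have "g (fst (?ps ! j)) = f j" if "j < ?J" for j
      unfolding g_def by (intro arg_cong[of _ _ f] the_equality) (use that inj in blast)+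
    then have "?c (\<lambda>j. g (fst (?ps ! j))) = ?c f" by (intro sum.cong refl) (simp only: lessThan_iff)
    then have "?d g = B" using f cd[of g] by (simp only:)
    then show "\<exists>f. ?d f = B" by (intro exI[of _ g])
  next
    assume "\<exists>f. ?d f = B"
    then obtain f where "?d f = B" by blast
    then have "?c (\<lambda>j. f (fst (?ps ! j))) = B" using cd[of f] by (simp only:)
    then show "\<exists>f. ?c f = B" by (intro exI[of _ "\<lambda>j. f (fst (?ps ! j))"])
  qed
  also have "\<dots> \<longleftrightarrow> (\<exists>f. a0 + (\<Sum>(p, a, b)\<leftarrow>ps. if f p then a else b) = B)"
  proof
    assume "\<exists>f. ?d f = B"
    then obtain f where f: "?d f = B" by blast
    define g where "g = (if f p0 then f else (\<lambda>p. \<not> f p))"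
    have "?d (\<lambda>p. \<not> f p) = B" using f compl[of f] by linarith
    with f have "?d g = B" unfolding g_def by (cases "f p0") (simp_all only: if_True if_False)
    moreover have "g p0" by (simp add: g_def)
    ultimately show "\<exists>f. a0 + (\<Sum>(p, a, b)\<leftarrow>ps. if f p then a else b) = B"
      by (intro exI[of _ g]) simp
  next
    assume "\<exists>f. a0 + (\<Sum>(p, a, b)\<leftarrow>ps. if f p then a else b) = B"
    then obtain f where f: "a0 + (\<Sum>(p, a, b)\<leftarrow>ps. if f p then a else b) = B" by blast
    have "p0 \<notin> fst ` set ps" using dist by simp
    then have "(\<Sum>(p, a, b)\<leftarrow>ps. if (f(p0 := True)) p then a else b) =
        (\<Sum>(p, a, b)\<leftarrow>ps. if f p then a else b)"
      by (intro arg_cong[of _ _ sum_list] map_cong) force+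
    then have "?d (f(p0 := True)) = B" using f by simp
    then show "\<exists>f. ?d f = B" by blast
  qed
  finally show ?thesis using min_drones_pair_instance[OF dist _ valid total] by simp
qed

section \<open>Matching tiles by adding numbers\<close>

lemma digits_unique:
  fixes p q :: "nat \<Rightarrow> nat"
  assumes "\<And>b. b < n \<Longrightarrow> p b < X" "\<And>b. b < n \<Longrightarrow> q b < X"
    and "(\<Sum>b<n. X ^ b * p b) = (\<Sum>b<n. X ^ b * q b)" "b < n"
  shows "p b = q b"
  using assms
proof (induction n arbitrary: p q b)
  case (Suc n)
  have sh: "(\<Sum>b<Suc n. X ^ b * r b) = r 0 + X * (\<Sum>b<n. X ^ b * r (Suc b))" for r
    by (subst sum.lessThan_Suc_shift) (simp add: sum_distrib_left mult.assoc)
  have eq: "p 0 + X * (\<Sum>b<n. X ^ b * p (Suc b)) = q 0 + X * (\<Sum>b<n. X ^ b * q (Suc b))"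
    using Suc.prems(3) unfolding sh .
  have lt: "p 0 < X" "q 0 < X" using Suc.prems(1,2) by auto
  have "p 0 = q 0"
    using arg_cong[OF eq, of "\<lambda>x. x mod X"] lt by simp
  moreover have "(\<Sum>b<n. X ^ b * p (Suc b)) = (\<Sum>b<n. X ^ b * q (Suc b))"
    using eq calculation lt by auto
  then have "p (Suc b) = q (Suc b)" if "b < n" for b
    using that Suc.prems(1,2) by (intro Suc.IH[of "\<lambda>b. p (Suc b)" "\<lambda>b. q (Suc b)" b]) auto
  ultimately show ?case using Suc.prems(4) by (cases b) auto
qed simp

lemma sum_powers_mset:
  fixes A :: "nat multiset" and Y :: nat
  assumes "set_mset A \<subseteq> {..<n}"
  shows "(\<Sum>c\<in>#A. Y ^ c) = (\<Sum>c<n. Y ^ c * count A c)"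
  using assms
proof (induction A)
  case (add a A)
  have "(\<Sum>c<n. Y ^ c * count (add_mset a A) c) = (\<Sum>c<n. Y ^ c * count A c + (if c = a then Y ^ c else 0))"
    by (intro sum.cong) auto
  also have "\<dots> = (\<Sum>c<n. Y ^ c * count A c) + Y ^ a"
    using add.prems by (simp add: sum.distrib)
  finally show ?case using add by simp
qed simp

text \<open>With fewer than \<open>Y\<close> elements, the multiplicities are the digits of the sum
  in base \<open>Y\<close> and thus determined by it.\<close>

lemma mset_eqI_sum_powers:
  fixes A B :: "nat multiset" and Y :: nat
  assumes eq: "(\<Sum>c\<in>#A. Y ^ c) = (\<Sum>c\<in>#B. Y ^ c)" and "size A < Y" "size B < Y"
  shows "A = B"
proof (rule multiset_eqI)
  fix c
  have cnt: "count M c < Y" if "size M < Y" for M :: "nat multiset" and c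
    using that count_le_size[of M c] by linarith
  obtain n where n: "\<forall>c \<in> set_mset A \<union> set_mset B. c < n"
    using finite_nat_bounded[of "set_mset A \<union> set_mset B"] by auto
  then have "set_mset A \<subseteq> {..<n}" "set_mset B \<subseteq> {..<n}" by auto
  note sums = this[THEN sum_powers_mset[where Y = Y]]
  show "count A c = count B c"
  proof (cases "c < n")
    case True
    then show ?thesis
      using digits_unique[of n "count A" Y "count B" c] cnt assms(2,3) eq sums by auto
  next
    case False
    then have "c \<notin># A" "c \<notin># B" using n by auto
    then show ?thesis by (simp add: not_in_iff)
  qed
qed

lemma sum_lessThan_add:
  fixes f :: "nat \<Rightarrow> nat"
  shows "(\<Sum>b<m + n. f b) = (\<Sum>b<m. f b) + (\<Sum>b<n. f (m + b))"
  by (induction n) (auto simp: ac_simps)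

text \<open>
  The horizontal colours \<open>we\<close>, \<open>ea\<close> and the vertical colours \<open>so\<close>, \<open>no\<close> of the \<open>Q\<close> tiles are
  numbers. A set of tiles is placed on each of the positions \<open>0, \<dots>, N - 1\<close>; the
  right neighbour of position \<open>i\<close> is \<open>i + 1\<close> and the upper one is \<open>i + W\<close>. The deliveries
  \<open>pos i q\<close> and \<open>neg i q\<close> exclude each other, and the first drone gets \<open>pos i q\<close> iff tile \<open>q\<close> is
  placed on \<open>i\<close>. Writing costs in base \<open>X\<close>, block \<open>b\<close> compares the west and south colours at \<open>b\<close> with
  the east colours at \<open>b - 1\<close> and the north colours at \<open>b - W\<close>.
\<close>

locale tile_numbers =
  fixes Q N W :: nat and we ea so no :: "nat \<Rightarrow> nat" and S :: "nat \<Rightarrow> nat"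
    and c0 c1 nl X Y :: nat
  assumes W: "0 < W" "W \<le> N"
    and Y: "2 * Q + 2 < Y"
    and X: "2 * (\<Sum>q<Q. Y ^ (2 * we q) + Y ^ (2 * ea q) + Y ^ Suc (2 * so q) + Y ^ Suc (2 * no q)) \<le> X"
    and c0: "\<exists>q<Q. we q = c0" and c1: "\<exists>q<Q. ea q = c1" and nl: "\<exists>q<Q. no q = nl"
    and S: "\<And>b. b < W \<Longrightarrow> \<exists>q<Q. so q = S b"
begin

text \<open>Even exponents for horizontal and odd ones for vertical colours let one block compare
  both kinds at once.\<close>

definition h :: "nat \<Rightarrow> nat" where "h c = Y ^ (2 * c)"
definition v :: "nat \<Rightarrow> nat" where "v c = Y ^ Suc (2 * c)"

definition "west_sum = (\<Sum>q<Q. h (we q))"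
definition "east_sum = (\<Sum>q<Q. h (ea q))"
definition "south_sum = (\<Sum>q<Q. v (so q))"
definition "north_sum = (\<Sum>q<Q. v (no q))"

definition pos :: "nat \<Rightarrow> nat \<Rightarrow> nat" where
  "pos i q = X ^ i * (h (we q) + v (so q))"

text \<open>The colours are charged to the blocks of the right and the upper neighbour, where they
  meet the west and south colours charged by \<open>pos\<close>.\<close>

definition neg :: "nat \<Rightarrow> nat \<Rightarrow> nat" where
  "neg i q = X ^ Suc i * h (ea q) + X ^ (i + W) * v (no q)"

text \<open>The digit \<open>rhs (\<lambda>_. {..<Q}) b - lhs (\<lambda>_. {}) b\<close>: what all
  tiles left out would contribute, corrected by the prescribed boundary. Likewise
  \<open>\<beta>\<close> is
  \<open>lhs (\<lambda>_. {..<Q}) b - rhs (\<lambda>_. {}) b\<close>.\<close>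

definition \<alpha> :: "nat \<Rightarrow> nat" where
  "\<alpha> b = (if b = 0 then h c0 else if b < N then east_sum else if b = N then east_sum - h c1 else 0) +
     (if b < W then v (S b) else if b < N then north_sum else north_sum - v nl)"

definition \<beta> :: "nat \<Rightarrow> nat" where
  "\<beta> b = (if b = 0 then west_sum - h c0 else if b < N then west_sum else if b = N then h c1 else 0) +
     (if b < W then south_sum - v (S b) else if b < N then south_sum else v nl)"

text \<open>
  The first two costs \<open>bal1\<close> and \<open>bal2\<close> make up for what the placed tiles leave open at the boundary.
  With \<open>cap\<close> consisting of maximal digits, their digits are computed without borrowing.
\<close>

definition cap :: nat where "cap = X ^ (N + W) - 1"
definition bal1 :: nat where "bal1 = (\<Sum>b<N + W. X ^ b * (X - 1 - \<alpha> b))"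
definition bal2 :: nat where "bal2 = (\<Sum>b<N + W. X ^ b * (X - 1 - \<beta> b))"

text \<open>Where a neighbour is missing, the prescribed colours stand in for it: \<open>c1\<close>
  and \<open>nl\<close> here, \<open>c0\<close> and \<open>S\<close> in \<open>rhs\<close>.\<close>

definition lhs :: "(nat \<Rightarrow> nat set) \<Rightarrow> nat \<Rightarrow> nat" where
  "lhs F b = (if b < N then \<Sum>q\<in>F b. h (we q) else if b = N then h c1 else 0) +
     (if b < N then \<Sum>q\<in>F b. v (so q) else v nl)"

definition rhs :: "(nat \<Rightarrow> nat set) \<Rightarrow> nat \<Rightarrow> nat" where
  "rhs F b = (if b = 0 then h c0 else if b \<le> N then \<Sum>q\<in>F (b - 1). h (ea q) else 0) +
     (if b < W then v (S b) else \<Sum>q\<in>F (b - W). v (no q))"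

definition matches :: "(nat \<Rightarrow> nat) \<Rightarrow> bool" where
  "matches \<tau> \<longleftrightarrow> (\<forall>i<N. \<tau> i < Q) \<and> we (\<tau> 0) = c0 \<and> ea (\<tau> (N - 1)) = c1 \<and>
     (\<forall>i. Suc i < N \<longrightarrow> we (\<tau> (Suc i)) = ea (\<tau> i)) \<and>
     (\<forall>i<W. so (\<tau> i) = S i) \<and>
     (\<forall>i<N. if i + W < N then so (\<tau> (i + W)) = no (\<tau> i) else no (\<tau> i) = nl)"

lemma le_sum: "q < Q \<Longrightarrow> g q \<le> (\<Sum>q<Q. g q)" for g :: "nat \<Rightarrow> nat"
  by (rule member_le_sum) auto

lemma le_sums: "h c0 \<le> west_sum" "h c1 \<le> east_sum" "v nl \<le> north_sum"
    "b < W \<Longrightarrow> v (S b) \<le> south_sum"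
  using c0 c1 nl S[of b] le_sum[of _ "\<lambda>q. h (we q)"] le_sum[of _ "\<lambda>q. h (ea q)"]
    le_sum[of _ "\<lambda>q. v (no q)"] le_sum[of _ "\<lambda>q. v (so q)"]
  unfolding west_sum_def east_sum_def north_sum_def south_sum_def by metis+

lemma sums_le_X: "2 * (west_sum + east_sum + south_sum + north_sum) \<le> X"
  using X by (simp add: west_sum_def east_sum_def south_sum_def north_sum_def h_def v_def sum.distrib)

lemma Y_pos: "0 < Y"
  using Y by simp

lemma h_pos: "0 < h c" and v_pos: "0 < v c"
  using Y_pos by (auto simp: h_def v_def)

lemma X_ge_8: "8 \<le> X"
proof -
  have "1 \<le> north_sum" "1 \<le> east_sum" "1 \<le> west_sum" "1 \<le> south_sum"
    using le_sums(1-3) le_sums(4)[of 0] h_pos[of c0] h_pos[of c1] v_pos[of nl] v_pos[of "S 0"] W(1)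
    by linarith+
  then have "4 \<le> west_sum + east_sum + south_sum + north_sum" by linarith
  then have "2 * 4 \<le> 2 * (west_sum + east_sum + south_sum + north_sum)" by (rule mult_le_mono2)
  then show ?thesis using sums_le_X by simp
qed

lemma sums_less_X: "west_sum + east_sum + south_sum + north_sum < X"
  using sums_le_X X_ge_8 by simp

text \<open>The factor 2 in the assumption on \<open>X\<close> is spent here: the complements
  \<open>X - 1 - \<alpha> b\<close> are so large that, for a power of two, their top bit is
  set.\<close>

lemma \<alpha>_le: "2 * \<alpha> b < X" and \<beta>_le: "2 * \<beta> b < X"
  using sums_le_X le_sums(1-3) le_sums(4)[of b] h_pos[of c0] h_pos[of c1] v_pos[of nl] by (auto simp: \<alpha>_def \<beta>_def)

lemma sum_X: "(\<Sum>b<n. X ^ b * (X - 1)) = X ^ n - 1"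
proof (induction n)
  case (Suc n)
  have "1 \<le> X ^ n" "X ^ n \<le> X * X ^ n" using X_ge_8 by simp_all
  then show ?case using Suc by (simp add: diff_mult_distrib2 algebra_simps)
qed simp

lemma bal_\<alpha>: "bal1 + (\<Sum>b<N + W. X ^ b * \<alpha> b) = cap" and bal_\<beta>: "bal2 + (\<Sum>b<N + W. X ^ b * \<beta> b) = cap"
proof -
  have "X - 1 - \<alpha> b + \<alpha> b = X - 1" "X - 1 - \<beta> b + \<beta> b = X - 1" for b
    using \<alpha>_le[of b] \<beta>_le[of b] X_ge_8 by auto
  then show "bal1 + (\<Sum>b<N + W. X ^ b * \<alpha> b) = cap" "bal2 + (\<Sum>b<N + W. X ^ b * \<beta> b) = cap"
    by (simp_all add: cap_def bal1_def bal2_def sum.distrib[symmetric]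
        distrib_left[symmetric] sum_X[unfolded One_nat_def] del: diff_diff_left)
qed

lemma sum_lhs:
  "(\<Sum>b<N + W. X ^ b * lhs F b) =
    (\<Sum>i<N. \<Sum>q\<in>F i. pos i q) + (X ^ N * h c1 + (\<Sum>b<W. X ^ (N + b) * v nl))"
proof -
  have "(\<Sum>b<N. X ^ b * lhs F b) = (\<Sum>i<N. \<Sum>q\<in>F i. pos i q)"
    by (intro sum.cong) (auto simp: lhs_def pos_def sum_distrib_left sum.distrib distrib_left)
  moreover have "(\<Sum>b<W. X ^ (N + b) * lhs F (N + b)) =
      (\<Sum>b<W. (if b = 0 then X ^ N * h c1 else 0) + X ^ (N + b) * v nl)"
    by (intro sum.cong) (auto simp: lhs_def algebra_simps)
  then have "(\<Sum>b<W. X ^ (N + b) * lhs F (N + b)) = X ^ N * h c1 + (\<Sum>b<W. X ^ (N + b) * v nl)"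
    using W by (simp add: sum.distrib)
  ultimately show ?thesis by (simp add: sum_lessThan_add)
qed

lemma sum_rhs:
  "(\<Sum>b<N + W. X ^ b * rhs F b) =
    (\<Sum>i<N. \<Sum>q\<in>F i. neg i q) + (h c0 + (\<Sum>b<W. X ^ b * v (S b)))"
proof -
  let ?H = "\<lambda>b. if b = 0 then h c0 else if b \<le> N then \<Sum>q\<in>F (b - 1). h (ea q) else 0"
  let ?V = "\<lambda>b. if b < W then v (S b) else \<Sum>q\<in>F (b - W). v (no q)"
  have "(\<Sum>b<N + W. X ^ b * ?V b) = (\<Sum>b<W + N. X ^ b * ?V b)" by (simp add: add.commute)
  also have "\<dots> = (\<Sum>b<W. X ^ b * v (S b)) + (\<Sum>i<N. X ^ (i + W) * (\<Sum>q\<in>F i. v (no q)))"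
    unfolding sum_lessThan_add by (intro arg_cong2[of _ _ _ _ "(+)"] sum.cong) (auto simp: add.commute)
  finally have V: "(\<Sum>b<N + W. X ^ b * ?V b) = \<dots>" .
  have "N + W = Suc N + (W - 1)" using W by simp
  then have "(\<Sum>b<N + W. X ^ b * ?H b) = (\<Sum>b<Suc N. X ^ b * ?H b) + (\<Sum>b<W - 1. X ^ (Suc N + b) * ?H (Suc N + b))"
    by (simp only: sum_lessThan_add)
  also have "(\<Sum>b<W - 1. X ^ (Suc N + b) * ?H (Suc N + b)) = 0" by simp
  also have "(\<Sum>b<Suc N. X ^ b * ?H b) = h c0 + (\<Sum>i<N. X ^ Suc i * (\<Sum>q\<in>F i. h (ea q)))"
    unfolding sum.lessThan_Suc_shift by (intro arg_cong2[of _ _ _ _ "(+)"] sum.cong) auto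
  finally have H: "(\<Sum>b<N + W. X ^ b * ?H b) = h c0 + (\<Sum>i<N. X ^ Suc i * (\<Sum>q\<in>F i. h (ea q)))"
    by simp
  have "(\<Sum>b<N + W. X ^ b * rhs F b) = (\<Sum>b<N + W. X ^ b * ?H b) + (\<Sum>b<N + W. X ^ b * ?V b)"
    unfolding sum.distrib[symmetric] distrib_left[symmetric] rhs_def ..
  also have "(\<Sum>i<N. \<Sum>q\<in>F i. neg i q) = (\<Sum>i<N. X ^ Suc i * (\<Sum>q\<in>F i. h (ea q))) +
      (\<Sum>i<N. X ^ (i + W) * (\<Sum>q\<in>F i. v (no q)))"
    unfolding sum.distrib[symmetric] neg_def sum_distrib_left ..
  ultimately show ?thesis unfolding H V by simp
qed

lemma sum_\<alpha>: "(\<Sum>b<N + W. X ^ b * \<alpha> b) + (X ^ N * h c1 + (\<Sum>b<W. X ^ (N + b) * v nl)) =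
    (\<Sum>i<N. \<Sum>q<Q. neg i q) + (h c0 + (\<Sum>b<W. X ^ b * v (S b)))"
proof -
  have "rhs (\<lambda>_. {..<Q}) b = \<alpha> b + lhs (\<lambda>_. {}) b" if "b < N + W" for b
    using that W le_sums(2,3)
    by (auto simp: rhs_def \<alpha>_def lhs_def east_sum_def[symmetric] north_sum_def[symmetric])
  then have "(\<Sum>b<N + W. X ^ b * rhs (\<lambda>_. {..<Q}) b) =
      (\<Sum>b<N + W. X ^ b * \<alpha> b) + (\<Sum>b<N + W. X ^ b * lhs (\<lambda>_. {}) b)"
    unfolding sum.distrib[symmetric] distrib_left[symmetric] by (intro sum.cong) auto
  then show ?thesis unfolding sum_rhs sum_lhs by simp
qed

lemma sum_\<beta>: "(\<Sum>b<N + W. X ^ b * \<beta> b) + (h c0 + (\<Sum>b<W. X ^ b * v (S b))) =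
    (\<Sum>i<N. \<Sum>q<Q. pos i q) + (X ^ N * h c1 + (\<Sum>b<W. X ^ (N + b) * v nl))"
proof -
  have "lhs (\<lambda>_. {..<Q}) b = \<beta> b + rhs (\<lambda>_. {}) b" if "b < N + W" for b
    using that W le_sums(1) le_sums(4)[of b]
    by (auto simp: rhs_def \<beta>_def lhs_def west_sum_def[symmetric] south_sum_def[symmetric])
  then have "(\<Sum>b<N + W. X ^ b * lhs (\<lambda>_. {..<Q}) b) =
      (\<Sum>b<N + W. X ^ b * \<beta> b) + (\<Sum>b<N + W. X ^ b * rhs (\<lambda>_. {}) b)"
    unfolding sum.distrib[symmetric] distrib_left[symmetric] by (intro sum.cong) auto
  then show ?thesis unfolding sum_rhs sum_lhs by simp
qed

text \<open>The boundary terms of \<open>sum_\<alpha>\<close> and \<open>sum_\<beta>\<close>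
  cancel.\<close>

lemma total: "bal1 + bal2 + (\<Sum>i<N. \<Sum>q<Q. pos i q + neg i q) = 2 * cap"
  using sum_\<alpha> sum_\<beta> bal_\<alpha> bal_\<beta> by (simp add: sum.distrib)

text \<open>Adding the \<open>neg\<close> costs of the placed tiles to both sides completes the sum
  over the omitted tiles to the fixed sum over all tiles. What remains equates the
  \<open>pos\<close> and \<open>neg\<close> costs of the placed tiles up to boundary terms.\<close>

lemma choice_iff_digits:
  assumes F: "\<And>i. F i \<subseteq> {..<Q}"
  shows "bal1 + (\<Sum>i<N. \<Sum>q<Q. if q \<in> F i then pos i q else neg i q) = cap \<longleftrightarrow>
    (\<forall>b < N + W. lhs F b = rhs F b)"
proof -
  have restrict: "(\<Sum>q\<in>F i. g q) = (\<Sum>q<Q. if q \<in> F i then g q else 0)" for i and g :: "nat \<Rightarrow> nat"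
    using F[of i] by (simp add: sum.If_cases Int_absorb1 Int_absorb2)
  have "(\<Sum>i<N. \<Sum>q<Q. if q \<in> F i then pos i q else neg i q) + (\<Sum>i<N. \<Sum>q\<in>F i. neg i q) =
      (\<Sum>i<N. \<Sum>q\<in>F i. pos i q) + (\<Sum>i<N. \<Sum>q<Q. neg i q)"
    unfolding restrict sum.distrib[symmetric] by (intro sum.cong) auto
  then have "bal1 + (\<Sum>i<N. \<Sum>q<Q. if q \<in> F i then pos i q else neg i q) = cap \<longleftrightarrow>
      (\<Sum>b<N + W. X ^ b * lhs F b) = (\<Sum>b<N + W. X ^ b * rhs F b)"
    using sum_\<alpha> bal_\<alpha> unfolding sum_lhs sum_rhs by linarith
  also have "\<dots> \<longleftrightarrow> (\<forall>b < N + W. lhs F b = rhs F b)"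
  proof
    have mono: "(\<Sum>q\<in>F i. g q) \<le> (\<Sum>q<Q. g q)" for i and g :: "nat \<Rightarrow> nat"
      using F by (intro sum_mono2) auto
    have "lhs F b < X" for b
      using mono[of "\<lambda>q. h (we q)" b] mono[of "\<lambda>q. v (so q)" b] sums_le_X le_sums X_ge_8
      unfolding lhs_def west_sum_def[symmetric] south_sum_def[symmetric] by auto
    moreover have "rhs F b < X" for b
      using mono[of "\<lambda>q. h (ea q)" "b - 1"] mono[of "\<lambda>q. v (no q)" "b - W"] sums_le_X 
        le_sums(1) le_sums(4)[of b] X_ge_8
      unfolding rhs_def east_sum_def[symmetric] north_sum_def[symmetric] by auto
    moreover assume "(\<Sum>b<N + W. X ^ b * lhs F b) = (\<Sum>b<N + W. X ^ b * rhs F b)"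
    ultimately show "\<forall>b < N + W. lhs F b = rhs F b"
      using digits_unique[of "N + W" "lhs F" X "rhs F"] by blast
  qed simp
  finally show ?thesis .
qed

lemma colours_unique:
  assumes "(\<Sum>c\<in>#A. h c) + (\<Sum>c\<in>#B. v c) = (\<Sum>c\<in>#A'. h c) + (\<Sum>c\<in>#B'. v c)"
    and "size A + size B < Y" "size A' + size B' < Y"
  shows "A = A' \<and> B = B'"
proof -
  let ?f = "\<lambda>A B. image_mset (\<lambda>c. 2 * c) A + image_mset (\<lambda>c. Suc (2 * c)) B"
  have "?f A B = ?f A' B'"
    using assms by (intro mset_eqI_sum_powers[of Y]) (auto simp: h_def v_def multiset.map_comp comp_def)
  moreover have "filter_mset even (?f A B) = image_mset (\<lambda>c. 2 * c) A"
    "filter_mset odd (?f A B) = image_mset (\<lambda>c. Suc (2 * c)) B" for A B :: "nat multiset"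
    by (auto simp: filter_mset_image_mset)
  ultimately have "image_mset (\<lambda>c. 2 * c) A = image_mset (\<lambda>c. 2 * c) A'"
    "image_mset (\<lambda>c. Suc (2 * c)) B = image_mset (\<lambda>c. Suc (2 * c)) B'" by metis+
  moreover have "inj (image_mset (\<lambda>c :: nat. 2 * c))" "inj (image_mset (\<lambda>c :: nat. Suc (2 * c)))"
    by (intro multiset.inj_map; simp add: inj_on_def)+
  ultimately show ?thesis by (auto dest: injD)
qed

lemma digits_iff_matches:
  assumes F: "\<And>i. F i \<subseteq> {..<Q}"
  shows "(\<forall>b < N + W. lhs F b = rhs F b) \<longleftrightarrow> (\<exists>\<tau>. (\<forall>i<N. F i = {\<tau> i}) \<and> matches \<tau>)"
proof
  assume eq: "\<forall>b < N + W. lhs F b = rhs F b"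
  let ?AH = "\<lambda>b. if b < N then image_mset we (mset_set (F b)) else if b = N then {#c1#} else {#}"
  let ?AV = "\<lambda>b. if b < N then image_mset so (mset_set (F b)) else {#nl#}"
  let ?BH = "\<lambda>b. if b = 0 then {#c0#} else if b \<le> N then image_mset ea (mset_set (F (b - 1))) else {#}"
  let ?BV = "\<lambda>b. if b < W then {#S b#} else image_mset no (mset_set (F (b - W)))"
  have fin: "finite (F i)" for i using F finite_subset by blast
  have card: "card (F i) \<le> Q" for i using card_mono[OF _ F[of i]] by simp
  \<comment> \<open>This makes \<open>Q\<close> a bound for the singleton multisets at the boundary,
    too.\<close>
  have "0 < Q" using c0 by auto
  then have sz: "size (?AH b) \<le> Q" "size (?AV b) \<le> Q" "size (?BH b) \<le> Q" "size (?BV b) \<le> Q" for b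
    using card by auto
  have sizes: "size (?AH b) + size (?AV b) < Y" "size (?BH b) + size (?BV b) < Y" for b
    using Y sz(1)[of b] sz(2)[of b] sz(3)[of b] sz(4)[of b] by linarith+
  have l: "lhs F b = (\<Sum>c\<in>#?AH b. h c) + (\<Sum>c\<in>#?AV b. v c)" for b
    by (simp add: lhs_def multiset.map_comp comp_def sum_unfold_sum_mset)
  have r: "rhs F b = (\<Sum>c\<in>#?BH b. h c) + (\<Sum>c\<in>#?BV b. v c)" for b
    by (simp add: rhs_def multiset.map_comp comp_def sum_unfold_sum_mset)
  have col: "?AH b = ?BH b \<and> ?AV b = ?BV b" if "b < N + W" for b
    by (rule colours_unique) (use eq that l r sizes in auto)
  \<comment> \<open>Equal multisets have equal sizes, so comparing horizontal colours carries
    uniqueness from each position to the next.\<close>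
  have "card (F i) = 1" if "i < N" for i
    using that
  proof (induction i)
    case 0
    then have "image_mset we (mset_set (F 0)) = {#c0#}" using col[of 0] by simp
    from arg_cong[OF this, of size] show ?case by simp
  next
    case (Suc i)
    then have "image_mset we (mset_set (F (Suc i))) = image_mset ea (mset_set (F i))"
      using col[of "Suc i"] by simp
    from arg_cong[OF this, of size] show ?case using Suc by simp
  qed
  then have "\<forall>i. \<exists>t. i < N \<longrightarrow> F i = {t}" by (simp add: card_1_singleton_iff)
  from choice[OF this] obtain \<tau> where \<tau>: "\<And>i. i < N \<Longrightarrow> F i = {\<tau> i}" by blast
  have "matches \<tau>"
    unfolding matches_def
  proof (intro conjI allI impI)
    show "\<tau> i < Q" if "i < N" for i using F[of i] \<tau>[OF that] by simp
    show "we (\<tau> 0) = c0" using col[of 0] W \<tau>[of 0] by simp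
    show "ea (\<tau> (N - 1)) = c1" using col[of N] W \<tau>[of "N - 1"] by simp
    show "we (\<tau> (Suc i)) = ea (\<tau> i)" if "Suc i < N" for i
      using col[of "Suc i"] that \<tau>[of i] \<tau>[of "Suc i"] by simp
    show "so (\<tau> i) = S i" if "i < W" for i
      using col[of i] that W \<tau>[of i] by simp
    show "if i + W < N then so (\<tau> (i + W)) = no (\<tau> i) else no (\<tau> i) = nl" if "i < N" for i
      using col[of "i + W"] that \<tau>[of i] \<tau>[of "i + W"] by (simp split: if_splits)
  qed
  then show "\<exists>\<tau>. (\<forall>i<N. F i = {\<tau> i}) \<and> matches \<tau>" using \<tau> by blast
next
  assume "\<exists>\<tau>. (\<forall>i<N. F i = {\<tau> i}) \<and> matches \<tau>"
  then obtain \<tau> where \<tau>: "\<And>i. i < N \<Longrightarrow> F i = {\<tau> i}" and m: "matches \<tau>" by blast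
  show "\<forall>b < N + W. lhs F b = rhs F b"
  proof (intro allI impI)
    fix b assume b: "b < N + W"
    have "(if b < N then \<Sum>q\<in>F b. h (we q) else if b = N then h c1 else 0) =
      (if b = 0 then h c0 else if b \<le> N then \<Sum>q\<in>F (b - 1). h (ea q) else 0)"
      using m W \<tau>[of b] \<tau>[of "b - 1"] by (cases b) (auto simp: matches_def)
    moreover have "(if b < N then \<Sum>q\<in>F b. v (so q) else v nl) =
      (if b < W then v (S b) else \<Sum>q\<in>F (b - W). v (no q))"
    proof (cases "b < W")
      case True
      then show ?thesis using m W \<tau>[of b] by (simp add: matches_def)
    next
      case False
      then have "b - W < N" "b - W + W = b" using b by auto
      moreover have "if b - W + W < N then so (\<tau> (b - W + W)) = no (\<tau> (b - W)) else no (\<tau> (b - W)) = nl"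
        using m \<open>b - W < N\<close> unfolding matches_def by blast
      ultimately show ?thesis using False \<tau>[of b] \<tau>[of "b - W"] by (simp split: if_splits)
    qed
    ultimately show "lhs F b = rhs F b" by (simp only: lhs_def rhs_def)
  qed
qed

text \<open>The points are powers of two because their binary code is a run of zeros, written by
  looping over a unary counter for \<open>i\<close>, followed by a constant. Point 0 is left for the
  balancing pair.\<close>

definition tile_pairs :: "(nat \<times> nat \<times> nat) list" where
  "tile_pairs = concat (map (\<lambda>i. map (\<lambda>q. (2 ^ (i * Q + q), pos i q, neg i q)) [0..<Q]) [0..<N])"

definition instance_pairs :: "(nat \<times> nat \<times> nat) list" where
  "instance_pairs = (0, bal1, bal2) # tile_pairs"

lemma sum_tile_pairs:
  fixes g :: "nat \<times> nat \<times> nat \<Rightarrow> nat"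
  shows "(\<Sum>x\<leftarrow>tile_pairs. g x) = (\<Sum>i<N. \<Sum>q<Q. g (2 ^ (i * Q + q), pos i q, neg i q))"
proof -
  have "(\<Sum>x\<leftarrow>concat (map (\<lambda>i. map (\<lambda>q. (2 ^ (i * Q + q), pos i q, neg i q)) [0..<Q]) [0..<n]). g x) =
      (\<Sum>i<n. \<Sum>q<Q. g (2 ^ (i * Q + q), pos i q, neg i q))" for n
    by (induction n) (simp_all add: comp_def interv_sum_list_conv_sum_set_nat atLeast0LessThan)
  then show ?thesis by (simp add: tile_pairs_def)
qed

lemma point_eq_iff:
  assumes "q < Q" "q' < Q"
  shows "(2 :: nat) ^ (i * Q + q) = 2 ^ (i' * Q + q') \<longleftrightarrow> i = i' \<and> q = q'"
proof -
  have "i = i' \<and> q = q'" if "i * Q + q = i' * Q + q'"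
    using arg_cong[OF that, of "\<lambda>x. x div Q"] arg_cong[OF that, of "\<lambda>x. x mod Q"] assms by simp
  then show ?thesis by (auto simp: power_inject_exp)
qed

lemma distinct_instance_pairs: "distinct (map fst instance_pairs)"
proof -
  have "map fst tile_pairs = map (\<lambda>x. 2 ^ x) [0..<N * Q]"
  proof -
    have "map fst (concat (map (\<lambda>i. map (\<lambda>q. (2 ^ (i * Q + q), pos i q, neg i q)) [0..<Q]) [0..<n])) =
        map (\<lambda>x. 2 ^ x) [0..<n * Q]" for n
    proof (induction n)
      case (Suc n)
      have "[0..<n * Q + Q] = [0..<n * Q] @ [n * Q..<n * Q + Q]"
        by (rule upt_add_eq_append) simp
      also have "[n * Q..<n * Q + Q] = map (\<lambda>q. n * Q + q) [0..<Q]"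
        using map_add_upt[of "n * Q" Q] by (simp add: add.commute)
      finally have "[0..<Suc n * Q] = [0..<n * Q] @ map (\<lambda>q. n * Q + q) [0..<Q]"
        by (simp add: add.commute)
      then show ?case using Suc by (simp add: comp_def)
    qed simp
    then show ?thesis by (simp add: tile_pairs_def)
  qed
  then show ?thesis by (simp add: instance_pairs_def distinct_map inj_on_def power_inject_exp image_iff)
qed

lemma set_tile_pairsD:
  "(p, a, b) \<in> set tile_pairs \<Longrightarrow> \<exists>i<N. \<exists>q<Q. a = pos i q \<and> b = neg i q"
  by (auto simp: tile_pairs_def; blast)

theorem min_drones_tiles:
  "valid_instance (pair_instance cap instance_pairs) \<and>
   (min_drones (pair_instance cap instance_pairs) \<le> 2 \<longleftrightarrow> (\<exists>\<tau>. matches \<tau>))"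
proof
  have X1: "1 \<le> X" using X_ge_8 by simp
  have le_total: "pos i q \<le> cap \<and> neg i q \<le> cap" if "i < N" "q < Q" for i q
  proof -
    have "h (we q) + v (so q) < X"
    proof -
      have "h (we q) \<le> west_sum" "v (so q) \<le> south_sum"
        using that by (auto simp: west_sum_def south_sum_def intro: le_sum)
      then show ?thesis using sums_less_X by linarith
    qed
    then have "pos i q < X ^ i * X" unfolding pos_def using X1 by (intro mult_strict_left_mono) auto
    also have "\<dots> \<le> X ^ (N + W)" unfolding power_Suc2[symmetric] using that X1 W
      by (intro power_increasing) auto
    finally have 1: "pos i q \<le> cap" by (simp add: cap_def)
    have he: "h (ea q) \<le> east_sum" "v (no q) \<le> north_sum"
        using that by (auto simp: east_sum_def north_sum_def intro: le_sum)
    have "neg i q \<le> X ^ (i + W) * h (ea q) + X ^ (i + W) * v (no q)"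
      unfolding neg_def using W X1 by (intro add_mono mult_right_mono power_increasing) auto
    also have "\<dots> = X ^ (i + W) * (h (ea q) + v (no q))" by (simp add: distrib_left)
    also have "\<dots> < X ^ (i + W) * X" using he sums_less_X X1
      by (intro mult_strict_left_mono) auto
    also have "\<dots> \<le> X ^ (N + W)" unfolding power_Suc2[symmetric] using that X1 W
      by (intro power_increasing) auto
    finally have "neg i q \<le> cap" by (simp add: cap_def)
    with 1 show ?thesis by simp
  qed
  have pos: "0 < pos i q" "0 < neg i q" for i q
    using X1 h_pos v_pos by (auto simp: pos_def neg_def)
  \<comment> \<open>Costs have to be positive, and one positive digit is enough for that.\<close>
  have "0 < X - 1 - \<alpha> 0" "0 < X - 1 - \<beta> 0" using \<alpha>_le[of 0] \<beta>_le[of 0] X_ge_8 by linarith+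
  then have "0 < bal1" "0 < bal2"
    unfolding bal1_def bal2_def using W by (auto intro!: sum_pos2[of _ 0])
  moreover have "0 < cap" using calculation(1) bal_\<alpha> by linarith
  moreover have "bal1 \<le> cap" "bal2 \<le> cap" using bal_\<alpha> bal_\<beta> by linarith+
  ultimately show valid: "valid_instance (pair_instance cap instance_pairs)"
    using le_total pos
    by (intro valid_pair_instance) (auto simp: instance_pairs_def dest!: set_tile_pairsD)
  have total': "(\<Sum>(p, a, b)\<leftarrow>instance_pairs. a + b) = 2 * cap"
    using total by (simp add: instance_pairs_def sum_tile_pairs)
  have "min_drones (pair_instance cap instance_pairs) \<le> 2 \<longleftrightarrow>
      (\<exists>f. bal1 + (\<Sum>(p, a, b)\<leftarrow>tile_pairs. if f p then a else b) = cap)"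
    using distinct_instance_pairs valid total' unfolding instance_pairs_def
    by (rule min_drones_pair_instance_Cons)
  also have "\<dots> \<longleftrightarrow> (\<exists>f. bal1 + (\<Sum>i<N. \<Sum>q<Q. if f ((2 :: nat) ^ (i * Q + q)) then pos i q else neg i q) = cap)"
    by (simp add: sum_tile_pairs)
  also have "\<dots> \<longleftrightarrow> (\<exists>F. (\<forall>i. F i \<subseteq> {..<Q}) \<and>
      bal1 + (\<Sum>i<N. \<Sum>q<Q. if q \<in> F i then pos i q else neg i q) = cap)"
  proof
    assume "\<exists>f. bal1 + (\<Sum>i<N. \<Sum>q<Q. if f ((2 :: nat) ^ (i * Q + q)) then pos i q else neg i q) = cap"
    then obtain f where f: "bal1 + (\<Sum>i<N. \<Sum>q<Q. if f ((2 :: nat) ^ (i * Q + q)) then pos i q else neg i q) = cap"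
      by blast
    define F where "F i = {q. q < Q \<and> f (2 ^ (i * Q + q))}" for i
    have F: "F i \<subseteq> {..<Q}" for i by (auto simp: F_def)
    have "(\<Sum>i<N. \<Sum>q<Q. if q \<in> F i then pos i q else neg i q) =
        (\<Sum>i<N. \<Sum>q<Q. if f ((2 :: nat) ^ (i * Q + q)) then pos i q else neg i q)"
      by (intro sum.cong) (auto simp: F_def)
    then show "\<exists>F. (\<forall>i. F i \<subseteq> {..<Q}) \<and>
      bal1 + (\<Sum>i<N. \<Sum>q<Q. if q \<in> F i then pos i q else neg i q) = cap"
      using f F by (intro exI[of _ F] conjI) (simp_all only: simp_thms)
  next
    assume "\<exists>F. (\<forall>i. F i \<subseteq> {..<Q}) \<and>
      bal1 + (\<Sum>i<N. \<Sum>q<Q. if q \<in> F i then pos i q else neg i q) = cap"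
    then obtain F where F: "bal1 + (\<Sum>i<N. \<Sum>q<Q. if q \<in> F i then pos i q else neg i q) = cap"
      by blast
    define f where "f p \<longleftrightarrow> (\<exists>i q. p = 2 ^ (i * Q + q) \<and> q < Q \<and> q \<in> F i)" for p :: nat
    have "f (2 ^ (i * Q + q)) \<longleftrightarrow> q \<in> F i" if "q < Q" for i q
    proof
      assume "f (2 ^ (i * Q + q))"
      then obtain i' q' where "(2 :: nat) ^ (i * Q + q) = 2 ^ (i' * Q + q')" "q' < Q" "q' \<in> F i'"
        unfolding f_def by blast
      then show "q \<in> F i" using point_eq_iff[OF that] by simp
    qed (use that f_def in blast)
    then have "(\<Sum>i<N. \<Sum>q<Q. if f ((2 :: nat) ^ (i * Q + q)) then pos i q else neg i q) =
        (\<Sum>i<N. \<Sum>q<Q. if q \<in> F i then pos i q else neg i q)"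
      by (intro sum.cong refl) simp
    then show "\<exists>f. bal1 + (\<Sum>i<N. \<Sum>q<Q. if f ((2 :: nat) ^ (i * Q + q)) then pos i q else neg i q) = cap"
      using F by (intro exI[of _ f]) (simp only:)
  qed
  also have "\<dots> \<longleftrightarrow> (\<exists>F. (\<forall>i. F i \<subseteq> {..<Q}) \<and> (\<exists>\<tau>. (\<forall>i<N. F i = {\<tau> i}) \<and> matches \<tau>))"
    by (intro ex_cong1 conj_cong refl) (simp only: choice_iff_digits digits_iff_matches)
  also have "\<dots> \<longleftrightarrow> (\<exists>\<tau>. matches \<tau>)"
  proof
    assume "\<exists>\<tau>. matches \<tau>"
    then obtain \<tau> where "matches \<tau>" by blast
    then show "\<exists>F. (\<forall>i. F i \<subseteq> {..<Q}) \<and> (\<exists>\<tau>. (\<forall>i<N. F i = {\<tau> i}) \<and> matches \<tau>)"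
      by (intro exI[of _ "\<lambda>i. if i < N then {\<tau> i} else {}"]) (auto simp: matches_def)
  qed blast
  finally show "min_drones (pair_instance cap instance_pairs) \<le> 2 \<longleftrightarrow> (\<exists>\<tau>. matches \<tau>)" .
qed

end

section \<open>Tiles of a Turing machine and their colours\<close>

instance move :: countable
  by countable_datatype

instance signal :: countable
  by countable_datatype

type_synonym tile = "signal \<times> cell \<times> cell \<times> cell \<times> signal \<times> cell"

text \<open>Horizontal neighbours overlap in two cells: \<open>east\<close> of one tile equals
  \<open>west\<close> of the next iff the cells \<open>x\<close>, \<open>r\<close> and the outgoing
  signal of the first are the cells \<open>l\<close>, \<open>x\<close> and the incoming signal of
  the second.\<close>

fun west :: "tile \<Rightarrow> cell \<times> cell \<times> signal" where
  "west (g, l, x, r, g', u) = (l, x, g)"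

fun east :: "tile \<Rightarrow> cell \<times> cell \<times> signal" where
  "east (g, l, x, r, g', u) = (x, r, g')"

fun south :: "tile \<Rightarrow> cell" where
  "south (g, l, x, r, g', u) = x"

fun north :: "tile \<Rightarrow> cell" where
  "north (g, l, x, r, g', u) = u"

lemma west_eq: "west t = (fst (west t), south t, fst t)"
  by (cases t) auto

lemma fst_east: "fst (east t) = south t"
  by (cases t) auto

lemma tile_eqI: "west t = (l, x, g) \<Longrightarrow> east t = (x, r, g') \<Longrightarrow> north t = u \<Longrightarrow> t = (g, l, x, r, g', u)"
  by (cases t) auto

definition tiles :: "tm \<Rightarrow> tile set" where
  "tiles M = {(g, l, x, r, g', u). g \<in> signals M \<and> l \<in> cells M \<and> x \<in> cells M \<and> r \<in> cells M \<and>
     g' \<in> signals M \<and> u \<in> cells M \<and> locally_ok M g l x r g' u}"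

lemma finite_tiles: "wf_tm M \<Longrightarrow> finite (tiles M)"
  by (rule finite_subset[of _ "signals M \<times> cells M \<times> cells M \<times> cells M \<times> signals M \<times> cells M"])
    (auto simp: tiles_def finite_signals finite_cells)

lemma snd_null: "snd (null k) = 0"
  by (simp add: null_def)

text \<open>\<open>End\<close> tolerates any cell below it, so these tiles provide the south colours
  of the first row as well as the boundary colours in the north and at the east end.\<close>

lemma end_tile: "x \<in> cells M \<Longrightarrow> (End, null (ntapes M), x, null (ntapes M), End, null (ntapes M)) \<in> tiles M"
  by (auto simp: tiles_def null_in_cells locally_ok_def up_def signals_def)

lemma start_tile: 
  assumes "wf_tm M"
  shows "\<exists>t \<in> tiles M. west t = (null (ntapes M), null (ntapes M), Start)"
proof -
  let ?z = "null (ntapes M)"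
  have "up (ntapes M) Start ?z ?z ?z \<in> cells M"
    by (rule up_in_cells[OF assms]) (auto simp: null_in_cells signals_def)
  then have "(Start, ?z, ?z, ?z, Start, up (ntapes M) Start ?z ?z ?z) \<in> tiles M"
    by (simp add: tiles_def null_in_cells locally_ok_def signals_def snd_null)
  then show ?thesis by (intro bexI) auto
qed

text \<open>Column 0 lies left of the input, so the west colour at position 0 is the same for all
  inputs.\<close>

lemma first_row_0: "0 < k \<Longrightarrow> first_row k U w 0 = null k"
  by (cases k) (auto simp: first_row_def null_def contents_def flag_def)

text \<open>About \<open>to_nat\<close> only injectivity matters. The tiles depend on
  \<open>M\<close> alone, so all exponents are constants of the machine.\<close>

locale tm_tiles =
  fixes M :: tm and ts :: "tile list" and X Y :: nat
  assumes wf: "wf_tm M" and ts: "set ts = tiles M"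
    and Y: "2 * length ts + 2 < Y"
    and X: "2 * (\<Sum>q<length ts. Y ^ (2 * to_nat (west (ts ! q))) + Y ^ (2 * to_nat (east (ts ! q))) +
      Y ^ Suc (2 * to_nat (south (ts ! q))) + Y ^ Suc (2 * to_nat (north (ts ! q)))) \<le> X"
begin

abbreviation "k \<equiv> ntapes M"

lemma k_pos: "0 < k"
  using wf by (auto simp: wf_tm_def)

lemma tile_index: "t \<in> tiles M \<Longrightarrow> \<exists>q<length ts. ts ! q = t"
  unfolding ts[symmetric] in_set_conv_nth .

lemma tile_numbers:
  assumes "W = width U (length w)" "N = (U + 1) * W"
  shows "tile_numbers (length ts) N W (\<lambda>q. to_nat (west (ts ! q))) (\<lambda>q. to_nat (east (ts ! q)))
    (\<lambda>q. to_nat (south (ts ! q))) (\<lambda>q. to_nat (north (ts ! q)))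
    (\<lambda>b. to_nat (first_row k U w b)) (to_nat (null k, null k, Start)) (to_nat (null k, null k, End))
    (to_nat (null k)) X Y"
proof
  show "0 < W" "W \<le> N" using assms by (auto simp: width_def)
  show "2 * length ts + 2 < Y" by (rule Y)
  show "2 * (\<Sum>q<length ts. Y ^ (2 * to_nat (west (ts ! q))) + Y ^ (2 * to_nat (east (ts ! q))) +
      Y ^ Suc (2 * to_nat (south (ts ! q))) + Y ^ Suc (2 * to_nat (north (ts ! q)))) \<le> X"
    by (rule X)
  show "\<exists>q<length ts. to_nat (west (ts ! q)) = to_nat (null k, null k, Start)"
    using start_tile[OF wf] tile_index by (metis)
  show "\<exists>q<length ts. to_nat (east (ts ! q)) = to_nat (null k, null k, End)"
    using tile_index[OF end_tile[OF null_in_cells]] by (metis east.simps)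
  show "\<exists>q<length ts. to_nat (north (ts ! q)) = to_nat (null k)"
    using tile_index[OF end_tile[OF null_in_cells]] by (metis north.simps)
  show "\<exists>q<length ts. to_nat (south (ts ! q)) = to_nat (first_row k U w b)" for b
    using tile_index[OF end_tile[OF first_row_in_cells[OF wf]]] by (metis south.simps)
qed

lemma matches_iff_pattern:
  assumes "W = width U (length w)" "N = (U + 1) * W"
  shows "(\<exists>\<tau>. tile_numbers.matches (length ts) N W
      (\<lambda>q. to_nat (west (ts ! q))) (\<lambda>q. to_nat (east (ts ! q)))
      (\<lambda>q. to_nat (south (ts ! q))) (\<lambda>q. to_nat (north (ts ! q)))
      (\<lambda>b. to_nat (first_row k U w b)) (to_nat (null k, null k, Start)) (to_nat (null k, null k, End))
      (to_nat (null k)) \<tau>) \<longleftrightarrow> (\<exists>x g. pattern M U w x g)"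
proof -
  note matches_def = tile_numbers.matches_def[OF tile_numbers[OF assms]]
  have W: "0 < W" "W \<le> N" using assms by (auto simp: width_def)
  show ?thesis
  proof (intro iffI; elim exE)
    fix \<tau> assume m: "tile_numbers.matches (length ts) N W
      (\<lambda>q. to_nat (west (ts ! q))) (\<lambda>q. to_nat (east (ts ! q)))
      (\<lambda>q. to_nat (south (ts ! q))) (\<lambda>q. to_nat (north (ts ! q)))
      (\<lambda>b. to_nat (first_row k U w b)) (to_nat (null k, null k, Start)) (to_nat (null k, null k, End))
      (to_nat (null k)) \<tau>"
    define T where "T i = ts ! \<tau> i" for i
    have T: "\<And>i. i < N \<Longrightarrow> T i \<in> tiles M" "west (T 0) = (null k, null k, Start)"
      "east (T (N - 1)) = (null k, null k, End)"
      "\<And>i. Suc i < N \<Longrightarrow> west (T (Suc i)) = east (T i)"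
      "\<And>i. i < W \<Longrightarrow> south (T i) = first_row k U w i"
      "\<And>i. i < N \<Longrightarrow> if i + W < N then south (T (i + W)) = north (T i) else north (T i) = null k"
      using m ts unfolding matches_def T_def by (auto simp: inj_eq[OF inj_to_nat])
    \<comment> \<open>Past the last position the pattern is continued with \<open>null\<close> and
      \<open>End\<close>, in agreement with the boundary colours.\<close>
    define x where "x i = (if i < N then south (T i) else null k)" for i
    define g where "g i = (if i < N then fst (T i) else End)" for i
    have fst_west: "fst (west (T i)) = (if i = 0 then null k else x (i - 1))" if "i < N" for i
    proof (cases i)
      case 0
      then show ?thesis using T(2) by simp
    next
      case (Suc j)
      then have "fst (west (T i)) = south (T j)" using T(4)[of j] that by (simp add: fst_east)
      then show ?thesis using Suc that by (simp add: x_def)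
    qed
    have west: "west (T i) = (if i = 0 then null k else x (i - 1), x i, g i)" if "i < N" for i
      by (subst west_eq, subst fst_west[OF that]) (use that in \<open>simp add: x_def g_def\<close>)
    have east: "east (T i) = (x i, x (i + 1), g (i + 1))" if "i < N" for i
    proof (cases "i + 1 < N")
      case True
      then have "east (T i) = west (T (i + 1))" using T(4)[of i] by simp
      also have "\<dots> = (x i, x (i + 1), g (i + 1))" unfolding west[OF True] by simp
      finally show ?thesis .
    next
      case False
      then have i: "i = N - 1" using that by simp
      have "x i = fst (east (T i))" using that by (simp add: x_def fst_east)
      also have "\<dots> = null k" unfolding i T(3) by simp
      finally show ?thesis using T(3) False i by (simp add: x_def g_def)
    qed
    have north: "north (T i) = x (i + W)" if "i < N" for i
      using T(6)[OF that] by (auto simp: x_def split: if_splits)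
    have Ti: "T i = (g i, if i = 0 then null k else x (i - 1), x i, x (i + 1), g (i + 1), x (i + W))"
      if "i < N" for i
      by (rule tile_eqI[OF west east north]) (use that in simp_all)
    have ok: "x i \<in> cells M" "g i \<in> signals M"
      "i < N \<Longrightarrow> locally_ok M (g i) (if i = 0 then null k else x (i - 1)) (x i) (x (i + 1))
        (g (i + 1)) (x (i + W))" for i
    proof -
      have *: "x i \<in> cells M \<and> g i \<in> signals M \<and>
        locally_ok M (g i) (if i = 0 then null k else x (i - 1)) (x i) (x (i + 1))
        (g (i + 1)) (x (i + W))" if "i < N"
        using T(1)[OF that] unfolding Ti[OF that] tiles_def by blast
      show "x i \<in> cells M" "g i \<in> signals M"
        using * by (cases "i < N", simp, simp add: x_def g_def null_in_cells signals_def)+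
      show "locally_ok M (g i) (if i = 0 then null k else x (i - 1)) (x i) (x (i + 1))
        (g (i + 1)) (x (i + W))" if "i < N" using * that by blast
    qed
    have "x i = first_row k U w i" if "i < W" for i using T(5)[OF that] that W by (simp add: x_def)
    moreover have "x i = null k" if "N - 1 \<le> i" for i
    proof (cases "i < N")
      case True
      then have "i = N - 1" using that by simp
      then show ?thesis using east[of i] T(3) True by simp
    qed (simp add: x_def)
    moreover have "g 0 = Start" using west[of 0] T(2) W by simp
    moreover have "g N = End" by (simp add: g_def)
    ultimately have "pattern M U w x g"
      using ok unfolding pattern_def Let_def assms(1)[symmetric] assms(2)[symmetric] by blast
    then show "\<exists>x g. pattern M U w x g" by blast
  next
    fix x g assume "pattern M U w x g"
    then have p: "\<And>i. x i \<in> cells M" "\<And>i. i \<le> N \<Longrightarrow> g i \<in> signals M"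
      "\<And>i. i < W \<Longrightarrow> x i = first_row k U w i" "\<And>i. i \<ge> N - 1 \<Longrightarrow> x i = null k"
      "g 0 = Start" "g N = End"
      "\<And>i. i < N \<Longrightarrow> locally_ok M (g i) (if i = 0 then null k else x (i - 1)) (x i) (x (i + 1))
        (g (i + 1)) (x (i + W))"
      unfolding pattern_def Let_def assms(1)[symmetric] assms(2)[symmetric] by blast+
    let ?T = "\<lambda>i. (g i, if i = 0 then null k else x (i - 1), x i, x (i + 1), g (i + 1), x (i + W))"
    have "?T i \<in> tiles M" if "i < N" for i
      using p(7)[OF that] p(1,2) that by (auto simp: tiles_def null_in_cells)
    then have "\<forall>i. \<exists>q. i < N \<longrightarrow> q < length ts \<and> ts ! q = ?T i" using tile_index by blast
    from choice[OF this] obtain \<tau> where \<tau>: "\<And>i. i < N \<Longrightarrow> \<tau> i < length ts" "\<And>i. i < N \<Longrightarrow> ts ! \<tau> i = ?T i"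
      by blast
    have "tile_numbers.matches (length ts) N W
      (\<lambda>q. to_nat (west (ts ! q))) (\<lambda>q. to_nat (east (ts ! q)))
      (\<lambda>q. to_nat (south (ts ! q))) (\<lambda>q. to_nat (north (ts ! q)))
      (\<lambda>b. to_nat (first_row k U w b)) (to_nat (null k, null k, Start)) (to_nat (null k, null k, End))
      (to_nat (null k)) \<tau>"
      unfolding matches_def
    proof (intro conjI allI impI)
      show "\<tau> i < length ts" if "i < N" for i using \<tau> that by simp
      show "to_nat (west (ts ! \<tau> 0)) = to_nat (null k, null k, Start)"
        using \<tau>(2)[of 0] W p(3)[of 0] p(5) k_pos by (simp add: first_row_0)
      show "to_nat (east (ts ! \<tau> (N - 1))) = to_nat (null k, null k, End)"
        using \<tau>(2)[of "N - 1"] W p(4)[of "N - 1"] p(4)[of N] p(6) by simp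
      show "to_nat (west (ts ! \<tau> (Suc i))) = to_nat (east (ts ! \<tau> i))" if "Suc i < N" for i
        using \<tau>(2)[of i] \<tau>(2)[of "Suc i"] that by simp
      show "to_nat (south (ts ! \<tau> i)) = to_nat (first_row k U w i)" if "i < W" for i
        using \<tau>(2)[of i] W p(3)[OF that] that by simp
      show "if i + W < N then to_nat (south (ts ! \<tau> (i + W))) = to_nat (north (ts ! \<tau> i))
          else to_nat (north (ts ! \<tau> i)) = to_nat (null k)" if "i < N" for i
        using \<tau>(2)[of i] \<tau>(2)[of "i + W"] p(4)[of "i + W"] that by simp
    qed
    then show "\<exists>\<tau>. tile_numbers.matches (length ts) N W
      (\<lambda>q. to_nat (west (ts ! q))) (\<lambda>q. to_nat (east (ts ! q)))
      (\<lambda>q. to_nat (south (ts ! q))) (\<lambda>q. to_nat (north (ts ! q)))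
      (\<lambda>b. to_nat (first_row k U w b)) (to_nat (null k, null k, Start)) (to_nat (null k, null k, End))
      (to_nat (null k)) \<tau>" by blast
  qed
qed

end

section \<open>Writing numbers block by block\<close>

text \<open>Leading zeros are kept and the terminator is omitted, so that the codes of successive
  digits in base \<open>2 ^ s\<close> can be concatenated.\<close>

fun blk :: "nat \<Rightarrow> nat \<Rightarrow> bool list" where
  "blk 0 d = []"
| "blk (Suc s) d = True # odd d # blk s (d div 2)"

lemma enc_nat_0: "enc_nat 0 = [False]"
  by (simp add: enc_nat.simps)

lemma enc_nat_blk: "d < 2 ^ s \<Longrightarrow> 0 < n \<Longrightarrow> enc_nat (d + 2 ^ s * n) = blk s d @ enc_nat n"
proof (induction s arbitrary: d)
  case (Suc s)
  have "enc_nat (d + 2 ^ Suc s * n) =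
      True # odd (d + 2 ^ Suc s * n) # enc_nat ((d + 2 ^ Suc s * n) div 2)"
    using Suc.prems by (subst enc_nat.simps) simp
  moreover have "(d + 2 ^ Suc s * n) div 2 = d div 2 + 2 ^ s * n"
    by (simp add: mult.assoc)
  moreover have "d div 2 < 2 ^ s" using Suc.prems by (simp add: less_mult_imp_div_less mult.commute)
  ultimately show ?case using Suc.IH Suc.prems by simp
qed simp

text \<open>The first assumption says that the highest of the \<open>s\<close> bits is set;
  otherwise \<open>enc_nat\<close> would be shorter than the block.\<close>

lemma enc_nat_top: "2 ^ s \<le> 2 * d \<Longrightarrow> d < 2 ^ s \<Longrightarrow> enc_nat d = blk s d @ [False]"
proof (induction s arbitrary: d)
  case (Suc s)
  have d: "0 < d" using Suc.prems by (cases d) auto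
  then have e: "enc_nat d = True # odd d # enc_nat (d div 2)" by (subst enc_nat.simps) simp
  show ?case
  proof (cases s)
    case 0
    then have "d = 1" using Suc.prems by simp
    then show ?thesis using e 0 by (simp add: enc_nat_0)
  next
    case (Suc r)
    have "enc_nat (d div 2) = blk s (d div 2) @ [False]"
      using Suc.prems Suc by (intro Suc.IH) auto
    then show ?thesis using e by simp
  qed
qed simp

lemma enc_nat_digits:
  assumes "0 < n" "\<And>b. b < n \<Longrightarrow> D b < 2 ^ s" "2 ^ s \<le> 2 * D (n - 1)"
  shows "enc_nat (\<Sum>b<n. (2 ^ s) ^ b * D b) = concat (map (\<lambda>b. blk s (D b)) [0..<n]) @ [False]"
  using assms
proof (induction n arbitrary: D)
  case (Suc n)
  show ?case
  proof (cases "n = 0")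
    case True
    then show ?thesis using Suc.prems enc_nat_top[of s "D 0"] by simp
  next
    case False
    let ?r = "\<Sum>b<n. (2 ^ s) ^ b * D (Suc b)"
    have "0 < D n" using Suc.prems(3) by (cases "D n") auto
    then have "0 < ?r"
      using False by (intro sum_pos2[of _ "n - 1"]) auto
    moreover have "(\<Sum>b<Suc n. (2 ^ s) ^ b * D b) = D 0 + 2 ^ s * ?r"
      by (subst sum.lessThan_Suc_shift) (simp add: sum_distrib_left mult.assoc)
    moreover have "enc_nat ?r = concat (map (\<lambda>b. blk s (D (Suc b))) [0..<n]) @ [False]"
      using Suc.prems False by (intro Suc.IH) auto
    moreover have "[0..<Suc n] = 0 # map Suc [0..<n]" by (simp add: map_Suc_upt upt_conv_Cons)
    ultimately show ?thesis using enc_nat_blk[of "D 0" s ?r] Suc.prems(2)[of 0]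
      by (simp add: comp_def del: upt_Suc)
  qed
qed simp

lemma enc_nat_shift: "0 < c \<Longrightarrow> enc_nat ((2 ^ s) ^ i * c) = concat (replicate i (blk s 0)) @ enc_nat c"
proof (induction i)
  case (Suc i)
  then show ?case using enc_nat_blk[of 0 s "(2 ^ s) ^ i * c"] by (simp add: mult.assoc)
qed simp

text \<open>The first bit is the sign; the last four bits are the code of the denominator 1.\<close>

definition rat_code :: "bool list \<Rightarrow> bool list" where
  "rat_code bs = False # bs @ [False, True, True, False]"

lemma enc_rat_of_nat: "enc_rat (of_nat n) = rat_code (enc_nat n)"
proof -
  have "quotient_of (of_nat n) = (int n, 1)" using quotient_of_int[of "int n"] by simp
  moreover have "enc_nat (nat 1) = [True, True, False]" by (simp add: enc_nat.simps)
  ultimately show ?thesis by (simp add: enc_rat_def enc_int_def rat_code_def)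
qed

definition delivery_code :: "bool list \<Rightarrow> bool list \<Rightarrow> bool list" where
  "delivery_code p c = True # rat_code p @ rat_code p @ rat_code c"

lemma enc_pair_deliveries:
  "enc_deliveries (pair_deliveries ps) =
    concat (map (\<lambda>(p, a, b). delivery_code (enc_nat p) (enc_nat a) @
      delivery_code (enc_nat p) (enc_nat b)) ps) @ [False]"
  by (induction ps)
    (auto simp: pair_deliveries_def enc_delivery_def point_delivery_def enc_rat_of_nat delivery_code_def)

lemma encode_pair_instance:
  "encode (pair_instance B ps) 2 = enc_nat 2 @ rat_code (enc_nat B) @
    concat (map (\<lambda>(p, a, b). delivery_code (enc_nat p) (enc_nat a) @
      delivery_code (enc_nat p) (enc_nat b)) ps) @ [False]"
  by (simp add: encode_def pair_instance_def enc_rat_of_nat enc_pair_deliveries)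

section \<open>Programs that write to a single tape\<close>

primrec puts :: "com \<Rightarrow> nat set" where
  "puts Skip = {}"
| "puts (Put x b) = {x}"
| "puts (Seq c d) = puts c \<union> puts d"
| "puts (For x c d) = puts c \<union> puts d"

lemma used_eq: "used c = puts c \<union> loops c"
  by (induction c) auto

text \<open>If all writing goes to one tape that controls no loop, what is written depends only on
  unchanged tapes, and execution dissolves into concatenation.\<close>

primrec outp :: "com \<Rightarrow> store \<Rightarrow> bool list" where
  "outp Skip s = []"
| "outp (Put x b) s = [b]"
| "outp (Seq c d) s = outp c s @ outp d s"
| "outp (For x c d) s = concat (map (\<lambda>b. if b then outp d s else outp c s) (s x))"

lemma outp_upd: "z \<notin> loops c \<Longrightarrow> outp c (s(z := ys)) = outp c s"
  by (induction c) (auto cong: if_cong)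

lemma exec_outp:
  "puts c \<subseteq> {z} \<Longrightarrow> z \<notin> loops c \<Longrightarrow> exec c s = s(z := s z @ outp c s)"
proof (induction c arbitrary: s)
  case (Seq c d)
  have 1: "exec c s = s(z := s z @ outp c s)" by (rule Seq.IH(1)) (use Seq.prems in simp_all)
  have 2: "exec d (s(z := s z @ outp c s)) = s(z := s z @ outp c s, z :=
      (s(z := s z @ outp c s)) z @ outp d (s(z := s z @ outp c s)))"
    by (rule Seq.IH(2)) (use Seq.prems in simp_all)
  have "outp d (s(z := s z @ outp c s)) = outp d s" using Seq.prems by (simp add: outp_upd)
  then show ?case unfolding exec.simps 1 2 by simp
next
  case (For x c d)
  have "fold (\<lambda>b. if b then exec d else exec c) bs s =
      s(z := s z @ concat (map (\<lambda>b. if b then outp d s else outp c s) bs))" for bs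
  proof (induction bs arbitrary: s)
    case (Cons b bs)
    have "(if b then exec d else exec c) s = s(z := s z @ (if b then outp d s else outp c s))"
      using For by auto
    then show ?case using Cons For.prems by (simp add: outp_upd cong: if_cong)
  qed simp
  then show ?case by simp
qed auto

definition seqs :: "com list \<Rightarrow> com" where
  "seqs cs = foldr Seq cs Skip"

definition emit :: "nat \<Rightarrow> bool list \<Rightarrow> com" where
  "emit x bs = seqs (map (Put x) bs)"

definition rep :: "nat \<Rightarrow> com \<Rightarrow> com" where
  "rep x c = For x c c"

lemma seqs_simps [simp]:
  "outp (seqs cs) s = concat (map (\<lambda>c. outp c s) cs)"
  "puts (seqs cs) = \<Union> (puts ` set cs)"
  "loops (seqs cs) = \<Union> (loops ` set cs)"
  "wf_com (seqs cs) \<longleftrightarrow> (\<forall>c \<in> set cs. wf_com c)"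
  by (induction cs) (auto simp: seqs_def)

lemma exec_seqs: "exec (seqs []) s = s" "exec (seqs (c # cs)) s = exec (seqs cs) (exec c s)"
  by (simp_all add: seqs_def)

lemma emit_simps [simp]:
  "outp (emit x bs) s = bs"
  "loops (emit x bs) = {}"
  "wf_com (emit x bs)"
proof -
  show "outp (emit x bs) s = bs" by (induction bs) (auto simp: emit_def)
qed (auto simp: emit_def)

lemma puts_emit [simp]:
  "x \<in> A \<Longrightarrow> puts (emit x bs) \<subseteq> A"
  "y \<noteq> x \<Longrightarrow> y \<notin> puts (emit x bs)"
  by (auto simp: emit_def)

lemma rep_simps [simp]:
  "outp (rep x c) s = concat (replicate (length (s x)) (outp c s))"
  "puts (rep x c) = puts c"
  "loops (rep x c) = insert x (loops c)"
  "wf_com (rep x c) \<longleftrightarrow> x \<notin> puts c \<union> loops c \<and> wf_com c"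
  by (auto simp: rep_def map_replicate_const used_eq)

lemma concat_replicate_replicate: "concat (replicate m (replicate n x)) = replicate (m * n) x"
  by (induction m) (auto simp: replicate_add)

lemma concat_replicate_single: "concat (replicate n [x]) = replicate n x"
  by (induction n) auto

lemma replicate_append_single: "replicate m x @ [x] = replicate (Suc m) x"
  by (induction m) auto

lemma concat_replicate_Cons: "concat (replicate m (x # replicate n x)) = replicate (m * Suc n) x"
  using concat_replicate_replicate[of m "Suc n"] by simp

lemma concat_replicate_pair: "concat (replicate m [x, x]) = replicate (2 * m) x"
  by (induction m) auto

lemma replicate_2: "[x, x] = replicate 2 x"
  by (simp add: numeral_2_eq_2)

lemma concat_replicate_Cons_Cons: "concat (replicate m (replicate n x @ [x, x])) = replicate (m * (n + 2)) x"
proof -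
  have "replicate n x @ [x, x] = replicate (n + 2) x" by (simp only: replicate_2 replicate_add)
  then show ?thesis by (simp only: concat_replicate_replicate)
qed

lemma upt_split: "i \<le> j \<Longrightarrow> j \<le> n \<Longrightarrow> [i..<n] = [i..<j] @ [j..<n]"
  using upt_add_eq_append[of i j "n - j"] by simp

lemma concat_replicate_commute: "concat (replicate n xs) @ xs = xs @ concat (replicate n xs)"
  by (induction n) auto

section \<open>The program that writes the packing instance\<close>

locale tm_reduction = tm_tiles M ts X Y for M ts X Y +
  fixes s c d :: nat
  assumes X_eq: "X = 2 ^ s"
begin

abbreviation "Q \<equiv> length ts"
abbreviation "we \<equiv> \<lambda>q. to_nat (west (ts ! q))"
abbreviation "ea \<equiv> \<lambda>q. to_nat (east (ts ! q))"
abbreviation "so \<equiv> \<lambda>q. to_nat (south (ts ! q))"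
abbreviation "no \<equiv> \<lambda>q. to_nat (north (ts ! q))"
abbreviation "C0 \<equiv> to_nat (null k, null k, Start)"
abbreviation "C1 \<equiv> to_nat (null k, null k, End)"
abbreviation "NL \<equiv> to_nat (null k)"
abbreviation "hor (a :: nat) \<equiv> Y ^ (2 * a)"
abbreviation "ver (a :: nat) \<equiv> Y ^ Suc (2 * a)"
abbreviation "wests \<equiv> \<Sum>q<Q. hor (we q)"
abbreviation "easts \<equiv> \<Sum>q<Q. hor (ea q)"
abbreviation "souths \<equiv> \<Sum>q<Q. ver (so q)"
abbreviation "norths \<equiv> \<Sum>q<Q. ver (no q)"

text \<open>The time bound is brought into this form because powers of \<open>n + 1\<close> are
  produced in unary by one loop after another.\<close>

definition size_of :: "nat \<Rightarrow> nat" where "size_of n = c * (n + 1) ^ d"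

definition out :: nat where "out = 7 + d"

definition centre :: cell where "centre = (0 # replicate (k - 1) 0, 1)"
definition input_cell :: "bool \<Rightarrow> cell" where
  "input_cell b = ((if b then 2 else 1) # replicate (k - 1) 0, 0)"
definition end_cell :: cell where "end_cell = (0 # replicate (k - 1) 0, 2)"

lemma first_row_list:
  "map (first_row k U w) [1..<width U (length w)] = replicate U (null k) @ [centre] @
    map input_cell w @ replicate U (null k) @ [end_cell]"
proof (rule nth_equalityI)
  show "length (map (first_row k U w) [1..<width U (length w)]) = length (replicate U (null k) @ [centre] @
    map input_cell w @ replicate U (null k) @ [end_cell])"
    by (simp add: width_def)
  fix i assume "i < length (map (first_row k U w) [1..<width U (length w)])"
  then have i: "i < 2 * U + length w + 2" by (simp add: width_def)
  then have l: "map (first_row k U w) [1..<width U (length w)] ! i = first_row k U w (Suc i)"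
    by (simp add: width_def)
  have null: "null k = (0 # replicate (k - 1) 0, 0)"
    using k_pos by (cases k) (simp_all add: null_def)
  consider "i < U" | "i = U" | j where "i = U + 1 + j" "j < length w"
    | j where "i = U + 1 + length w + j" "j < U" | "i = 2 * U + length w + 1"
  proof -
    assume a: "i < U \<Longrightarrow> thesis" "i = U \<Longrightarrow> thesis"
      "\<And>j. i = U + 1 + j \<Longrightarrow> j < length w \<Longrightarrow> thesis"
      "\<And>j. i = U + 1 + length w + j \<Longrightarrow> j < U \<Longrightarrow> thesis" "i = 2 * U + length w + 1 \<Longrightarrow> thesis"
    show thesis
      using a(1,2,5) a(3)[of "i - (U + 1)"] a(4)[of "i - (U + 1 + length w)"] i by linarith
  qed
  then show "map (first_row k U w) [1..<width U (length w)] ! i = (replicate U (null k) @ [centre] @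
    map input_cell w @ replicate U (null k) @ [end_cell]) ! i"
    unfolding l
    by cases (simp_all add: null nth_append first_row_def flag_def contents_def centre_def
      input_cell_def end_cell_def)
qed

text \<open>Tape 0 holds the input, tapes 1 to 4 hold in unary \<open>U\<close>, \<open>W - 2\<close>, \<open>U * W\<close> and \<open>N\<close>, tape 5
  counts positions, and tapes 6 to \<open>6 + d\<close> hold the powers of \<open>n + 1\<close>.\<close>

definition pow_com :: "nat \<Rightarrow> com" where
  "pow_com j = seqs (Put 6 False # map (\<lambda>j. rep (6 + j)
     (seqs [rep 0 (Put (7 + j) False), Put (7 + j) False])) [0..<j])"

definition pow_store :: "bool list \<Rightarrow> nat \<Rightarrow> store" where
  "pow_store w j = (\<lambda>x. if x = 0 then w else
     if 6 \<le> x \<and> x \<le> 6 + j then replicate ((length w + 1) ^ (x - 6)) False else [])"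

lemma exec_seqs_append: "exec (seqs (cs @ ds)) r = exec (seqs ds) (exec (seqs cs) r)"
  by (induction cs arbitrary: r) (simp_all add: exec_seqs)

lemma exec_pow_com: "exec (pow_com j) (input w) = pow_store w j"
proof (induction j)
  case 0
  then show ?case by (auto simp: pow_com_def exec_seqs input_def pow_store_def fun_eq_iff)
next
  case (Suc j)
  let ?c = "rep (6 + j) (seqs [rep 0 (Put (7 + j) False), Put (7 + j) False])"
  have "exec (pow_com (Suc j)) (input w) = exec ?c (exec (pow_com j) (input w))"
    using exec_seqs_append[of "Put 6 False # map (\<lambda>j. rep (6 + j)
      (seqs [rep 0 (Put (7 + j) False), Put (7 + j) False])) [0..<j]" "[?c]"]
    by (simp add: pow_com_def exec_seqs)
  also have "\<dots> = exec ?c (pow_store w j)" by (simp only: Suc)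
  also have "\<dots> = (pow_store w j)(7 + j := pow_store w j (7 + j) @ outp ?c (pow_store w j))"
    by (rule exec_outp) auto
  also have "outp ?c (pow_store w j) = replicate ((length w + 1) ^ Suc j) False"
    by (simp add: concat_replicate_single replicate_append_same concat_replicate_Cons pow_store_def
        algebra_simps)
  finally show ?case by (auto simp: pow_store_def fun_eq_iff)
qed

definition setup_com :: com where
  "setup_com = Seq (pow_com d) (Seq (rep (6 + d) (emit 1 (replicate c False)))
     (Seq (seqs [rep 1 (emit 2 [False, False]), rep 0 (emit 2 [False]), emit 2 [False]])
     (Seq (rep 1 (seqs [rep 2 (emit 3 [False]), emit 3 [False, False]]))
     (seqs [rep 3 (emit 4 [False]), rep 2 (emit 4 [False]), emit 4 [False, False]]))))"

definition setup_store :: "bool list \<Rightarrow> store" where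
  "setup_store w = (let n = length w; U = size_of n; W = width U n in (pow_store w d)
     (1 := replicate U False, 2 := replicate (W - 2) False, 3 := replicate (U * W) False,
      4 := replicate ((U + 1) * W) False))"

lemma exec_setup_com: "exec setup_com (input w) = setup_store w"
proof -
  let ?n = "length w"
  let ?U = "size_of ?n"
  let ?W = "width ?U ?n"
  let ?F = "\<lambda>m. replicate m False"
  let ?s0 = "pow_store w d"
  have 1: "exec (rep (6 + d) (emit 1 (?F c))) ?s0 = ?s0(1 := ?F ?U)" (is "exec ?c1 _ = ?s1")
  proof -
    have "exec ?c1 ?s0 = ?s0(1 := ?s0 1 @ outp ?c1 ?s0)" by (rule exec_outp) auto
    then show ?thesis
      by (simp add: pow_store_def concat_replicate_replicate size_of_def mult.commute)
  qed
  have 2: "exec (seqs [rep 1 (emit 2 [False, False]), rep 0 (emit 2 [False]), emit 2 [False]]) ?s1 =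
      ?s1(2 := ?F (?W - 2))" (is "exec ?c2 _ = ?s2")
  proof -
    have "exec ?c2 ?s1 = ?s1(2 := ?s1 2 @ outp ?c2 ?s1)" by (rule exec_outp) auto
    moreover have "outp ?c2 ?s1 = ?F (2 * ?U) @ ?F ?n @ ?F 1"
      by (simp add: pow_store_def concat_replicate_single concat_replicate_pair)
    moreover have "2 * ?U + (?n + 1) = ?W - 2" by (simp add: width_def)
    ultimately show ?thesis by (simp only: replicate_add[symmetric]) (simp add: pow_store_def)
  qed
  have 3: "exec (rep 1 (seqs [rep 2 (emit 3 [False]), emit 3 [False, False]])) ?s2 =
      ?s2(3 := ?F (?U * ?W))" (is "exec ?c3 _ = ?s3")
  proof -
    have "exec ?c3 ?s2 = ?s2(3 := ?s2 3 @ outp ?c3 ?s2)" by (rule exec_outp) auto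
    moreover have "outp ?c3 ?s2 = ?F (?U * (?W - 2 + 2))"
      by (simp only: concat_replicate_Cons_Cons[symmetric]) (simp add: concat_replicate_single)
    moreover have "?W - 2 + 2 = ?W" by (simp add: width_def)
    ultimately show ?thesis by (simp only:) (simp add: pow_store_def)
  qed
  have 4: "exec (seqs [rep 3 (emit 4 [False]), rep 2 (emit 4 [False]), emit 4 [False, False]]) ?s3 =
      ?s3(4 := ?F ((?U + 1) * ?W))" (is "exec ?c4 _ = ?s4")
  proof -
    have "exec ?c4 ?s3 = ?s3(4 := ?s3 4 @ outp ?c4 ?s3)" by (rule exec_outp) auto
    moreover have "outp ?c4 ?s3 = ?F (?U * ?W) @ ?F (?W - 2) @ ?F 2"
      by (simp add: concat_replicate_single numeral_2_eq_2)
    moreover have "?U * ?W + (?W - 2 + 2) = (?U + 1) * ?W" by (simp add: width_def)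
    ultimately show ?thesis by (simp only: replicate_add[symmetric]) (simp add: pow_store_def)
  qed
  show ?thesis
    unfolding setup_com_def exec.simps(3) exec_pow_com 1 2 3 4 setup_store_def Let_def ..
qed

text \<open>The blocks in order: position 0, the \<open>U\<close> blank cells, head column, input,
  \<open>U\<close> blank cells and closing cell of the first row, then the \<open>U * W\<close>
  positions of the other rows, block \<open>N\<close>, and the \<open>W - 1\<close> blocks above
  it.\<close>

definition bal_com :: "bool list \<Rightarrow> (cell \<Rightarrow> bool list) \<Rightarrow> bool list \<Rightarrow> bool list \<Rightarrow> bool list \<Rightarrow> com" where
  "bal_com b0 e bm bN bt = seqs [emit out b0, rep 1 (emit out (e (null k))), emit out (e centre),
     For 0 (emit out (e (input_cell False))) (emit out (e (input_cell True))),
     rep 1 (emit out (e (null k))), emit out (e end_cell), rep 3 (emit out bm), emit out bN,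
     rep 2 (emit out bt), emit out bt, emit out [False]]"

lemma outp_bal_com:
  fixes f :: "nat \<Rightarrow> bool list" and w :: "bool list"
  assumes U: "U = size_of (length w)" and W': "W = width U (length w)" and N: "N = (U + 1) * W"
    and "\<And>x. x \<le> 3 \<Longrightarrow> r x = setup_store w x"
    and "f 0 = b0" "\<And>b. 0 < b \<Longrightarrow> b < W \<Longrightarrow> f b = e (first_row k U w b)"
    and "\<And>b. W \<le> b \<Longrightarrow> b < N \<Longrightarrow> f b = bm" "f N = bN" "\<And>b. N < b \<Longrightarrow> f b = bt"
  shows "outp (bal_com b0 e bm bN bt) r = concat (map f [0..<N + W]) @ [False]"
proof -
  have r: "r 0 = w" "length (r 1) = U" "length (r 2) = W - 2" "length (r 3) = U * W"
    using assms(4)[of 0] assms(4)[of 1] assms(4)[of 2] assms(4)[of 3]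
    by (simp_all add: setup_store_def Let_def pow_store_def U W')
  have W: "3 \<le> W" "W \<le> N" by (simp_all add: W' N width_def)
  have "[0..<1] = [0 :: nat]" "[N..<N + 1] = [N]" by simp_all
  then have "[0..<N + W] = [0] @ [1..<W] @ [W..<N] @ [N] @ [N + 1..<N + W]"
    using W upt_split[of 0 1 W] upt_split[of 0 W N] upt_split[of 0 N "N + 1"]
      upt_split[of 0 "N + 1" "N + W"] by (simp only: append.assoc[symmetric])
  moreover have "map f [1..<W] = map e (map (first_row k U w) [1..<W])"
    using assms(6) by simp
  then have "map f [1..<W] = map e (replicate U (null k) @ [centre] @
    map input_cell w @ replicate U (null k) @ [end_cell])"
    unfolding W' first_row_list .
  moreover have "map f [W..<N] = replicate (U * W) bm"
    using assms(7) by (intro replicate_eqI) (auto simp: N)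
  moreover have "map f [N + 1..<N + W] = replicate (W - 2) bt @ [bt]"
    unfolding replicate_append_single using assms(9) W by (intro replicate_eqI) auto
  moreover have "(\<lambda>b. if b then e (input_cell True) else e (input_cell False)) = (\<lambda>b. e (input_cell b))"
    by auto
  ultimately show ?thesis
    by (simp add: bal_com_def r[unfolded One_nat_def] assms(5,8) comp_def del: upt_Suc replicate_append_single cong: if_cong)
qed

definition rat_com :: "com \<Rightarrow> com" where
  "rat_com e = seqs [emit out [False], e, emit out [False, True, True, False]]"

definition delivery_com :: "com \<Rightarrow> com \<Rightarrow> com" where
  "delivery_com p e = seqs [emit out [True], rat_com p, rat_com p, rat_com e]"

lemma outp_rat_com: "outp (rat_com e) r = rat_code (outp e r)"
  by (simp add: rat_com_def rat_code_def)

lemma outp_delivery_com: "outp (delivery_com p e) r = delivery_code (outp p r) (outp e r)"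
  by (simp add: delivery_com_def delivery_code_def outp_rat_com)

abbreviation "dig n \<equiv> blk s (X - 1 - n)"

definition cap_com :: com where
  "cap_com = seqs [rep 4 (emit out (dig 0)), rep 2 (emit out (dig 0)), emit out (dig 0), emit out (dig 0),
     emit out [False]]"

definition bal1_com :: com where
  "bal1_com = bal_com (dig (hor C0 + ver (to_nat (null k)))) (\<lambda>x. dig (easts + ver (to_nat x)))
     (dig (easts + norths)) (dig (easts - hor C1 + (norths - ver NL))) (dig (norths - ver NL))"

definition bal2_com :: com where
  "bal2_com = bal_com (dig (wests - hor C0 + (souths - ver (to_nat (null k)))))
     (\<lambda>x. dig (wests + (souths - ver (to_nat x))))
     (dig (wests + souths)) (dig (hor C1 + ver NL)) (dig (ver NL))"

definition header_com :: com where
  "header_com = seqs [emit out (enc_nat 2), rat_com cap_com,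
     delivery_com (emit out [False]) bal1_com, delivery_com (emit out [False]) bal2_com]"

definition point_com :: "nat \<Rightarrow> com" where
  "point_com q = seqs [rep 5 (emit out (blk Q 0)), emit out (enc_nat (2 ^ q))]"

definition pos_com :: "nat \<Rightarrow> com" where
  "pos_com q = seqs [rep 5 (emit out (blk s 0)), emit out (enc_nat (hor (we q) + ver (so q)))]"

text \<open>With \<open>i\<close> zero blocks from tape 5 and one more, the east colour lands in
  block \<open>i + 1\<close>. The \<open>W - 2\<close> zero blocks after it put the north colour
  into block \<open>i + W\<close>; it is the leading digit and written without padding. This is why
  tape 2 holds \<open>W - 2\<close>.\<close>

definition neg_com :: "nat \<Rightarrow> com" where
  "neg_com q = seqs [rep 5 (emit out (blk s 0)), emit out (blk s 0), emit out (blk s (hor (ea q))),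
     rep 2 (emit out (blk s 0)), emit out (enc_nat (ver (no q)))]"

definition items_com :: com where
  "items_com = seqs (map (\<lambda>q. Seq (delivery_com (point_com q) (pos_com q))
     (delivery_com (point_com q) (neg_com q))) [0..<Q])"

text \<open>Tape 5 grows only between the runs of \<open>items_com\<close>, which loops over it; in
  the run for position \<open>i\<close> its length is \<open>i\<close>.\<close>

definition main_com :: com where
  "main_com = seqs [setup_com, header_com, rep 4 (Seq items_com (Put 5 False)), emit out [False]]"

lemma puts_bal_com: "puts (bal_com b0 e bm bN bt) \<subseteq> {out}"
  and loops_bal_com: "loops (bal_com b0 e bm bN bt) = {0, 1, 2, 3}"
  and wf_bal_com: "wf_com (bal_com b0 e bm bN bt)"
  by (auto simp: bal_com_def used_eq out_def)

lemma puts_delivery_com: "puts p \<subseteq> A \<Longrightarrow> puts e \<subseteq> A \<Longrightarrow> out \<in> A \<Longrightarrow> puts (delivery_com p e) \<subseteq> A"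
  and loops_delivery_com: "loops (delivery_com p e) = loops p \<union> loops e"
  and wf_delivery_com: "wf_com (delivery_com p e) \<longleftrightarrow> wf_com p \<and> wf_com e"
  by (auto simp: delivery_com_def rat_com_def)

lemma puts_header: "puts header_com \<subseteq> {out}" and loops_header: "loops header_com = {0, 1, 2, 3, 4}"
  and wf_header: "wf_com header_com"
  using puts_bal_com
  by (simp_all add: header_com_def rat_com_def cap_com_def puts_delivery_com loops_delivery_com
      wf_delivery_com bal1_com_def bal2_com_def loops_bal_com wf_bal_com out_def[symmetric] insert_commute)
    (auto simp: out_def)

lemma puts_items: "puts items_com \<subseteq> {out}"
  by (simp add: items_com_def UN_subset_iff puts_delivery_com point_com_def pos_com_def neg_com_def)

lemma loops_items: "loops items_com \<subseteq> {2, 5}" and wf_items: "wf_com items_com"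
  by (auto simp: items_com_def point_com_def pos_com_def neg_com_def loops_delivery_com wf_delivery_com out_def)

lemma puts_setup: "puts setup_com \<subseteq> {..<7 + d}" and loops_setup: "loops setup_com \<subseteq> {..<7 + d}"
  and wf_setup: "wf_com setup_com"
  by (auto simp: setup_com_def pow_com_def used_eq)

lemma wf_main: "wf_com main_com"
  using puts_items loops_items
  by (auto simp: main_com_def wf_setup wf_header wf_items out_def)

lemma loops_main: "loops main_com \<subseteq> {..<7 + d}"
  using loops_setup loops_items by (auto simp: main_com_def loops_header)

lemma used_main: "used main_com \<subseteq> {..<8 + d}"
  using loops_main puts_setup puts_header puts_items by (auto simp: main_com_def used_eq out_def)

context
  fixes w :: "bool list" and U W N :: nat
  assumes U: "U = size_of (length w)" and W: "W = width U (length w)" and N: "N = (U + 1) * W"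
begin

interpretation T: tile_numbers Q N W we ea so no "\<lambda>b. to_nat (first_row k U w b)" C0 C1 NL X Y
  by (rule tile_numbers[OF W N])

lemma hv: "T.h = hor" "T.v = ver"
  by (simp_all add: T.h_def T.v_def fun_eq_iff)

lemma sums: "T.west_sum = wests" "T.east_sum = easts" "T.south_sum = souths" "T.north_sum = norths"
  by (simp_all add: T.west_sum_def T.east_sum_def T.south_sum_def T.north_sum_def hv)

lemma W_ge_3: "3 \<le> W" and W_le_N: "W \<le> N"
  using W N by (simp_all add: width_def)

text \<open>\<open>X\<close> is even, so \<open>2 * D b < X\<close> makes the complementary digit at
  least half of \<open>X\<close>. Thus the leading block is full, as \<open>enc_nat_digits\<close>
  demands.\<close>

lemma enc_digits:
  assumes "\<And>b. 2 * D b < X"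
  shows "enc_nat (\<Sum>b<N + W. X ^ b * (X - 1 - D b)) = concat (map (\<lambda>b. dig (D b)) [0..<N + W]) @ [False]"
proof -
  have "X - 1 - D b < X" "X \<le> 2 * (X - 1 - D b)" for b
  proof -
    have "even X" using T.X_ge_8 X_eq by (cases s) auto
    then show "X - 1 - D b < X" "X \<le> 2 * (X - 1 - D b)" using assms[of b] T.X_ge_8 by presburger+
  qed
  then show ?thesis
    unfolding X_eq using W_ge_3 by (intro enc_nat_digits) (auto simp: X_eq[symmetric])
qed

lemma outp_bal1:
  assumes "\<And>x. x \<le> 3 \<Longrightarrow> r x = setup_store w x"
  shows "outp bal1_com r = enc_nat T.bal1"
proof -
  have "outp bal1_com r = concat (map (\<lambda>b. dig (T.\<alpha> b)) [0..<N + W]) @ [False]"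
    unfolding bal1_com_def
    by (rule outp_bal_com[OF U W N assms], assumption)
      (use W_ge_3 W_le_N in \<open>auto simp: T.\<alpha>_def hv sums first_row_0 k_pos\<close>)
  then show ?thesis using enc_digits[OF T.\<alpha>_le] by (simp add: T.bal1_def)
qed

lemma outp_bal2:
  assumes "\<And>x. x \<le> 3 \<Longrightarrow> r x = setup_store w x"
  shows "outp bal2_com r = enc_nat T.bal2"
proof -
  have "outp bal2_com r = concat (map (\<lambda>b. dig (T.\<beta> b)) [0..<N + W]) @ [False]"
    unfolding bal2_com_def
    by (rule outp_bal_com[OF U W N assms], assumption)
      (use W_ge_3 W_le_N in \<open>auto simp: T.\<beta>_def hv sums first_row_0 k_pos\<close>)
  then show ?thesis using enc_digits[OF T.\<beta>_le] by (simp add: T.bal2_def)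
qed

lemma setup_lengths: "length (setup_store w 2) = W - 2" "length (setup_store w 4) = N"
    "setup_store w 5 = []" "setup_store w out = []"
  by (simp_all add: setup_store_def Let_def pow_store_def out_def U W N)

lemma outp_cap: "outp cap_com (setup_store w) = enc_nat T.cap"
proof -
  have "outp cap_com (setup_store w) = concat (replicate (N + W) (dig 0)) @ [False]"
  proof -
    have "N + W = N + (W - 2) + 1 + 1" using W_ge_3 by simp
    then show ?thesis
      by (simp only: replicate_add concat_append) (simp add: cap_com_def setup_lengths)
  qed
  also have "replicate (N + W) (dig 0) = map (\<lambda>b. dig ((\<lambda>_. 0) b)) [0..<N + W]"
    by (simp add: map_replicate_const)
  finally show ?thesis
    using enc_digits[of "\<lambda>_. 0"] T.X_ge_8 T.sum_X[of "N + W"] by (simp add: T.cap_def)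
qed

lemma outp_header: "outp header_com (setup_store w) = enc_nat 2 @ rat_code (enc_nat T.cap) @
    delivery_code (enc_nat 0) (enc_nat T.bal1) @ delivery_code (enc_nat 0) (enc_nat T.bal2)"
  by (simp add: header_com_def outp_rat_com outp_delivery_com outp_cap outp_bal1 outp_bal2 enc_nat_0)

lemma outp_items:
  assumes "length (r 5) = i" "length (r 2) = W - 2"
  shows "outp items_com r = concat (map (\<lambda>q.
    delivery_code (enc_nat (2 ^ (i * Q + q))) (enc_nat (T.pos i q)) @
    delivery_code (enc_nat (2 ^ (i * Q + q))) (enc_nat (T.neg i q))) [0..<Q])"
proof -
  have "outp (point_com q) r = enc_nat (2 ^ (i * Q + q))" for q
    using enc_nat_shift[of "2 ^ q" Q i] assms(1)
    by (simp add: point_com_def power_add power_mult mult.commute[of i])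
  moreover have "outp (pos_com q) r = enc_nat (T.pos i q)" for q
  proof -
    have "T.pos i q = (2 ^ s) ^ i * (hor (we q) + ver (so q))"
      unfolding T.pos_def hv by (simp only: X_eq)
    then show ?thesis
      using enc_nat_shift[of "hor (we q) + ver (so q)" s i] assms(1) T.Y_pos
      by (simp add: pos_com_def)
  qed
  moreover have "outp (neg_com q) r = enc_nat (T.neg i q)" if q: "q < Q" for q
  proof -
    have "hor (ea q) < X"
      using T.le_sum[OF q, of "\<lambda>q. hor (ea q)"] T.sums_less_X unfolding sums by linarith
    then have lt: "hor (ea q) < 2 ^ s" by (simp add: X_eq)
    have pos: "0 < ver (no q)" using T.Y_pos by simp
    then have pos': "0 < X ^ (W - 2) * ver (no q)" by (simp add: X_eq)
    then have pos'': "0 < hor (ea q) + X * (X ^ (W - 2) * ver (no q))" by (simp add: X_eq)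
    have "i + W = Suc i + Suc (W - 2)" using W_ge_3 by simp
    then have e: "X ^ (i + W) = X ^ Suc i * (X * X ^ (W - 2))" by (simp only: power_add power_Suc)
    have neg_eq: "T.neg i q = X ^ Suc i * (hor (ea q) + X * (X ^ (W - 2) * ver (no q)))"
      unfolding T.neg_def hv e by (simp only: distrib_left mult.assoc)
    have "enc_nat (T.neg i q) = concat (replicate (Suc i) (blk s 0)) @ blk s (hor (ea q)) @
        concat (replicate (W - 2) (blk s 0)) @ enc_nat (ver (no q))"
      unfolding neg_eq
      using enc_nat_shift[OF pos'', of s "Suc i"] enc_nat_blk[OF lt pos'] enc_nat_shift[OF pos, of s "W - 2"]
      by (simp only: X_eq append_assoc)
    also have "\<dots> = outp (neg_com q) r"
      using assms concat_replicate_commute[of i "blk s 0"] by (simp add: neg_com_def)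
    finally show ?thesis ..
  qed
  ultimately show ?thesis
    by (auto simp: items_com_def outp_delivery_com comp_def intro!: arg_cong[of _ _ concat])
qed

lemma exec_items_loop:
  fixes ys :: "bool list"
  defines "I \<equiv> \<lambda>i. outp items_com ((setup_store w)(5 := replicate i False))"
  shows "exec (rep 4 (Seq items_com (Put 5 False))) ((setup_store w)(out := ys)) =
    (setup_store w)(5 := replicate N False, out := ys @ concat (map I [0..<N]))"
proof -
  let ?c = "Seq items_com (Put 5 False)"
  define st where "st i = (setup_store w)(5 := replicate i False, out := ys @ concat (map I [0..<i]))" for i
  have o5: "out \<noteq> 5" "out \<noteq> 4" by (auto simp: out_def)
  have step: "exec ?c (st i) = st (Suc i)" for i
  proof -
    have "outp items_com (st i) = I i"
      unfolding st_def I_def by (rule outp_upd) (use loops_items in \<open>auto simp: out_def\<close>)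
    moreover have "out \<notin> loops items_com" using loops_items by (auto simp: out_def)
    ultimately have "exec items_com (st i) = (st i)(out := st i out @ I i)"
      using exec_outp[OF puts_items, of "st i"] by simp
    then show ?thesis
      using o5 by (auto simp: st_def fun_eq_iff replicate_append_same)
  qed
  have "fold (\<lambda>b. if b then exec ?c else exec ?c) bs (st i) = st (i + length bs)" for bs i
    by (induction bs arbitrary: i) (simp_all add: step del: exec.simps)
  from this[of "setup_store w 4" 0] have "exec (rep 4 ?c) (st 0) = st N"
    using o5 by (simp add: rep_def st_def setup_lengths del: exec.simps(3))
  moreover have "st 0 = (setup_store w)(out := ys)"
    using o5 setup_lengths(3) by (auto simp: st_def fun_eq_iff)
  ultimately show ?thesis by (simp add: st_def)
qed

lemma exec_main: "exec main_com (input w) =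
  (setup_store w)(5 := replicate N False, out := encode (pair_instance T.cap T.instance_pairs) 2)"
proof -
  define I where "I i = outp items_com ((setup_store w)(5 := replicate i False))" for i
  have I: "I i = concat (map (\<lambda>q.
    delivery_code (enc_nat (2 ^ (i * Q + q))) (enc_nat (T.pos i q)) @
    delivery_code (enc_nat (2 ^ (i * Q + q))) (enc_nat (T.neg i q))) [0..<Q])" for i
    unfolding I_def by (rule outp_items) (simp_all add: setup_lengths)
  have "concat (map (\<lambda>(p, a, b). delivery_code (enc_nat p) (enc_nat a) @
      delivery_code (enc_nat p) (enc_nat b))
      (concat (map (\<lambda>i. map (\<lambda>q. (2 ^ (i * Q + q), T.pos i q, T.neg i q)) [0..<Q]) [0..<n]))) =
    concat (map I [0..<n])" for n
    by (induction n) (simp_all add: I comp_def)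
  then have enc: "encode (pair_instance T.cap T.instance_pairs) 2 =
      outp header_com (setup_store w) @ concat (map I [0..<N]) @ [False]"
    by (simp add: encode_pair_instance T.instance_pairs_def T.tile_pairs_def outp_header)
  have "exec main_com (input w) = exec (emit out [False])
      (exec (rep 4 (Seq items_com (Put 5 False))) (exec header_com (setup_store w)))"
    by (simp only: main_com_def exec_seqs exec_setup_com)
  also have "exec header_com (setup_store w) = (setup_store w)(out := outp header_com (setup_store w))"
  proof -
    have "out \<notin> loops header_com" by (simp add: loops_header out_def)
    then show ?thesis using exec_outp[OF puts_header, of "setup_store w"] by (simp add: setup_lengths)
  qed
  also have "exec (rep 4 (Seq items_com (Put 5 False))) \<dots> = (setup_store w)(5 := replicate N False,
      out := outp header_com (setup_store w) @ concat (map I [0..<N]))"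
    unfolding I_def by (rule exec_items_loop)
  finally show ?thesis
    unfolding enc by (auto simp: emit_def exec_seqs fun_eq_iff)
qed

text \<open>The tape \<open>out\<close> controls no loop, so the lengths to be bounded are those of
  the input, the unary counters and the powers of \<open>n + 1\<close>.\<close>

lemma exec_main_length:
  assumes "x \<in> loops main_com"
  shows "length (exec main_com (input w) x) \<le> length w + U + W + U * W + N + (length w + 1) ^ d"
proof -
  have "x < 7 + d" using loops_main assms by auto
  moreover have "(length w + 1) ^ (x - 6) \<le> (length w + 1) ^ d" if "x \<le> 6 + d"
    using that by (intro power_increasing) auto
  ultimately show ?thesis
    unfolding exec_main by (auto simp: setup_store_def Let_def pow_store_def U[symmetric] W[symmetric] N[symmetric] out_def)
qed

lemma main_correct: "exec main_com (input w) out \<in> DDP \<longleftrightarrow> (\<exists>x g. pattern M U w x g)"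
proof -
  have "exec main_com (input w) out = encode (pair_instance T.cap T.instance_pairs) 2"
    by (simp add: exec_main)
  then have "exec main_com (input w) out \<in> DDP \<longleftrightarrow>
      valid_instance (pair_instance T.cap T.instance_pairs) \<and>
      min_drones (pair_instance T.cap T.instance_pairs) \<le> 2"
    by (auto simp: DDP_def encode_eq_iff)
  also have "\<dots> \<longleftrightarrow> (\<exists>\<tau>. T.matches \<tau>)" using T.min_drones_tiles by blast
  also have "\<dots> \<longleftrightarrow> (\<exists>x g. pattern M U w x g)" by (rule matches_iff_pattern[OF W N])
  finally show ?thesis .
qed

end

lemma polytime_main: "polytime_computable (\<lambda>w. exec main_com (input w) out)"
proof -
  define u where "u = smult c ([:1, 1:] ^ d)"
  let ?n = "[:0, 1:] :: nat poly"
  let ?w = "2 * u + ?n + 3"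
  let ?p = "?n + u + ?w + u * ?w + (u + 1) * ?w + [:1, 1:] ^ d"
  have u: "poly u n = size_of n" for n by (simp add: u_def size_of_def poly_power add.commute)
  have "length (exec main_com (input w) x) \<le> poly ?p (length w)" if "x \<in> loops main_com" for w x
    using exec_main_length[OF refl refl refl that, of w]
    by (simp add: u width_def poly_power)
  from polytime_computable_exec[OF wf_main used_main _ this] show ?thesis
    by (simp add: out_def)
qed

end

section \<open>Assembling the reduction from an arbitrary language in NP\<close>

lemma nat_poly_bound:
  fixes p :: "nat poly"
  shows "\<exists>c d. \<forall>n. poly p n \<le> c * (n + 1) ^ d"
proof (induction p)
  case 0
  then show ?case by simp
next
  case (pCons a p)
  then obtain c d where cd: "\<And>n. poly p n \<le> c * (n + 1) ^ d" by blast
  have "poly (pCons a p) n \<le> (a + c) * (n + 1) ^ Suc d" for n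
  proof -
    have "n * poly p n \<le> (n + 1) * (c * (n + 1) ^ d)" using cd by (intro mult_le_mono) auto
    moreover have "1 \<le> (n + 1) ^ Suc d" by (rule one_le_power) simp
    then have "a \<le> a * (n + 1) ^ Suc d" using mult_le_mono2[of 1 _ a] by simp
    ultimately show ?thesis by (simp add: algebra_simps)
  qed
  then show ?case by blast
qed

theorem theorem3p1: "NP_hard DDP"
  unfolding NP_hard_def
proof
  fix L assume "L \<in> NP"
  then obtain M and p :: "nat poly" where wf: "wf_tm M"
    and time: "\<And>w t c. (step M ^^ t) (init M w) c \<Longrightarrow> t \<le> poly p (length w)"
    and L: "\<And>w. w \<in> L \<longleftrightarrow> (\<exists>t c. (step M ^^ t) (init M w) c \<and> fst c = accept M)"
    unfolding NP_def by blast
  \<comment> \<open>The summand 2 provides the spare rows that \<open>accepting_imp_pattern\<close>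
    asks for.\<close>
  obtain c d where cd: "\<And>n. poly (p + 2) n \<le> c * (n + 1) ^ d" using nat_poly_bound by blast
  obtain ts where ts: "set ts = tiles M" using finite_list[OF finite_tiles[OF wf]] by blast
  define Y where "Y = 2 * length ts + 3"
  \<comment> \<open>The bound required of \<open>X\<close> itself serves as the exponent:
    \<open>s \<le> 2 ^ s\<close> holds without computing a logarithm, and \<open>s\<close> is a
    constant of the machine.\<close>
  define s where "s = 2 * (\<Sum>q<length ts. Y ^ (2 * to_nat (west (ts ! q))) + Y ^ (2 * to_nat (east (ts ! q))) +
      Y ^ Suc (2 * to_nat (south (ts ! q))) + Y ^ Suc (2 * to_nat (north (ts ! q))))"
  interpret tm_reduction M ts "2 ^ s" Y s c d
  proof
    show "2 * (\<Sum>q<length ts. Y ^ (2 * to_nat (west (ts ! q))) + Y ^ (2 * to_nat (east (ts ! q))) +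
      Y ^ Suc (2 * to_nat (south (ts ! q))) + Y ^ Suc (2 * to_nat (north (ts ! q)))) \<le> 2 ^ s"
      unfolding s_def[symmetric] using less_exp[of s] by simp
  qed (use wf ts in \<open>simp_all add: Y_def\<close>)
  have "w \<in> L \<longleftrightarrow> exec main_com (input w) out \<in> DDP" for w
  proof -
    have "t + 2 \<le> size_of (length w)" if "(step M ^^ t) (init M w) c'" for t c'
      using time[OF that] cd[of "length w"] by (simp add: size_of_def)
    then have "w \<in> L \<longleftrightarrow> (\<exists>x g. pattern M (size_of (length w)) w x g)"
      unfolding L using accepting_imp_pattern[OF wf] pattern_imp_accepting[OF _ wf] by blast
    then show ?thesis using main_correct[OF refl refl refl, of w] by simp
  qed
  then show "L \<le>\<^sub>p DDP"
    unfolding polytime_reducible_def using polytime_main by blast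
qed

end
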